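(* Let $X=(X_1,\ldots,X_N)$ be a family of independent random variables with $X_k$ taking values in a set $\Lambda_k$, let $f:\prod_{j\in[N]}\Lambda_j\to\mathbb{R}$ be a function and $\mu=\mathbb{E}f(X)$. Consider any query strategy for $f$ satisfying $q_{i+1}\ge q_i$ in each step, let $\mathcal{Q}$ be its collection of query sets, and let $(\gamma_k)_{k\in[N]}$ be numbers with $\gamma_k\in(0,1]$. Let $\phi(x)=(1+x)\log(1+x)-x$. Then the following hold. (1) Suppose there are numbers $(c_k)_{k\in[N]}$ such that $|f(x)-f(\tilde x)|\le c_k$ whenever $x,\tilde x\in\prod_{j\in[N]}\Lambda_j$ differ only in the $k$-th coordinate. Then for any $t\ge0$: (1a) $\mathbb{P}(f(X)\ge\mu+t)\le\exp\left(-\dfrac{2t^2}{\max_{Q\in\mathcal{Q}}\sum_{k\in Q}c_k^2}\right)$. (1b) If $\Lambda_k=\{0,1\}$ and $p_k=\mathbb{P}(X_k=1)$ for all $k$, then with $C=\max_{Q\in\mathcal{Q}}\max_{k\in Q}c_k$ and $V=\max_{Q\in\mathcal{Q}}\sum_{k\in Q}(1-p_k)p_kc_k^2$ we have $\mathbb{P}(f(X)\ge\mu+t)\le e^{-t^2/(2V+2Ct/3)}$, and this bound may be improved to $e^{-\frac{V}{C^2}\phi(Ct/V)}$ (whenever $V,C>0$). (1c) If $\max_{\eta\in\Lambda_k}\mathbb{P}(X_k=\eta)\ge1-p_k$ for all $k$, then $\mathbb{P}(f(X)\ge\mu+t)\le e^{-t^2/(2V'+2Ct/3)}$ with $V'=\max_{Q\in\mathcal{Q}}\sum_{k\in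 Q}p_kc_k^2$ and $C=\max_{Q\in\mathcal{Q}}\max_{k\in Q}c_k$. (2) Let $\Gamma\subseteq\prod_{j\in[N]}\Lambda_j$ be an event and let $(c_k)_{k\in[N]}$, $(d_k)_{k\in[N]}$ be numbers with $c_k\le d_k$. Suppose that one of the following holds: (i) whenever $x,\tilde x\in\prod_{j\in[N]}\Lambda_j$ differ only in the $k$-th coordinate, $|f(x)-f(\tilde x)|\le c_k$ if $x\in\Gamma$ and $|f(x)-f(\tilde x)|\le d_k$ otherwise; in this case set $e_k=\gamma_k(d_k-c_k)$; (ii) whenever $x,\tilde x\in\prod_{j\in[N]}\Lambda_j$ differ only in the $k$-th coordinate, $|f(x)-f(\tilde x)|\le c_k$ if $x,\tilde x\in\Gamma$ and $|f(x)-f(\tilde x)|\le d_k$ otherwise, and $\min_{\eta\in\Lambda_k}\mathbb{P}(X_k=\eta)\ge q_k>0$ for all $k$; in this case set $e_k=2\gamma_k(d_k-c_k)q_k^{-1}$. Then there is an event $\mathcal{B}=\mathcal{B}(\Gamma,(\gamma_k)_{k\in[N]})$ satisfying $\mathbb{P}(\mathcal{B})\le\sum_{k\in[N]}\gamma_k^{-1}\cdot\mathbb{P}(X\notin\Gamma)$ and $\neg\mathcal{B}\subseteq\Gamma$ such that, with $C=\max_{Q\in\mathcal{Q}}\max_{k\in Q}(c_k+e_k)$, for any $t\ge0$: (2a) $\mathbb{P}(f(X)\ge\mu+t\text{ and }\neg\mathcal{B})\le\exp\left(-\dfrac{t^2}{2\max_{Q\in\mathcal{Q}}\sum_{k\in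 Q}(c_k+e_k)^2}\right)$; if $|\Lambda_k|=2$ for all $k$, the exponent may be multiplied by a factor of $4$. (2b) If $\Lambda_k=\{0,1\}$ and $p_k=\mathbb{P}(X_k=1)$ for all $k$, then with $V=\max_{Q\in\mathcal{Q}}\sum_{k\in Q}(1-p_k)p_k(c_k+e_k)^2$ we have $\mathbb{P}(f(X)\ge\mu+t\text{ and }\neg\mathcal{B})\le e^{-t^2/(2V+2Ct/3)}$, and this bound may be improved to $e^{-\frac{V}{C^2}\phi(Ct/V)}$ (whenever $V,C>0$). If in addition (i) holds and $f$ and $\Gamma$ are either both monotone increasing or both monotone decreasing, then (when $\mathbb{P}(\mathcal{B})<1$) $$\mathbb{P}(f(X)\ge\mu+t)\le\frac{\mathbb{P}(f(X)\ge\mu+t\text{ and }\neg\mathcal{B})}{1-\mathbb{P}(\mathcal{B})}.$$ (2c) If $\max_{\eta\in\Lambda_k}\mathbb{P}(X_k=\eta)\ge1-p_k$ with $p_k\in[0,1)$ for all $k$, then $\mathbb{P}(f(X)\ge\mu+t\text{ and }\neg\mathcal{B})\le e^{-t^2/(2V'+2Ct/3)}$ with $V'=\max_{Q\in\mathcal{Q}}\sum_{k\in Q}p_k\left(c_k+e_k(1-p_k)^{-1}\right)^2$. (3) Let $\Gamma_k\subseteq\Lambda_k$ ($k\in[N]$) and $\Gamma\subseteq\prod_{j\in[N]}\Gamma_j$ be events, and let $(c_k)_{k\in[N]}$, $(d_k)_{k\in[N]}$ be numbers with $c_k\le d_k$ such that for all $x,\tilde x\in\prod_{j\in[N]}\Gamma_j$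 that differ only in the $k$-th coordinate, $|f(x)-f(\tilde x)|\le c_k$ if $x\in\Gamma$ and $|f(x)-f(\tilde x)|\le d_k$ otherwise. Suppose also that $|f(x)-f(\tilde x)|\le s$ for all $x,\tilde x\in\prod_{j\in[N]}\Lambda_j$. Set $\Delta=s\,\mathbb{P}(X\notin\Gamma)$ and $e_k=\gamma_k(d_k-c_k)$. Then there is an event $\mathcal{B}=\mathcal{B}(\Gamma,(\gamma_k)_{k\in[N]})$ satisfying $\mathbb{P}(\mathcal{B})\le\sum_{k\in[N]}\gamma_k^{-1}\cdot\mathbb{P}(X\notin\Gamma)$ and $\neg\mathcal{B}\subseteq\Gamma$ such that for any $t\ge0$ $$\mathbb{P}(f(X)\ge\mu+t+\Delta\text{ and }\neg\mathcal{B})\le\exp\left(-\frac{t^2}{2\max_{Q\in\mathcal{Q}}\sum_{k\in Q}(c_k+e_k)^2}\right).$$ If $\Gamma=\prod_{j\in[N]}\Gamma_j$, then one may set $\mathcal{B}=\neg\Gamma$, $e_k=0$ and multiply the exponent by a factor of $4$. Moreover, one may set $\Delta=0$ if $f(x)\ge f(\tilde x)$ whenever $x,\tilde x\in\prod_{j\in[N]}\Lambda_j$ differ only in their $k$-th coordinates $x_k\in\Lambda_k\setminus\Gamma_k$ and $\tilde x_k\in\Gamma_k$.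
   Context: $[N]=\{1,\ldots,N\}$. Each $\Lambda_k$ is a measurable space; events and functions are measurable. Events are identified with subsets of $\prod_{j\in[N]}\Lambda_j$; $\mathbb{P}(\mathcal{B})=\mathbb{P}(X\in\mathcal{B})$ and $\neg\mathcal{B}$ is the complement. The notation $\mathcal{B}=\mathcal{B}(\Gamma,(\gamma_k)_{k\in[N]})$ means that $\mathcal{B}$ depends only on $\Gamma$ and $(\gamma_k)$ (and the law of $X$), not on $f$, $t$ or the strategy. A function on $\{0,1\}^N$ is monotone increasing (decreasing) if it is so with respect to the coordinatewise order, and an event is increasing (decreasing) if its indicator function is. Query strategy: a strategy sequentially exposes the values $X_{q_1},X_{q_2},\ldots$ of distinct coordinates, where each index $q_i=q_i(X_{q_1},\ldots,X_{q_{i-1}})\in[N]$ may depend on the previous outcomes and indices (so $q_1$ is fixed), until the value of $f(X)$ is determined by the exposed values; by convention $q_{k+1}=q_k$ if $f(X)$ is determined by $(X_{q_1},\ldots,X_{q_k})$ with $k<N$, i.e. no new coordinates are exposed from then on. (A strategy is a decision tree computing $f$.) For every possible outcome of $X$ the set of queried indices is $Q=\{q_1,q_2,\ldots\}\subseteq[N]$, and $\mathcal{Q}$ denotes the set of all possible such query sets $Q$. *)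

theory Defs
  imports "HOL-Probability.Probability"
begin

abbreviation outcomes :: "nat \<Rightarrow> (nat \<Rightarrow> 'a measure) \<Rightarrow> (nat \<Rightarrow> 'a) set" where
  "outcomes N L \<equiv> (\<Pi>\<^sub>E k\<in>{1..N}. space (L k))"

definition tuple :: "nat \<Rightarrow> (nat \<Rightarrow> 'w \<Rightarrow> 'a) \<Rightarrow> 'w \<Rightarrow> (nat \<Rightarrow> 'a)" where
  "tuple N X \<omega> = (\<lambda>k\<in>{1..N}. X k \<omega>)"

definition differ_only :: "nat \<Rightarrow> (nat \<Rightarrow> 'a) \<Rightarrow> (nat \<Rightarrow> 'a) \<Rightarrow> bool" where
  "differ_only k x y \<longleftrightarrow> x k \<noteq> y k \<and> (\<forall>j. j \<noteq> k \<longrightarrow> x j = y j)"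

definition one_sided_lipschitz ::
  "nat \<Rightarrow> (nat \<Rightarrow> 'a) set \<Rightarrow> (nat \<Rightarrow> 'a) set \<Rightarrow> (nat \<Rightarrow> real) \<Rightarrow> (nat \<Rightarrow> real)
    \<Rightarrow> ((nat \<Rightarrow> 'a) \<Rightarrow> real) \<Rightarrow> bool" where
  "one_sided_lipschitz N S \<Gamma> c d f \<longleftrightarrow>
     (\<forall>k\<in>{1..N}. \<forall>x\<in>S. \<forall>y\<in>S. differ_only k x y \<longrightarrow>
        \<bar>f x - f y\<bar> \<le> (if x \<in> \<Gamma> then c k else d k))"

definition two_sided_lipschitz ::
  "nat \<Rightarrow> (nat \<Rightarrow> 'a) set \<Rightarrow> (nat \<Rightarrow> 'a) set \<Rightarrow> (nat \<Rightarrow> real) \<Rightarrow> (nat \<Rightarrow> real)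
    \<Rightarrow> ((nat \<Rightarrow> 'a) \<Rightarrow> real) \<Rightarrow> bool" where
  "two_sided_lipschitz N S \<Gamma> c d f \<longleftrightarrow>
     (\<forall>k\<in>{1..N}. \<forall>x\<in>S. \<forall>y\<in>S. differ_only k x y \<longrightarrow>
        \<bar>f x - f y\<bar> \<le> (if x \<in> \<Gamma> \<and> y \<in> \<Gamma> then c k else d k))"

definition determined_by ::
  "(nat \<Rightarrow> 'a) set \<Rightarrow> ((nat \<Rightarrow> 'a) \<Rightarrow> real) \<Rightarrow> nat set \<Rightarrow> (nat \<Rightarrow> 'a) \<Rightarrow> bool" where
  "determined_by S f J x \<longleftrightarrow> (\<forall>y\<in>S. (\<forall>j\<in>J. y j = x j) \<longrightarrow> f y = f x)"

text \<open>\<open>q i x\<close> is the index of the \<open>i\<close>-th query (\<open>1 \<le> i \<le> N\<close>) when the outcome is \<open>x\<close>. The second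
  conjunct says that it is a function of the values exposed before (so \<open>q 1\<close> is constant); the
  third that a new coordinate is exposed as long as \<open>f\<close> is undetermined, and that the last index is
  repeated from then on. The first query is always made, even if \<open>f\<close> is constant.\<close>

definition query_strategy ::
  "nat \<Rightarrow> (nat \<Rightarrow> 'a) set \<Rightarrow> ((nat \<Rightarrow> 'a) \<Rightarrow> real) \<Rightarrow> (nat \<Rightarrow> (nat \<Rightarrow> 'a) \<Rightarrow> nat) \<Rightarrow> bool" where
  "query_strategy N S f q \<longleftrightarrow>
     (\<forall>x\<in>S. \<forall>i\<in>{1..N}. q i x \<in> {1..N}) \<and>
     (\<forall>x\<in>S. \<forall>y\<in>S. \<forall>i\<in>{1..N}.
        (\<forall>j\<in>{1..<i}. x (q j x) = y (q j y)) \<longrightarrow> q i x = q i y) \<and>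
     (\<forall>x\<in>S. \<forall>i\<in>{1..<N}. let J = (\<lambda>j. q j x) ` {1..i} in
        if determined_by S f J x then q (Suc i) x = q i x else q (Suc i) x \<notin> J)"

definition increasing_queries ::
  "nat \<Rightarrow> (nat \<Rightarrow> 'a) set \<Rightarrow> (nat \<Rightarrow> (nat \<Rightarrow> 'a) \<Rightarrow> nat) \<Rightarrow> bool" where
  "increasing_queries N S q \<longleftrightarrow> (\<forall>x\<in>S. \<forall>i\<in>{1..<N}. q i x \<le> q (Suc i) x)"

definition query_sets ::
  "nat \<Rightarrow> (nat \<Rightarrow> 'a) set \<Rightarrow> (nat \<Rightarrow> (nat \<Rightarrow> 'a) \<Rightarrow> nat) \<Rightarrow> nat set set" where
  "query_sets N S q = (\<lambda>x. (\<lambda>i. q i x) ` {1..N}) ` S"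

text \<open>\<open>exp (- a / b)\<close> for \<open>a \<ge> 0\<close>, with the limiting value at \<open>b = 0\<close> (so 0 when \<open>a > 0\<close>) in place
  of the value 1 that \<open>a / 0 = 0\<close> would give.\<close>

definition exp_neg_ratio :: "real \<Rightarrow> real \<Rightarrow> real" where
  "exp_neg_ratio a b = (if b = 0 then (if a = 0 then 1 else 0) else exp (- a / b))"

definition phi :: "real \<Rightarrow> real" where
  "phi x = (1 + x) * ln (1 + x) - x"

definition binary_spaces :: "nat \<Rightarrow> (nat \<Rightarrow> 'a::zero_neq_one measure) \<Rightarrow> bool" where
  "binary_spaces N L \<longleftrightarrow> (\<forall>k\<in>{1..N}. space (L k) = {0, 1} \<and> sets (L k) = Pow {0, 1})"

text \<open>The coordinatewise order induced by \<open>0 < 1\<close>; the type of values need not be ordered.\<close>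

definition cube_le :: "nat \<Rightarrow> (nat \<Rightarrow> 'a::zero_neq_one) \<Rightarrow> (nat \<Rightarrow> 'a) \<Rightarrow> bool" where
  "cube_le N x y \<longleftrightarrow> (\<forall>k\<in>{1..N}. x k = y k \<or> x k = 0 \<and> y k = 1)"

definition cube_increasing :: "nat \<Rightarrow> ((nat \<Rightarrow> 'a::zero_neq_one) \<Rightarrow> real) \<Rightarrow> bool" where
  "cube_increasing N g \<longleftrightarrow>
     (\<forall>x\<in>{1..N} \<rightarrow>\<^sub>E {0, 1}. \<forall>y\<in>{1..N} \<rightarrow>\<^sub>E {0, 1}. cube_le N x y \<longrightarrow> g x \<le> g y)"

definition cube_decreasing :: "nat \<Rightarrow> ((nat \<Rightarrow> 'a::zero_neq_one) \<Rightarrow> real) \<Rightarrow> bool" where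
  "cube_decreasing N g \<longleftrightarrow>
     (\<forall>x\<in>{1..N} \<rightarrow>\<^sub>E {0, 1}. \<forall>y\<in>{1..N} \<rightarrow>\<^sub>E {0, 1}. cube_le N x y \<longrightarrow> g y \<le> g x)"

definition exceptional_event ::
  "'w measure \<Rightarrow> nat \<Rightarrow> (nat \<Rightarrow> 'a measure) \<Rightarrow> (nat \<Rightarrow> 'w \<Rightarrow> 'a) \<Rightarrow> (nat \<Rightarrow> 'a) set
    \<Rightarrow> (nat \<Rightarrow> real) \<Rightarrow> (nat \<Rightarrow> 'a) set \<Rightarrow> bool" where
  "exceptional_event P N L X \<Gamma> \<gamma> B \<longleftrightarrow>
     B \<in> sets (Pi\<^sub>M {1..N} L) \<and>
     \<P>(\<omega> in P. tuple N X \<omega> \<in> B) \<le> (\<Sum>k\<in>{1..N}. inverse (\<gamma> k)) * \<P>(\<omega> in P. tuple N X \<omega> \<notin> \<Gamma>) \<and>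
     outcomes N L - B \<subseteq> \<Gamma>"

end

theory Submission
  imports Defs
begin

text \<open>Let \<open>g\<^sub>k\<close> be the average of \<open>f\<close> given the first \<open>k\<close> coordinates. Going down from
  \<open>k = N\<close>, the moment generating function of \<open>f\<close> is bounded coordinate by coordinate, and a
  coordinate that is not queried costs nothing: as queries increase, whether \<open>k\<close> is queried depends
  on the coordinates below \<open>k\<close> only, and if it is not then \<open>f\<close> ignores it. So only
  the worst query set is paid for. The exceptional event is the complement of \<open>\<Gamma>\<close> together with
  all points that have, for some \<open>k\<close>, conditional probability above \<open>\<gamma>\<^sub>k\<close> of leaving \<open>\<Gamma>\<close> given
  their coordinates below \<open>k\<close>; by Markov's inequality it is rare, and outside of it the increments
  \<open>g\<^sub>k - g\<^sub>k\<^sub>-\<^sub>1\<close> are at most \<open>c\<^sub>k + e\<^sub>k\<close>. Hoeffding's lemma and Bennett's inequality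
  bound the individual steps. For (3) the same argument is run for the product of the factors
  conditioned on \<open>\<Gamma>\<^sub>k\<close>, under which leaving \<open>\<Gamma>\<close> is even less likely; the monotone
  case of (2b) is Harris' inequality, since the complement of the exceptional event inherits the
  monotonicity of \<open>\<Gamma>\<close>.\<close>

section \<open>Averages over the last coordinates of a product space\<close>

text \<open>Every bound is wanted at each point of an event, so conditional expectations are taken
  in the pointwise version that integrates over an independent copy of the remaining coordinates.
  The coordinates are always revealed in their natural order, whatever the strategy asks. This keeps
  the exceptional event independent of \<open>f\<close> and of the strategy, and it is why the
  queries must increase: it is then known before a coordinate is revealed whether it will be
  queried. The obstacle is that increments are under control only outside the exceptional event,
  while a moment generating function averages over all points. The good event is therefore kept as
  an indicator inside the expectation. An increment depends on the prefix alone, so either some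
  point of the good event has the given prefix and the bound may be read off there, or the indicator
  kills the average. A distance \<open>m\<close> to the mean gives a range of \<open>2 * m\<close>
  only; whenever the range itself is at most \<open>m\<close>, as for two points, the exponent gains
  the factor 4.\<close>

declare One_nat_def [simp del]


text \<open>All of \<open>z\<close> will be drawn, although only its coordinates above
  \<open>k\<close> survive: the others integrate out, and everything stays on one product. Index 0
  lies outside \<open>{1..N}\<close>, where points of the product agree.\<close>

definition mix :: "nat \<Rightarrow> (nat \<Rightarrow> 'a) \<Rightarrow> (nat \<Rightarrow> 'a) \<Rightarrow> (nat \<Rightarrow> 'a)" where
  "mix k x z = (\<lambda>j. if j \<le> k then x j else z j)"

lemma mix_cong: "(\<And>j. j \<le> k \<Longrightarrow> x j = y j) \<Longrightarrow> mix k x z = mix k y z"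
  by (auto simp: mix_def)

text \<open>Drawing coordinate \<open>k + 1\<close> in the tail is the same as prescribing it in the
  prefix; the recursion \<open>avg_step\<close> rests on this.\<close>

lemma mix_fun_upd: "mix k x (z(Suc k := y)) = mix (Suc k) (x(Suc k := y)) z"
  by (auto simp: mix_def fun_eq_iff le_Suc_eq)

lemma mix_mem_PiE: "x \<in> Pi\<^sub>E I S \<Longrightarrow> z \<in> Pi\<^sub>E I S \<Longrightarrow> mix k x z \<in> Pi\<^sub>E I S"
  by (auto simp: mix_def PiE_def Pi_def extensional_def)

lemma fun_upd_mem_PiE:
  "x \<in> Pi\<^sub>E I S \<Longrightarrow> k \<in> I \<Longrightarrow> y \<in> S k \<Longrightarrow> x(k := y) \<in> Pi\<^sub>E I S"
  by (auto simp: PiE_def Pi_def extensional_def)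

locale fin_prod =
  fixes N :: nat and M :: "nat \<Rightarrow> 'a measure"
  assumes prob_space_factor: "k \<in> {1..N} \<Longrightarrow> prob_space (M k)"
begin

abbreviation "PM \<equiv> PiM {1..N} M"

lemma space_PM: "space PM = (\<Pi>\<^sub>E k\<in>{1..N}. space (M k))"
  by (rule space_PiM)

sublocale PM: prob_space PM
  by (intro prob_space_PiM prob_space_factor)

text \<open>Boundedness makes every function that occurs integrable, over the product and over
  single factors, and it survives averages, products and exponentials.\<close>

definition bm :: "((nat \<Rightarrow> 'a) \<Rightarrow> real) \<Rightarrow> bool" where
  "bm F \<longleftrightarrow> F \<in> borel_measurable PM \<and> (\<exists>K. \<forall>x\<in>space PM. \<bar>F x\<bar> \<le> K)"

definition avg :: "nat \<Rightarrow> ((nat \<Rightarrow> 'a) \<Rightarrow> real) \<Rightarrow> (nat \<Rightarrow> 'a) \<Rightarrow> real" where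
  "avg k F x = (\<integral>z. F (mix k x z) \<partial>PM)"

lemma mix_space: "x \<in> space PM \<Longrightarrow> z \<in> space PM \<Longrightarrow> mix k x z \<in> space PM"
  unfolding space_PM by (rule mix_mem_PiE)

lemma upd_space: "x \<in> space PM \<Longrightarrow> k \<in> {1..N} \<Longrightarrow> y \<in> space (M k) \<Longrightarrow> x(k := y) \<in> space PM"
  unfolding space_PM by (rule fun_upd_mem_PiE)

lemma measurable_mix_pair: "(\<lambda>(x, z). mix k x z) \<in> PM \<Otimes>\<^sub>M PM \<rightarrow>\<^sub>M PM"
proof (rule measurable_PiM_single')
  fix i assume i: "i \<in> {1..N}"
  have [measurable]: "(\<lambda>x. x i) \<in> PM \<rightarrow>\<^sub>M M i"
    using i by (rule measurable_component_singleton)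
  show "(\<lambda>w. (case w of (x, z) \<Rightarrow> mix k x z) i) \<in> PM \<Otimes>\<^sub>M PM \<rightarrow>\<^sub>M M i"
    by (cases "i \<le> k") (simp_all add: mix_def case_prod_beta)
next
  show "(\<lambda>w i. (case w of (x, z) \<Rightarrow> mix k x z) i)
        \<in> space (PM \<Otimes>\<^sub>M PM) \<rightarrow> (\<Pi>\<^sub>E i\<in>{1..N}. space (M i))"
    using mix_space by (auto simp: space_pair_measure space_PM[symmetric])
qed

lemma measurable_mix: "x \<in> space PM \<Longrightarrow> mix k x \<in> PM \<rightarrow>\<^sub>M PM"
  using measurable_Pair2[OF measurable_mix_pair] by simp

lemma measurable_upd:
  assumes "x \<in> space PM" "k \<in> {1..N}"
  shows "(\<lambda>y. x(k := y)) \<in> M k \<rightarrow>\<^sub>M PM"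
proof (rule measurable_PiM_single')
  fix i assume i: "i \<in> {1..N}"
  have "x i \<in> space (M i)" using assms(1) i by (auto simp: space_PM)
  then show "(\<lambda>y. (x(k := y)) i) \<in> M k \<rightarrow>\<^sub>M M i"
    by (cases "i = k") auto
next
  show "(\<lambda>y i. (x(k := y)) i) \<in> space (M k) \<rightarrow> (\<Pi>\<^sub>E i\<in>{1..N}. space (M i))"
    using upd_space[OF assms] by (auto simp: space_PM[symmetric] fun_upd_def)
qed

lemma bm_measurable: "bm F \<Longrightarrow> F \<in> borel_measurable PM"
  by (simp add: bm_def)

lemma bm_bound: "bm F \<Longrightarrow> \<exists>K. \<forall>x\<in>space PM. \<bar>F x\<bar> \<le> K"
  by (simp add: bm_def)

lemma bm_avg_integrable:
  assumes "bm F" "x \<in> space PM"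
  shows "integrable PM (\<lambda>z. F (mix k x z))"
proof -
  obtain K where K: "\<And>x. x \<in> space PM \<Longrightarrow> \<bar>F x\<bar> \<le> K"
    using bm_bound[OF assms(1)] by auto
  have "(\<lambda>z. F (mix k x z)) \<in> borel_measurable PM"
    using measurable_compose[OF measurable_mix[OF assms(2)] bm_measurable[OF assms(1)]] .
  then show ?thesis
    using K mix_space[OF assms(2)] by (intro PM.integrable_const_bound[where B = K]) auto
qed

lemma bm_integrable: "bm F \<Longrightarrow> integrable PM F"
  using PM.integrable_const_bound[of F] AE_I2[of PM] unfolding bm_def by (metis real_norm_def)

lemma avg_cong: "(\<And>j. j \<le> k \<Longrightarrow> x j = y j) \<Longrightarrow> avg k F x = avg k F y"
  unfolding avg_def using mix_cong[of k x y] by simp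

lemma avg_mix: "avg k F (mix k x z) = avg k F x"
  by (rule avg_cong) (simp add: mix_def)

lemma bm_avg: 
  assumes "bm F"
  shows "bm (avg k F)"
proof -
  obtain K where K: "\<And>x. x \<in> space PM \<Longrightarrow> \<bar>F x\<bar> \<le> K"
    using bm_bound[OF assms] by auto
  have "(\<lambda>(x, z). F (mix k x z)) \<in> borel_measurable (PM \<Otimes>\<^sub>M PM)"
    using measurable_compose[OF measurable_mix_pair bm_measurable[OF assms]]
    by (simp add: case_prod_beta)
  then have "avg k F \<in> borel_measurable PM"
    unfolding avg_def by (rule PM.borel_measurable_lebesgue_integral)
  moreover have "\<bar>avg k F x\<bar> \<le> K" if x: "x \<in> space PM" for x
  proof -
    have "\<bar>avg k F x\<bar> \<le> (\<integral>z. \<bar>F (mix k x z)\<bar> \<partial>PM)"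
      unfolding avg_def by (rule integral_abs_bound)
    also have "\<dots> \<le> (\<integral>z. K \<partial>PM)"
      using K mix_space[OF x] bm_avg_integrable[OF assms x] by (intro integral_mono) auto
    finally show ?thesis by (simp add: PM.prob_space)
  qed
  ultimately show ?thesis unfolding bm_def by blast
qed

lemma bm_const: "bm (\<lambda>_. c)"
  unfolding bm_def by auto

lemma bm_minus: assumes "bm F" "bm G" shows "bm (\<lambda>x. F x - G x)"
proof -
  obtain K K' where "\<And>x. x \<in> space PM \<Longrightarrow> \<bar>F x\<bar> \<le> K" "\<And>x. x \<in> space PM \<Longrightarrow> \<bar>G x\<bar> \<le> K'"
    using bm_bound[OF assms(1)] bm_bound[OF assms(2)] by auto
  then have "\<bar>F x - G x\<bar> \<le> K + K'" if "x \<in> space PM" for x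
    using that by (smt (verit))
  then show ?thesis using assms unfolding bm_def by auto
qed

lemma bm_mult: assumes "bm F" "bm G" shows "bm (\<lambda>x. F x * G x)"
proof -
  obtain K K' where *: "\<And>x. x \<in> space PM \<Longrightarrow> \<bar>F x\<bar> \<le> K" "\<And>x. x \<in> space PM \<Longrightarrow> \<bar>G x\<bar> \<le> K'"
    using bm_bound[OF assms(1)] bm_bound[OF assms(2)] by auto
  have "\<bar>F x * G x\<bar> \<le> K * K'" if "x \<in> space PM" for x
    unfolding abs_mult using *[OF that] by (intro mult_mono) auto
  then show ?thesis using assms unfolding bm_def by auto
qed

lemma bm_exp: assumes "bm F" shows "bm (\<lambda>x. exp (l * F x))"
proof -
  obtain K where *: "\<And>x. x \<in> space PM \<Longrightarrow> \<bar>F x\<bar> \<le> K"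
    using bm_bound[OF assms(1)] by auto
  have "\<bar>exp (l * F x)\<bar> \<le> exp (\<bar>l\<bar> * K)" if "x \<in> space PM" for x
  proof -
    have "l * F x \<le> \<bar>l\<bar> * \<bar>F x\<bar>" by (metis abs_ge_self abs_mult)
    also have "\<dots> \<le> \<bar>l\<bar> * K" using *[OF that] by (intro mult_left_mono) auto
    finally show ?thesis by simp
  qed
  then show ?thesis using assms unfolding bm_def by auto
qed

lemma bm_indicator: "E \<in> sets PM \<Longrightarrow> bm (indicator E)"
  unfolding bm_def by (auto simp: indicator_def intro!: exI[of _ 1])

lemma avg_top:
  assumes "bm F" "x \<in> space PM"
  shows "avg N F x = F x"
proof -
  have "avg N F x = (\<integral>z. F x \<partial>PM)"
    unfolding avg_def
  proof (rule Bochner_Integration.integral_cong[OF refl])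
    fix z assume z: "z \<in> space PM"
    have "mix N x z = x"
      using assms(2) z by (auto simp: space_PM mix_def PiE_def extensional_def fun_eq_iff)
    then show "F (mix N x z) = F x" by simp
  qed
  then show ?thesis by (simp add: PM.prob_space)
qed

lemma mix_0: "x \<in> space PM \<Longrightarrow> z \<in> space PM \<Longrightarrow> mix 0 x z = z"
  by (auto simp: space_PM mix_def PiE_def extensional_def fun_eq_iff)

lemma avg_0: 
  assumes "x \<in> space PM"
  shows "avg 0 F x = (\<integral>z. F z \<partial>PM)"
  unfolding avg_def
  by (rule Bochner_Integration.integral_cong[OF refl]) (simp add: mix_0[OF assms])

lemma bm_coord:
  assumes "bm F" "x \<in> space PM" "k \<in> {1..N}"
  shows "(\<lambda>y. F (x(k := y))) \<in> borel_measurable (M k)"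
    and "\<exists>K. \<forall>y\<in>space (M k). \<bar>F (x(k := y))\<bar> \<le> K"
    and "integrable (M k) (\<lambda>y. F (x(k := y)))"
proof -
  interpret Mk: prob_space "M k" by (rule prob_space_factor[OF assms(3)])
  show 1: "(\<lambda>y. F (x(k := y))) \<in> borel_measurable (M k)"
    using measurable_compose[OF measurable_upd[OF assms(2,3)] bm_measurable[OF assms(1)]] .
  show 2: "\<exists>K. \<forall>y\<in>space (M k). \<bar>F (x(k := y))\<bar> \<le> K"
    using bm_bound[OF assms(1)] upd_space[OF assms(2,3)] by blast
  then obtain K where "\<And>y. y \<in> space (M k) \<Longrightarrow> \<bar>F (x(k := y))\<bar> \<le> K" by auto
  then show "integrable (M k) (\<lambda>y. F (x(k := y)))"
    using 1 by (intro Mk.integrable_const_bound[where B = K]) auto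
qed

text \<open>The tower property for one coordinate. Redrawing coordinate \<open>k + 1\<close>
  independently does not change the product measure, and Fubini's theorem then separates that
  coordinate.\<close>

lemma avg_step:
  assumes F: "bm F" and x: "x \<in> space PM" and k: "k < N"
  shows "avg k F x = (\<integral>y. avg (Suc k) F (x(Suc k := y)) \<partial>M (Suc k))"
proof -
  have sk: "Suc k \<in> {1..N}" using k by simp
  interpret Mk: prob_space "M (Suc k)" by (rule prob_space_factor[OF sk])
  interpret pair: pair_prob_space "M (Suc k)" PM ..
  have ins: "insert (Suc k) {1..N} = {1..N}" using sk by auto
  \<comment> \<open>The inserted index is already present, so the pushforward is the product measure
    itself.\<close>
  have D: "distr (M (Suc k) \<Otimes>\<^sub>M PM) PM (\<lambda>(y, z). z(Suc k := y)) = PM"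
    using distr_pair_PiM_eq_PiM[of "{1..N}" M "Suc k"] prob_space_factor sk
    by (simp add: ins)
  have upd: "(\<lambda>(y, z). z(Suc k := y)) \<in> M (Suc k) \<Otimes>\<^sub>M PM \<rightarrow>\<^sub>M PM"
  proof (rule measurable_PiM_single')
    fix i assume i: "i \<in> {1..N}"
    have [measurable]: "(\<lambda>x. x i) \<in> PM \<rightarrow>\<^sub>M M i"
      using i by (rule measurable_component_singleton)
    show "(\<lambda>w. (case w of (y, z) \<Rightarrow> z(Suc k := y)) i) \<in> M (Suc k) \<Otimes>\<^sub>M PM \<rightarrow>\<^sub>M M i"
      by (cases "i = Suc k") (simp_all add: case_prod_beta)
  next
    show "(\<lambda>w i. (case w of (y, z) \<Rightarrow> z(Suc k := y)) i)
          \<in> space (M (Suc k) \<Otimes>\<^sub>M PM) \<rightarrow> (\<Pi>\<^sub>E i\<in>{1..N}. space (M i))"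
      using upd_space[OF _ sk] by (auto simp: space_pair_measure space_PM[symmetric])
  qed
  have meas: "(\<lambda>z. F (mix k x z)) \<in> borel_measurable PM"
    using measurable_compose[OF measurable_mix[OF x] bm_measurable[OF F]] .
  obtain K where K: "\<And>x. x \<in> space PM \<Longrightarrow> \<bar>F x\<bar> \<le> K"
    using bm_bound[OF F] by auto
  have meas2: "(\<lambda>(y, z). F (mix (Suc k) (x(Suc k := y)) z))
      \<in> borel_measurable (M (Suc k) \<Otimes>\<^sub>M PM)"
    using measurable_compose[OF upd meas] by (simp add: case_prod_beta mix_fun_upd)
  have int: "integrable (M (Suc k) \<Otimes>\<^sub>M PM) (\<lambda>(y, z). F (mix (Suc k) (x(Suc k := y)) z))"
    using meas2 K mix_space[OF upd_space[OF x sk]]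
    by (intro pair.P.integrable_const_bound[where B = K]) (auto simp: space_pair_measure)
  have "avg k F x = (\<integral>z. F (mix k x z) \<partial>distr (M (Suc k) \<Otimes>\<^sub>M PM) PM (\<lambda>(y, z). z(Suc k := y)))"
    by (simp only: D avg_def)
  also have "\<dots> = (\<integral>w. (case w of (y, z) \<Rightarrow> F (mix (Suc k) (x(Suc k := y)) z)) \<partial>(M (Suc k) \<Otimes>\<^sub>M PM))"
    by (subst integral_distr[OF upd meas]) (simp add: case_prod_beta' mix_fun_upd)
  also have "\<dots> = (\<integral>y. avg (Suc k) F (x(Suc k := y)) \<partial>M (Suc k))"
    unfolding avg_def by (rule pair.integral_fst[OF int, symmetric])
  finally show ?thesis .
qed

end

section \<open>Moment generating functions in one coordinate\<close>

lemma exp_remainder2_sums: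
  fixes u :: real
  shows "(\<lambda>n. u ^ (n + 2) / fact (n + 2)) sums (exp u - 1 - u)"
proof -
  have "(\<lambda>n. u ^ n / fact n) sums exp u"
    using exp_converges[of u] by (simp add: divide_inverse mult.commute)
  from sums_split_initial_segment[OF this, of 2] show ?thesis
    by (simp add: numeral_2_eq_2 algebra_simps)
qed

text \<open>Since \<open>(1 - u + u\<^sup>2 / 2) * (1 + u + u\<^sup>2 / 2)\<close> is
  \<open>1 + u ^ 4 / 4\<close>, the Taylor bound for \<open>exp (- u)\<close> can be
  inverted.\<close>

lemma exp_le_quadratic_nonpos:
  fixes u :: real
  assumes "u \<le> 0"
  shows "exp u \<le> 1 + u + u\<^sup>2 / 2"
proof -
  have pos: "0 < 1 + u + u\<^sup>2 / 2"
    using zero_le_power2[of "u + 1"] by (simp add: power2_eq_square algebra_simps)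
  have "1 \<le> (1 - u + u\<^sup>2 / 2) * (1 + u + u\<^sup>2 / 2)"
  proof -
    have "(1 - u + u\<^sup>2 / 2) * (1 + u + u\<^sup>2 / 2) = 1 + (u\<^sup>2)\<^sup>2 / 4"
      by (simp add: power2_eq_square algebra_simps)
    then show ?thesis by simp
  qed
  also have "\<dots> \<le> exp (- u) * (1 + u + u\<^sup>2 / 2)"
    using exp_lower_Taylor_quadratic[of "- u"] assms pos by (intro mult_right_mono) auto
  finally show ?thesis by (simp add: exp_minus field_simps)
qed

text \<open>The ratio of \<open>exp u - 1 - u\<close> to \<open>u\<^sup>2\<close> increases with
  \<open>u\<close>. Positive arguments are compared term by term in the series; for the others the
  value 1/2 at the origin separates the two ratios.\<close>

lemma exp_le_bennett:
  fixes u b :: real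
  assumes "u \<le> b" "0 < b"
  shows "exp u \<le> 1 + u + u\<^sup>2 * ((exp b - 1 - b) / b\<^sup>2)"
proof (cases "u \<le> 0")
  case True
  have "1 / 2 \<le> (exp b - 1 - b) / b\<^sup>2"
    using exp_lower_Taylor_quadratic[of b] assms by (simp add: field_simps)
  then have "u\<^sup>2 * (1 / 2) \<le> u\<^sup>2 * ((exp b - 1 - b) / b\<^sup>2)"
    by (intro mult_left_mono) auto
  then show ?thesis using exp_le_quadratic_nonpos[OF True] by linarith
next
  case False
  have "(exp u - 1 - u) * b\<^sup>2 \<le> u\<^sup>2 * (exp b - 1 - b)"
  proof (rule sums_le)
    show "(\<lambda>n. u ^ (n + 2) / fact (n + 2) * b\<^sup>2) sums ((exp u - 1 - u) * b\<^sup>2)"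
      by (intro sums_mult2 exp_remainder2_sums)
    show "(\<lambda>n. u\<^sup>2 * (b ^ (n + 2) / fact (n + 2))) sums (u\<^sup>2 * (exp b - 1 - b))"
      by (intro sums_mult exp_remainder2_sums)
    fix n
    have "u ^ n * (u\<^sup>2 * b\<^sup>2) \<le> b ^ n * (u\<^sup>2 * b\<^sup>2)"
      using False assms by (intro mult_right_mono power_mono) auto
    then show "u ^ (n + 2) / fact (n + 2) * b\<^sup>2 \<le> u\<^sup>2 * (b ^ (n + 2) / fact (n + 2))"
      by (simp add: power_add power2_eq_square divide_simps mult_ac del: fact_Suc)
  qed
  then show ?thesis using assms by (simp add: field_simps)
qed

text \<open>Comparison with a geometric series through \<open>2 * 3 ^ n \<le> fact (n + 2)\<close>;
  this is the source of the 3 in the Bernstein denominators.\<close>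

lemma exp_remainder2_le_bernstein:
  fixes u :: real
  assumes "0 \<le> u" "u < 3"
  shows "exp u - 1 - u \<le> u\<^sup>2 / (2 * (1 - u / 3))"
proof -
  have fact_ge: "2 * 3 ^ n \<le> (fact (n + 2) :: real)" for n
  proof (induction n)
    case (Suc n)
    have "(3::real) * (2 * 3 ^ n) \<le> (of_nat n + 3) * fact (n + 2)"
      using Suc by (intro mult_mono) auto
    then show ?case by (simp add: algebra_simps)
  qed (simp add: numeral_2_eq_2)
  have "(\<lambda>n. (u / 3) ^ n) sums (1 / (1 - u / 3))"
    using assms by (intro geometric_sums) auto
  from sums_mult[OF this, of "u\<^sup>2 / 2"]
  have "(\<lambda>n. u\<^sup>2 / 2 * (u / 3) ^ n) sums (u\<^sup>2 / (2 * (1 - u / 3)))" by simp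
  then show ?thesis
  proof (rule sums_le[OF _ exp_remainder2_sums, rotated])
    fix n
    have "u ^ (n + 2) / fact (n + 2) \<le> u ^ (n + 2) / (2 * 3 ^ n)"
      using fact_ge[of n] assms by (intro divide_left_mono mult_pos_pos) auto
    then show "u ^ (n + 2) / fact (n + 2) \<le> u\<^sup>2 / 2 * (u / 3) ^ n"
      by (simp add: power_add power_divide power2_eq_square mult_ac del: fact_Suc)
  qed
qed

text \<open>An atom \<open>\<eta>\<close> of mass at least \<open>m\<close>, without asking for the singleton of \<open>\<eta>\<close> to be
  measurable.\<close>

definition atom_mass :: "'a measure \<Rightarrow> 'a \<Rightarrow> real \<Rightarrow> bool" where
  "atom_mass M \<eta> m \<longleftrightarrow> \<eta> \<in> space M \<and>
     (\<forall>u\<in>borel_measurable M. \<forall>B. (\<forall>y\<in>space M. 0 \<le> u y \<and> u y \<le> B) \<longrightarrow>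
        m * u \<eta> \<le> (\<integral>y. u y \<partial>M))"

lemma atom_massD:
  fixes B :: real
  assumes "atom_mass M \<eta> m" "u \<in> borel_measurable M"
    "\<And>y. y \<in> space M \<Longrightarrow> 0 \<le> u y" "\<And>y. y \<in> space M \<Longrightarrow> u y \<le> B"
  shows "m * u \<eta> \<le> (\<integral>y. u y \<partial>M)"
  using assms unfolding atom_mass_def by blast

lemma atom_mass_space: "atom_mass M \<eta> m \<Longrightarrow> \<eta> \<in> space M"
  by (simp add: atom_mass_def)

section \<open>One increment: deviation, range, variance, moment generating function\<close>

context prob_space
begin

lemma abs_diff_expectation_le:
  fixes h u :: "'a \<Rightarrow> real"
  assumes "integrable M h" "integrable M u" "\<And>y'. y' \<in> space M \<Longrightarrow> \<bar>h y - h y'\<bar> \<le> u y'"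
  shows "\<bar>h y - expectation h\<bar> \<le> expectation u"
proof -
  have "h y - expectation h = (\<integral>y'. h y - h y' \<partial>M)"
    using assms(1) by (simp add: prob_space)
  also have "\<bar>\<dots>\<bar> \<le> (\<integral>y'. \<bar>h y - h y'\<bar> \<partial>M)" by (rule integral_abs_bound)
  also have "\<dots> \<le> expectation u"
    using assms by (intro integral_mono) auto
  finally show ?thesis .
qed

text \<open>Here \<open>h\<close> is an average as a function of the newest coordinate and
  \<open>a\<close> the probability of leaving \<Gamma> at that stage. Single values of
  \<open>a\<close> may be large but its mean is not, so the failure is charged to the argument that
  is averaged out. If there is a second point, \<open>c\<close> is nonnegative, which covers the
  diagonal \<open>y' = y\<close>; if not, \<open>h\<close> equals its mean.\<close>

lemma one_sided_deviation:
  fixes h a :: "'a \<Rightarrow> real"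
  assumes h: "integrable M h" and a: "integrable M a" "\<And>y. y \<in> space M \<Longrightarrow> 0 \<le> a y"
    "expectation a \<le> g" and cd: "c \<le> d"
    and lip: "\<And>y y'. y \<in> space M \<Longrightarrow> y' \<in> space M \<Longrightarrow> y \<noteq> y' \<Longrightarrow>
       0 \<le> c \<and> \<bar>h y - h y'\<bar> \<le> c + (d - c) * a y'"
    and y: "y \<in> space M"
  shows "\<bar>h y - expectation h\<bar> \<le> max 0 (c + g * (d - c))"
proof (cases "\<exists>y'\<in>space M. y' \<noteq> y")
  case True
  have "\<bar>h y - expectation h\<bar> \<le> (\<integral>y'. c + (d - c) * a y' \<partial>M)"
  proof (rule abs_diff_expectation_le[OF h])
    fix y' assume y': "y' \<in> space M"
    have "0 \<le> c" using True y lip by blast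
    then show "\<bar>h y - h y'\<bar> \<le> c + (d - c) * a y'"
      using lip[OF y y'] a(2)[OF y'] cd by (cases "y = y'") auto
  qed (use a in auto)
  also have "\<dots> = c + (d - c) * expectation a" using a by (simp add: prob_space)
  also have "\<dots> \<le> c + (d - c) * g" using a(3) cd by (intro add_left_mono mult_left_mono) auto
  finally show ?thesis by (simp add: mult.commute)
next
  case False
  then have "\<bar>h y - expectation h\<bar> \<le> (\<integral>y'. 0 \<partial>M)"
    by (intro abs_diff_expectation_le[OF h]) auto
  then show ?thesis by simp
qed

text \<open>The smaller of two values of \<open>a\<close> is at most the mean, and by symmetry the
  failure can be charged to that point. So the whole range is bounded, not just the distance to the
  mean.\<close>

lemma one_sided_range_two_points:
  fixes h a :: "'a \<Rightarrow> real"
  assumes a: "integrable M a" "expectation a \<le> g" and cd: "c \<le> d"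
    and lip: "\<And>y y'. y \<in> space M \<Longrightarrow> y' \<in> space M \<Longrightarrow> y \<noteq> y' \<Longrightarrow>
       0 \<le> c \<and> \<bar>h y - h y'\<bar> \<le> c + (d - c) * a y'"
    and card: "card (space M) = 2" and y: "y \<in> space M" "y' \<in> space M"
  shows "\<bar>h y - h y'\<bar> \<le> max 0 (c + g * (d - c))"
proof (cases "y = y'")
  case False
  have space: "space M = {y, y'}"
    using card y False by (metis card_2_iff doubleton_eq_iff insertE singletonD)
  have "min (a y) (a y') = (\<integral>_. min (a y) (a y') \<partial>M)" by (simp add: prob_space)
  also have "\<dots> \<le> expectation a"
    using a(1) by (intro integral_mono) (auto simp: space)
  finally have *: "a y \<le> g \<or> a y' \<le> g" using a(2) by linarith
  have "\<bar>h y - h y'\<bar> \<le> c + (d - c) * g"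
    using *
  proof
    assume "a y' \<le> g"
    then have "(d - c) * a y' \<le> (d - c) * g" using cd by (intro mult_left_mono) auto
    then show ?thesis using lip[OF y False] by linarith
  next
    assume "a y \<le> g"
    then have "(d - c) * a y \<le> (d - c) * g" using cd by (intro mult_left_mono) auto
    then show ?thesis using lip[OF y(2,1)] False by (simp add: abs_minus_commute)
  qed
  then show ?thesis by (simp add: mult.commute)
qed simp

text \<open>A point of mass \<open>m\<close> cannot carry a failure probability above
  \<open>g / m\<close>. This is how \<open>1 - p k\<close> enters the denominators of the atomic
  case.\<close>

lemma one_sided_range_atom:
  fixes h a :: "'a \<Rightarrow> real"
  assumes a: "a \<in> borel_measurable M" "\<And>y. y \<in> space M \<Longrightarrow> 0 \<le> a y" "\<And>y. y \<in> space M \<Longrightarrow> a y \<le> B"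
    "expectation a \<le> g" and cd: "c \<le> d"
    and lip: "\<And>y y'. y \<in> space M \<Longrightarrow> y' \<in> space M \<Longrightarrow> y \<noteq> y' \<Longrightarrow>
       0 \<le> c \<and> \<bar>h y - h y'\<bar> \<le> c + (d - c) * a y'"
    and atom: "atom_mass M \<eta> m" "0 < m" and y: "y \<in> space M"
  shows "\<bar>h y - h \<eta>\<bar> \<le> max 0 (c + g * (d - c) * inverse m)"
proof (cases "y = \<eta>")
  case False
  have "m * a \<eta> \<le> g" using atom_massD[OF atom(1) a(1-3)] a(4) by linarith
  then have "a \<eta> \<le> g / m" using atom(2) by (simp add: field_simps)
  then have "(d - c) * a \<eta> \<le> (d - c) * (g / m)" using cd by (intro mult_left_mono) auto
  moreover have "g * (d - c) * inverse m = (d - c) * (g / m)" by (simp add: field_simps)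
  ultimately show ?thesis
    using lip[OF y atom_mass_space[OF atom(1)] False] by linarith
qed simp

text \<open>The failure may now sit at both endpoints, each of mass at least \<open>m\<close>. This
  costs \<open>g / m\<close> twice, whence the 2 and the division by the smallest mass in
  \<open>e\<close>.\<close>

lemma two_sided_range_atoms:
  fixes h a :: "'a \<Rightarrow> real"
  assumes a: "a \<in> borel_measurable M" "\<And>y. y \<in> space M \<Longrightarrow> 0 \<le> a y" "\<And>y. y \<in> space M \<Longrightarrow> a y \<le> B"
    "expectation a \<le> g" and cd: "c \<le> d"
    and lip: "\<And>y y'. y \<in> space M \<Longrightarrow> y' \<in> space M \<Longrightarrow> y \<noteq> y' \<Longrightarrow>
       \<bar>h y - h y'\<bar> \<le> c + (d - c) * a y + (d - c) * a y'"
    and atom: "\<And>\<eta>. \<eta> \<in> space M \<Longrightarrow> atom_mass M \<eta> m" "0 < m"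
    and y: "y \<in> space M" "y' \<in> space M"
  shows "\<bar>h y - h y'\<bar> \<le> max 0 (c + 2 * g * (d - c) * inverse m)"
proof (cases "y = y'")
  case False
  have *: "(d - c) * a \<eta> \<le> (d - c) * (g / m)" if "\<eta> \<in> space M" for \<eta>
  proof -
    have "m * a \<eta> \<le> g" using atom_massD[OF atom(1)[OF that] a(1-3)] a(4) by linarith
    then have "a \<eta> \<le> g / m" using atom(2) by (simp add: field_simps)
    then show ?thesis using cd by (intro mult_left_mono) auto
  qed
  have "c + 2 * g * (d - c) * inverse m = c + (d - c) * (g / m) + (d - c) * (g / m)"
    by (simp add: field_simps)
  then show ?thesis using lip[OF y False] *[OF y(1)] *[OF y(2)] by linarith
qed simp

text \<open>A bound on the range puts \<open>h\<close> into an interval of length \<open>r\<close>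
  above its infimum, as Hoeffding's lemma asks.\<close>

lemma hoeffding_mgf:
  fixes h :: "'a \<Rightarrow> real"
  assumes h: "h \<in> borel_measurable M"
    and range: "\<And>y y'. y \<in> space M \<Longrightarrow> y' \<in> space M \<Longrightarrow> \<bar>h y - h y'\<bar> \<le> r"
    and l: "0 < l"
  shows "(\<integral>y. exp (l * (h y - expectation h)) \<partial>M) \<le> exp (l\<^sup>2 * r\<^sup>2 / 8)"
proof -
  define a where "a = Inf (h ` space M)"
  obtain y0 where y0: "y0 \<in> space M" using not_empty by auto
  have bdd: "bdd_below (h ` space M)"
    by (rule bdd_belowI2[of _ "h y0 - r"]) (use range[OF y0] in force)
  have a: "a \<le> h y" "h y \<le> a + r" if y: "y \<in> space M" for y
  proof -
    show "a \<le> h y" unfolding a_def using bdd y by (intro cInf_lower) auto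
    have "h y - r \<le> a"
      unfolding a_def using y0 range[OF y] by (intro cInf_greatest) (auto simp: abs_le_iff algebra_simps)
    then show "h y \<le> a + r" by simp
  qed
  interpret B: interval_bounded_random_variable M h a "a + r"
    by unfold_locales (use h a in auto)
  have int: "integrable M (\<lambda>y. exp (l * (h y - expectation h)))"
    using h a l by (intro integrable_const_bound[where B = "exp (l * (a + r - expectation h))"]) auto
  have "ennreal (\<integral>y. exp (l * (h y - expectation h)) \<partial>M)
        = (\<integral>\<^sup>+y. exp (l * (h y - expectation h)) \<partial>M)"
    using int by (intro nn_integral_eq_integral[symmetric]) auto
  also have "\<dots> \<le> ennreal (exp (l\<^sup>2 * r\<^sup>2 / 8))"
    using B.Hoeffdings_lemma_nn_integral[OF l] by simp
  finally show ?thesis by simp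
qed

text \<open>The linear term averages to 0 and the quadratic one to the variance;
  \<open>1 + x \<le> exp x\<close> then restores the exponential form. The bound \<open>K\<close>
  secures integrability and does not enter the result.\<close>

lemma bennett_mgf:
  fixes h :: "'a \<Rightarrow> real"
  assumes h: "h \<in> borel_measurable M"
    and bound: "\<And>y. y \<in> space M \<Longrightarrow> \<bar>h y\<bar> \<le> K"
    and upper: "\<And>y. y \<in> space M \<Longrightarrow> h y - expectation h \<le> C"
    and var: "(\<integral>y. (h y - expectation h)\<^sup>2 \<partial>M) \<le> v"
    and l: "0 < l" and C: "0 < C"
  shows "(\<integral>y. exp (l * (h y - expectation h)) \<partial>M) \<le> exp (v * ((exp (l * C) - 1 - l * C) / C\<^sup>2))"
proof -
  define D where "D y = h y - expectation h" for y
  have D: "D \<in> borel_measurable M" using h unfolding D_def by simp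
  have inth: "integrable M h"
    using h bound by (intro integrable_const_bound[where B = K]) auto
  then have intD: "integrable M D" and D0: "(\<integral>y. D y \<partial>M) = 0"
    unfolding D_def by (auto simp: prob_space)
  define K' where "K' = K + \<bar>expectation h\<bar>"
  have bD: "\<bar>D y\<bar> \<le> K'" if "y \<in> space M" for y
    using bound[OF that] unfolding D_def K'_def by linarith
  have intD2: "integrable M (\<lambda>y. (D y)\<^sup>2)"
  proof (rule integrable_const_bound[where B = "K'\<^sup>2"])
    show "AE y in M. norm ((D y)\<^sup>2) \<le> K'\<^sup>2"
    proof (rule AE_I2)
      fix y assume "y \<in> space M"
      then show "norm ((D y)\<^sup>2) \<le> K'\<^sup>2"
        using power_mono[OF bD[of y], of 2] by simp
    qed
  qed (use D in simp)
  have inte: "integrable M (\<lambda>y. exp (l * D y))"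
    using D upper l unfolding D_def
    by (intro integrable_const_bound[where B = "exp (l * C)"]) auto
  \<comment> \<open>The coefficient of \<open>exp_le_bennett\<close> for the bound
    \<open>l * C\<close> on \<open>l * D y\<close>; the factor \<open>l\<^sup>2\<close> cancels at
    the end.\<close>
  define R where "R = (exp (l * C) - 1 - l * C) / (l * C)\<^sup>2"
  have R: "0 \<le> R"
    using exp_ge_add_one_self[of "l * C"] unfolding R_def
    by (intro divide_nonneg_nonneg) (simp_all add: algebra_simps)
  have "(\<integral>y. exp (l * D y) \<partial>M) \<le> (\<integral>y. 1 + l * D y + (l\<^sup>2 * R) * (D y)\<^sup>2 \<partial>M)"
  proof (rule integral_mono)
    fix y assume y: "y \<in> space M"
    have "l * D y \<le> l * C" using upper[OF y] l unfolding D_def by simp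
    then have "exp (l * D y) \<le> 1 + l * D y + (l * D y)\<^sup>2 * R"
      unfolding R_def using l C by (intro exp_le_bennett) auto
    then show "exp (l * D y) \<le> 1 + l * D y + (l\<^sup>2 * R) * (D y)\<^sup>2"
      by (simp add: power_mult_distrib mult_ac)
  qed (use inte intD intD2 in auto)
  also have "\<dots> = 1 + (l\<^sup>2 * R) * (\<integral>y. (D y)\<^sup>2 \<partial>M)"
    using intD intD2 D0 by (simp add: prob_space)
  also have "\<dots> \<le> 1 + (l\<^sup>2 * R) * v"
    using var R unfolding D_def by (intro add_left_mono mult_left_mono) auto
  also have "\<dots> \<le> exp (l\<^sup>2 * R * v)" by (rule exp_ge_add_one_self)
  also have "l\<^sup>2 * R * v = v * ((exp (l * C) - 1 - l * C) / C\<^sup>2)"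
    unfolding R_def using l C by (simp add: field_simps power2_eq_square)
  finally show ?thesis unfolding D_def .
qed

text \<open>The second moment about \<open>h \<eta>\<close> is at least the variance. Its integrand
  is at most \<open>r\<^sup>2\<close> and vanishes at \<eta>, so the gap
  \<open>r\<^sup>2 - (D y)\<^sup>2\<close> has mean at least \<open>m * r\<^sup>2\<close>.\<close>

lemma variance_le_atom:
  fixes h :: "'a \<Rightarrow> real"
  assumes h: "h \<in> borel_measurable M"
    and atom: "atom_mass M \<eta> m"
    and r: "\<And>y. y \<in> space M \<Longrightarrow> \<bar>h y - h \<eta>\<bar> \<le> r"
  shows "(\<integral>y. (h y - expectation h)\<^sup>2 \<partial>M) \<le> (1 - m) * r\<^sup>2"
proof -
  define D where "D y = h y - h \<eta>" for y
  have D [measurable]: "D \<in> borel_measurable M" using h unfolding D_def by simp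
  have sq: "(D y)\<^sup>2 \<le> r\<^sup>2" if "y \<in> space M" for y
    using power_mono[OF r[OF that], of 2] unfolding D_def by simp
  have intD: "integrable M D"
    using r by (intro integrable_const_bound[where B = r]) (auto simp: D_def[symmetric])
  have intD2: "integrable M (\<lambda>y. (D y)\<^sup>2)"
    using sq by (intro integrable_const_bound[where B = "r\<^sup>2"]) auto
  have inth: "integrable M h"
    using Bochner_Integration.integrable_add[OF intD integrable_const[of "h \<eta>"]]
    by (simp add: D_def)
  have ED: "expectation D = expectation h - h \<eta>"
    unfolding D_def using inth by (simp add: prob_space)
  have "(\<integral>y. (h y - expectation h)\<^sup>2 \<partial>M) = (\<integral>y. (D y)\<^sup>2 - 2 * expectation D * D y + (expectation D)\<^sup>2 \<partial>M)"
    by (intro Bochner_Integration.integral_cong refl)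
       (simp add: ED D_def power2_eq_square algebra_simps)
  also have "\<dots> = (\<integral>y. (D y)\<^sup>2 \<partial>M) - (expectation D)\<^sup>2"
    using intD intD2 by (simp add: prob_space power2_eq_square)
  also have "\<dots> \<le> (\<integral>y. (D y)\<^sup>2 \<partial>M)" by simp
  also have "\<dots> \<le> (1 - m) * r\<^sup>2"
  proof -
    have "m * (r\<^sup>2 - (D \<eta>)\<^sup>2) \<le> (\<integral>y. r\<^sup>2 - (D y)\<^sup>2 \<partial>M)"
      using sq by (intro atom_massD[OF atom, where B = "r\<^sup>2"]) auto
    also have "\<dots> = r\<^sup>2 - (\<integral>y. (D y)\<^sup>2 \<partial>M)"
      using intD2 by (simp add: prob_space)
    finally show ?thesis by (simp add: D_def algebra_simps)
  qed
  finally show ?thesis .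
qed

lemma binary_expectation:
  fixes h :: "'a \<Rightarrow> real"
  assumes "space M = {u, v}" "u \<noteq> v" "sets M = Pow {u, v}"
  shows "expectation h = (1 - prob {v}) * h u + prob {v} * h v"
proof -
  have p: "prob {u} = 1 - prob {v}"
    using prob_compl[of "{v}"] assms by (simp add: insert_Diff_if)
  have "expectation h = (\<integral>y. indicator {u} y * h u + indicator {v} y * h v \<partial>M)"
    using assms(1,2) by (intro Bochner_Integration.integral_cong) (auto simp: indicator_def)
  also have "\<dots> = prob {u} * h u + prob {v} * h v"
    using assms by (subst Bochner_Integration.integral_add) (auto intro!: integrable_mult_left integrable_real_indicator simp: emeasure_eq_measure)
  finally show ?thesis by (simp add: p)
qed

lemma binary_variance:
  fixes h :: "'a \<Rightarrow> real"
  assumes "space M = {u, v}" "u \<noteq> v" "sets M = Pow {u, v}"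
  shows "(\<integral>y. (h y - expectation h)\<^sup>2 \<partial>M) = (1 - prob {v}) * prob {v} * (h v - h u)\<^sup>2"
  by (subst binary_expectation[OF assms], simp only: binary_expectation[OF assms])
     (simp add: power2_eq_square algebra_simps)

end

section \<open>Tail bounds under a query strategy\<close>

lemma exp_neg_ratio_nonneg: "0 \<le> exp_neg_ratio a b"
  by (simp add: exp_neg_ratio_def)

lemma exp_neg_ratio_0 [simp]: "exp_neg_ratio 0 b = 1"
  by (simp add: exp_neg_ratio_def)

text \<open>Serves the degenerate cases of zero range or zero variance, where the parameter of the
  exponential moment can be sent to infinity.\<close>

lemma le_0_of_le_exp_neg:
  fixes p t :: real
  assumes "0 < t" "\<And>l. 0 < l \<Longrightarrow> p \<le> exp (- (l * t))"
  shows "p \<le> 0"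
proof (rule ccontr)
  assume "\<not> p \<le> 0"
  then have p: "0 < p" by simp
  \<comment> \<open>\<open>l\<close> is chosen such that \<open>l * t\<close> is larger than
    \<open>- ln p\<close>.\<close>
  have "p \<le> exp (- (\<bar>ln p\<bar> + 1))"
    using assms(2)[of "(\<bar>ln p\<bar> + 1) / t"] assms(1) by (simp add: add_pos_nonneg)
  then have "ln p \<le> ln (exp (- (\<bar>ln p\<bar> + 1)))" using p by (subst ln_le_cancel_iff) auto
  then show False by simp
qed

context fin_prod
begin

text \<open>What the tail bounds use of an increasing strategy: whether \<open>k\<close> is queried
  is known before \<open>k\<close> is revealed, and the queried values determine \<open>f\<close>.
  Only points of the given product are mentioned, so the notion passes to conditioned
  factors.\<close>

definition valid_queries :: "((nat \<Rightarrow> 'a) \<Rightarrow> nat set) \<Rightarrow> ((nat \<Rightarrow> 'a) \<Rightarrow> real) \<Rightarrow> bool" where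
  "valid_queries Q f \<longleftrightarrow> (\<forall>x\<in>space PM. Q x \<subseteq> {1..N}) \<and>
     (\<forall>x\<in>space PM. \<forall>y\<in>space PM. \<forall>k\<in>{1..N}. (\<forall>j<k. x j = y j) \<longrightarrow> k \<in> Q x \<longleftrightarrow> k \<in> Q y) \<and>
     (\<forall>x\<in>space PM. \<forall>y\<in>space PM. (\<forall>j\<in>Q x. x j = y j) \<longrightarrow> f y = f x)"

lemma valid_queries_prefix:
  assumes "valid_queries Q f" "x \<in> space PM" "y \<in> space PM" "k < N" "\<And>j. j \<le> k \<Longrightarrow> x j = y j"
  shows "Suc k \<in> Q x \<longleftrightarrow> Suc k \<in> Q y"
proof -
  have "Suc k \<in> {1..N}" using assms(4) by simp
  moreover have "\<forall>j<Suc k. x j = y j" using assms(5) by auto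
  ultimately show ?thesis using assms(1-3) unfolding valid_queries_def by blast
qed

text \<open>For every completion \<open>z\<close> the prefix decides that coordinate
  \<open>k + 1\<close> stays unqueried, so changing its value does not change \<open>f\<close>;
  averaging over it is averaging a constant.\<close>

lemma avg_not_queried:
  assumes Q: "valid_queries Q f" and f: "bm f" and x: "x \<in> space PM" and k: "k < N"
    and nq: "Suc k \<notin> Q x" and y: "y \<in> space (M (Suc k))"
  shows "avg (Suc k) f (x(Suc k := y)) = avg k f x"
proof -
  have sk: "Suc k \<in> {1..N}" using k by simp
  interpret Mk: prob_space "M (Suc k)" by (rule prob_space_factor[OF sk])
  have "avg (Suc k) f (x(Suc k := y')) = avg (Suc k) f (x(Suc k := y))"
    if y': "y' \<in> space (M (Suc k))" for y'
    unfolding avg_def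
  proof (rule Bochner_Integration.integral_cong[OF refl])
    fix z assume z: "z \<in> space PM"
    let ?w = "mix (Suc k) (x(Suc k := y)) z" and ?w' = "mix (Suc k) (x(Suc k := y')) z"
    have w: "?w \<in> space PM" "?w' \<in> space PM"
      using mix_space[OF upd_space[OF x sk] z] y y' by auto
    have "Suc k \<notin> Q ?w"
      using valid_queries_prefix[OF Q x w(1) k] nq by (auto simp: mix_def)
    then have "\<forall>j\<in>Q ?w. ?w j = ?w' j" by (auto simp: mix_def)
    then show "f ?w' = f ?w" using Q w unfolding valid_queries_def by blast
  qed
  then have "avg k f x = (\<integral>y'. avg (Suc k) f (x(Suc k := y)) \<partial>M (Suc k))"
    unfolding avg_step[OF f x k] by (intro Bochner_Integration.integral_cong) auto
  then show ?thesis by (simp add: Mk.prob_space)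
qed

text \<open>In the induction the cost of the queries still to come is only known through a constant
  upper bound, so that \<open>Q\<close> never occurs under an integral.\<close>

lemma exp_moment_le:
  assumes f: "bm f" and E: "E \<in> sets PM" and Q: "valid_queries Q f"
    and step: "\<And>k x. k < N \<Longrightarrow> x \<in> E \<Longrightarrow> Suc k \<in> Q x \<Longrightarrow>
      (\<integral>y. exp (l * (avg (Suc k) f (x(Suc k := y)) - avg k f x)) \<partial>M (Suc k)) \<le> exp (\<psi> (Suc k))"
    and w: "\<And>x. x \<in> space PM \<Longrightarrow> (\<Sum>k\<in>Q x. \<psi> k) \<le> w"
  shows "(\<integral>x. exp (l * f x) * indicator E x \<partial>PM) \<le> exp (l * (\<integral>x. f x \<partial>PM) + w)"
proof -
  define F where "F = (\<lambda>x. exp (l * f x) * indicator E x :: real)"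
  have F: "bm F" unfolding F_def by (intro bm_mult bm_exp f bm_indicator E)
  have fin: "finite (Q x)" if "x \<in> space PM" for x
    using Q that unfolding valid_queries_def by (meson finite_atLeastAtMost finite_subset)
  define S where "S k x = (\<Sum>j\<in>{j\<in>Q x. k < j}. \<psi> j)" for k x
  have S_step: "S k x = (if Suc k \<in> Q x then \<psi> (Suc k) else 0) + S (Suc k) x"
    if "x \<in> space PM" for k x
  proof -
    have "{j\<in>Q x. k < j} = (if Suc k \<in> Q x then insert (Suc k) {j\<in>Q x. Suc k < j} else {j\<in>Q x. Suc k < j})"
      by (auto intro!: Suc_lessI)
    then show ?thesis unfolding S_def using fin[OF that] by simp
  qed
  have main: "avg k F x \<le> exp (l * avg k f x + w)"
    if "k \<le> N" "x \<in> space PM" "\<And>z. z \<in> space PM \<Longrightarrow> S k (mix k x z) \<le> w" for k x w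
    using that
  proof (induction k arbitrary: x w rule: inc_induct)
    case base
    have "{j \<in> Q x. N < j} = {}"
      using Q base(1) unfolding valid_queries_def by fastforce
    then have "S N x = 0" by (simp only: S_def sum.empty)
    moreover have "mix N x x = x" by (simp add: mix_def)
    ultimately have "0 \<le> w" using base(2)[OF base(1)] by simp
    then show ?case
      unfolding avg_top[OF F base(1)] avg_top[OF f base(1)] by (simp add: F_def indicator_def)
  next
    case (step k)
    have k: "k < N" and x: "x \<in> space PM" using step by auto
    have sk: "Suc k \<in> {1..N}" using k by simp
    interpret Mk: prob_space "M (Suc k)" by (rule prob_space_factor[OF sk])
    show ?case
    \<comment> \<open>If no completion of the prefix lies in \<open>E\<close>, the indicator makes
      the average 0. Otherwise one completion in \<open>E\<close> suffices, since the increments see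
      only the prefix.\<close>
    proof (cases "\<exists>z\<in>space PM. mix k x z \<in> E")
      case False
      then have "avg k F x = (\<integral>z. 0 \<partial>PM)"
        unfolding avg_def F_def by (intro Bochner_Integration.integral_cong) auto
      then show ?thesis by simp
    next
      case True
      then obtain z0 where z0: "z0 \<in> space PM" "mix k x z0 \<in> E" by auto
      define q where "q = (if Suc k \<in> Q x then \<psi> (Suc k) else 0)"
      let ?D = "\<lambda>y. avg (Suc k) f (x(Suc k := y)) - avg k f x"
      \<comment> \<open>Coordinate \<open>k + 1\<close> consumes \<open>q\<close> of the budget
        \<open>w\<close>. Its value is read off at \<open>x\<close> but is the same for all
        completions of the prefix.\<close>
      have bd: "avg (Suc k) F (x(Suc k := y)) \<le> exp (l * avg (Suc k) f (x(Suc k := y)) + (w - q))"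
        if y: "y \<in> space (M (Suc k))" for y
      proof (rule step.IH)
        show "x(Suc k := y) \<in> space PM" by (rule upd_space[OF x sk y])
        fix z assume z: "z \<in> space PM"
        have u: "z(Suc k := y) \<in> space PM" by (rule upd_space[OF z sk y])
        have m: "mix k x (z(Suc k := y)) \<in> space PM" by (rule mix_space[OF x u])
        have "Suc k \<in> Q x \<longleftrightarrow> Suc k \<in> Q (mix k x (z(Suc k := y)))"
          by (rule valid_queries_prefix[OF Q x m k]) (simp add: mix_def)
        then have "S k (mix k x (z(Suc k := y))) = q + S (Suc k) (mix k x (z(Suc k := y)))"
          using S_step[OF m, of k] by (simp add: q_def)
        moreover have "S k (mix k x (z(Suc k := y))) \<le> w" by (rule step.prems(2)[OF u])
        ultimately show "S (Suc k) (mix (Suc k) (x(Suc k := y)) z) \<le> w - q"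
          by (simp add: mix_fun_upd)
      qed
      have mgf: "(\<integral>y. exp (l * ?D y) \<partial>M (Suc k)) \<le> exp q"
      proof (cases "Suc k \<in> Q x")
        case q: True
        let ?x = "mix k x z0"
        have "Suc k \<in> Q ?x"
          using valid_queries_prefix[OF Q x mix_space[OF x z0(1)] k] q by (simp add: mix_def)
        from assms(4)[OF k z0(2) this]
        have "(\<integral>y. exp (l * (avg (Suc k) f (?x(Suc k := y)) - avg k f ?x)) \<partial>M (Suc k)) \<le> exp q"
          using q by (simp add: q_def)
        moreover have "avg (Suc k) f (?x(Suc k := y)) = avg (Suc k) f (x(Suc k := y))" for y
          by (rule avg_cong) (auto simp: mix_def)
        ultimately show ?thesis by (simp add: avg_mix)
      next
        case nq: False
        have "(\<integral>y. exp (l * ?D y) \<partial>M (Suc k)) = (\<integral>y. 1 \<partial>M (Suc k))"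
          using avg_not_queried[OF Q f x k nq] by (intro Bochner_Integration.integral_cong) auto
        then show ?thesis by (simp add: Mk.prob_space q_def nq)
      qed
      have inte: "integrable (M (Suc k)) (\<lambda>y. exp (l * avg (Suc k) f (x(Suc k := y))))"
        using bm_coord(3)[OF bm_exp[OF bm_avg[OF f]] x sk] .
      have "avg k F x = (\<integral>y. avg (Suc k) F (x(Suc k := y)) \<partial>M (Suc k))"
        by (rule avg_step[OF F x k])
      also have "\<dots> \<le> (\<integral>y. exp (l * avg (Suc k) f (x(Suc k := y))) * exp (w - q) \<partial>M (Suc k))"
        using bd bm_coord(3)[OF bm_avg[OF F] x sk] inte
        by (intro integral_mono) (auto simp: exp_add)
      also have "\<dots> = (\<integral>y. exp (l * avg k f x + (w - q)) * exp (l * ?D y) \<partial>M (Suc k))"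
        by (intro Bochner_Integration.integral_cong refl) (simp add: exp_add[symmetric] algebra_simps)
      also have "\<dots> = exp (l * avg k f x + (w - q)) * (\<integral>y. exp (l * ?D y) \<partial>M (Suc k))"
        by simp
      also have "\<dots> \<le> exp (l * avg k f x + (w - q)) * exp q"
        using mgf by (intro mult_left_mono) auto
      also have "\<dots> = exp (l * avg k f x + w)" by (simp add: exp_add[symmetric])
      finally show ?thesis .
    qed
  qed
  obtain x0 where x0: "x0 \<in> space PM" using PM.not_empty by blast
  have "avg 0 F x0 \<le> exp (l * avg 0 f x0 + w)"
  proof (rule main[OF _ x0])
    fix z assume z: "z \<in> space PM"
    have "{j\<in>Q z. 0 < j} = Q z" using Q z unfolding valid_queries_def by fastforce
    then show "S 0 (mix 0 x0 z) \<le> w" using w[OF z] by (simp add: mix_0[OF x0 z] S_def)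
  qed simp
  then show ?thesis unfolding avg_0[OF x0] F_def .
qed

text \<open>Markov's inequality for \<open>exp (l * f)\<close> cut off outside
  \<open>E\<close>.\<close>

lemma exp_tail_le:
  assumes f: "bm f" and E: "E \<in> sets PM" and Q: "valid_queries Q f" and l: "0 < l"
    and step: "\<And>k x. k < N \<Longrightarrow> x \<in> E \<Longrightarrow> Suc k \<in> Q x \<Longrightarrow>
      (\<integral>y. exp (l * (avg (Suc k) f (x(Suc k := y)) - avg k f x)) \<partial>M (Suc k)) \<le> exp (\<psi> (Suc k))"
    and w: "\<And>x. x \<in> space PM \<Longrightarrow> (\<Sum>k\<in>Q x. \<psi> k) \<le> w"
  shows "measure PM {x\<in>space PM. (\<integral>x. f x \<partial>PM) + t \<le> f x \<and> x \<in> E} \<le> exp (- (l * t) + w)"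
proof -
  define \<mu> where "\<mu> = (\<integral>x. f x \<partial>PM)"
  define F where "F = (\<lambda>x. exp (l * f x) * indicator E x :: real)"
  have F: "bm F" unfolding F_def by (intro bm_mult bm_exp f bm_indicator E)
  have "measure PM {x\<in>space PM. \<mu> + t \<le> f x \<and> x \<in> E} \<le> measure PM {x\<in>space PM. exp (l * (\<mu> + t)) \<le> F x}"
    using l bm_measurable[OF F] by (intro PM.finite_measure_mono) (auto simp: F_def)
  also have "\<dots> \<le> (\<integral>x. F x \<partial>PM) / exp (l * (\<mu> + t))"
    using bm_integrable[OF F] by (intro integral_Markov_inequality_measure[of _ _ "{}"]) (auto simp: F_def)
  also have "\<dots> \<le> exp (l * \<mu> + w) / exp (l * (\<mu> + t))"
    using exp_moment_le[OF f E Q step w] unfolding F_def \<mu>_def by (intro divide_right_mono) auto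
  also have "\<dots> = exp (- (l * t) + w)" by (simp add: exp_diff[symmetric] algebra_simps)
  finally show ?thesis unfolding \<mu>_def .
qed

lemma hoeffding_tail:
  assumes f: "bm f" and E: "E \<in> sets PM" and Q: "valid_queries Q f" and t: "0 \<le> t"
    and range: "\<And>k x y y'. k < N \<Longrightarrow> x \<in> E \<Longrightarrow> Suc k \<in> Q x \<Longrightarrow> y \<in> space (M (Suc k)) \<Longrightarrow>
      y' \<in> space (M (Suc k)) \<Longrightarrow>
      \<bar>avg (Suc k) f (x(Suc k := y)) - avg (Suc k) f (x(Suc k := y'))\<bar> \<le> r (Suc k)"
    and W: "\<And>x. x \<in> space PM \<Longrightarrow> (\<Sum>k\<in>Q x. (r k)\<^sup>2) \<le> W"
  shows "measure PM {x\<in>space PM. (\<integral>x. f x \<partial>PM) + t \<le> f x \<and> x \<in> E} \<le> exp_neg_ratio (2 * t\<^sup>2) W"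
    (is "?p \<le> _")
proof (cases "t = 0")
  case False
  with t have t: "0 < t" by simp
  obtain x0 where "x0 \<in> space PM" using PM.not_empty by blast
  from W[OF this] have W0: "0 \<le> W" by (meson order_trans sum_nonneg zero_le_power2)
  have bound: "?p \<le> exp (- (l * t) + l\<^sup>2 * W / 8)" if l: "0 < l" for l
  proof (rule exp_tail_le[OF f E Q l])
    fix k x assume k: "k < N" and x: "x \<in> E" and q: "Suc k \<in> Q x"
    have sk: "Suc k \<in> {1..N}" using k by simp
    have xs: "x \<in> space PM" using x sets.sets_into_space[OF E] by auto
    interpret Mk: prob_space "M (Suc k)" by (rule prob_space_factor[OF sk])
    show "(\<integral>y. exp (l * (avg (Suc k) f (x(Suc k := y)) - avg k f x)) \<partial>M (Suc k))
        \<le> exp (l\<^sup>2 * (r (Suc k))\<^sup>2 / 8)"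
      unfolding avg_step[OF f xs k]
      by (rule Mk.hoeffding_mgf[OF bm_coord(1)[OF bm_avg[OF f] xs sk] range[OF k x q] l])
  next
    fix x assume "x \<in> space PM"
    from W[OF this] have "l\<^sup>2 / 8 * (\<Sum>k\<in>Q x. (r k)\<^sup>2) \<le> l\<^sup>2 / 8 * W"
      by (intro mult_left_mono) auto
    then show "(\<Sum>k\<in>Q x. l\<^sup>2 * (r k)\<^sup>2 / 8) \<le> l\<^sup>2 * W / 8"
      by (simp add: sum_distrib_left)
  qed
  show ?thesis
  proof (cases "W = 0")
    case True
    then have "?p \<le> 0"
      using bound by (intro le_0_of_le_exp_neg[OF t]) auto
    then show ?thesis using exp_neg_ratio_nonneg order_trans by blast
  next
    case False
    with W0 have W0: "0 < W" by simp
    \<comment> \<open>\<open>l = 4 * t / W\<close> minimises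
      \<open>- (l * t) + l\<^sup>2 * W / 8\<close>.\<close>
    have "- (4 * t / W * t) + (4 * t / W)\<^sup>2 * W / 8 = - (2 * t\<^sup>2) / W"
      using W0 by (simp add: field_simps power2_eq_square)
    then show ?thesis
      using bound[of "4 * t / W"] t W0 by (simp add: exp_neg_ratio_def)
  qed
qed simp

lemma bennett_tail:
  assumes f: "bm f" and E: "E \<in> sets PM" and Q: "valid_queries Q f" and t: "0 \<le> t" and C: "0 < C"
    and upper: "\<And>k x y. k < N \<Longrightarrow> x \<in> E \<Longrightarrow> Suc k \<in> Q x \<Longrightarrow> y \<in> space (M (Suc k)) \<Longrightarrow>
      avg (Suc k) f (x(Suc k := y)) - avg k f x \<le> C"
    and var: "\<And>k x. k < N \<Longrightarrow> x \<in> E \<Longrightarrow> Suc k \<in> Q x \<Longrightarrow>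
      (\<integral>y. (avg (Suc k) f (x(Suc k := y)) - avg k f x)\<^sup>2 \<partial>M (Suc k)) \<le> v (Suc k)"
    and V: "\<And>x. x \<in> space PM \<Longrightarrow> (\<Sum>k\<in>Q x. v k) \<le> V" "0 \<le> V"
  shows "measure PM {x\<in>space PM. (\<integral>x. f x \<partial>PM) + t \<le> f x \<and> x \<in> E}
      \<le> exp_neg_ratio (t\<^sup>2) (2 * V + 2 * C * t / 3)" (is "?p \<le> _")
    and "0 < V \<Longrightarrow> measure PM {x\<in>space PM. (\<integral>x. f x \<partial>PM) + t \<le> f x \<and> x \<in> E}
      \<le> exp (- (V / C\<^sup>2) * phi (C * t / V))"
proof -
  define R where "R l = (exp (l * C) - 1 - l * C) / C\<^sup>2" for l
  have R: "0 \<le> R l" for l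
    using exp_ge_add_one_self[of "l * C"] unfolding R_def
    by (intro divide_nonneg_nonneg) (simp_all add: algebra_simps)
  have bound: "?p \<le> exp (- (l * t) + V * R l)" if l: "0 < l" for l
  proof (rule exp_tail_le[OF f E Q l])
    fix k x assume k: "k < N" and x: "x \<in> E" and q: "Suc k \<in> Q x"
    have sk: "Suc k \<in> {1..N}" using k by simp
    have xs: "x \<in> space PM" using x sets.sets_into_space[OF E] by auto
    interpret Mk: prob_space "M (Suc k)" by (rule prob_space_factor[OF sk])
    obtain K where K: "\<And>y. y \<in> space (M (Suc k)) \<Longrightarrow> \<bar>avg (Suc k) f (x(Suc k := y))\<bar> \<le> K"
      using bm_coord(2)[OF bm_avg[OF f] xs sk] by blast
    show "(\<integral>y. exp (l * (avg (Suc k) f (x(Suc k := y)) - avg k f x)) \<partial>M (Suc k))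
        \<le> exp (v (Suc k) * R l)"
      using upper[OF k x q] var[OF k x q] unfolding avg_step[OF f xs k] R_def
      by (intro Mk.bennett_mgf[OF bm_coord(1)[OF bm_avg[OF f] xs sk] K _ _ l C])
  next
    fix x assume "x \<in> space PM"
    from V(1)[OF this] have "(\<Sum>k\<in>Q x. v k) * R l \<le> V * R l"
      using R by (intro mult_right_mono) auto
    then show "(\<Sum>k\<in>Q x. v k * R l) \<le> V * R l" by (simp add: sum_distrib_right)
  qed
  show "?p \<le> exp_neg_ratio (t\<^sup>2) (2 * V + 2 * C * t / 3)"
  proof (cases "t = 0")
    case False
    with t have t: "0 < t" by simp
    show ?thesis
    proof (cases "V = 0")
      case True
      then have "?p \<le> 0" using bound by (intro le_0_of_le_exp_neg[OF t]) auto
      then show ?thesis using exp_neg_ratio_nonneg order_trans by blast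
    next
      case False
      with V(2) have V0: "0 < V" by simp
      \<comment> \<open>Bernstein's choice \<open>l = t / D\<close> turns
        \<open>1 - l * C / 3\<close> into \<open>V / D\<close>, so the bound on
        \<open>V * R l\<close> collapses to \<open>t\<^sup>2 / (2 * D)\<close>.\<close>
      define D where "D = V + C * t / 3"
      have D: "0 < D" using V0 C t unfolding D_def by (intro add_pos_pos) auto
      define l where "l = t / D"
      have l: "0 < l" unfolding l_def using t D by simp
      have lC: "1 - l * C / 3 = V / D" unfolding l_def using D by (simp add: D_def field_simps)
      have "0 < V / D" using V0 D by simp
      then have lC3: "l * C < 3" using lC by linarith
      have "R l \<le> (l * C)\<^sup>2 / (2 * (1 - l * C / 3)) / C\<^sup>2"
        unfolding R_def using exp_remainder2_le_bernstein[of "l * C"] l C lC3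
        by (intro divide_right_mono) auto
      also have "\<dots> = l\<^sup>2 * D / (2 * V)"
        unfolding lC using C V0 D by (simp add: field_simps power2_eq_square)
      finally have "V * R l \<le> V * (l\<^sup>2 * D / (2 * V))"
        using V0 by (intro mult_left_mono) auto
      also have "\<dots> = t\<^sup>2 / (2 * D)"
        unfolding l_def using V0 D by (simp add: field_simps power2_eq_square)
      finally have "- (l * t) + V * R l \<le> - (l * t) + t\<^sup>2 / (2 * D)" by simp
      also have "\<dots> = - (t\<^sup>2) / (2 * D)"
        unfolding l_def using D by (simp add: field_simps power2_eq_square)
      finally have "?p \<le> exp (- (t\<^sup>2) / (2 * D))"
        using bound[OF l] by (meson exp_le_cancel_iff order_trans)
      moreover have "2 * V + 2 * C * t / 3 = 2 * D" by (simp add: D_def)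
      ultimately show ?thesis using D by (simp add: exp_neg_ratio_def)
    qed
  qed simp
  assume V0: "0 < V"
  show "?p \<le> exp (- (V / C\<^sup>2) * phi (C * t / V))"
  proof (cases "t = 0")
    case True
    then show ?thesis by (simp add: phi_def)
  next
    case False
    with t have t: "0 < t" by simp
    define s where "s = C * t / V"
    have s: "0 < s" unfolding s_def using C t V0 by simp
    \<comment> \<open>The exact minimiser of \<open>- (l * t) + V * R l\<close>: the derivative
      vanishes when \<open>exp (l * C) = 1 + C * t / V\<close>.\<close>
    define l where "l = ln (1 + s) / C"
    have l: "0 < l" unfolding l_def using s C by simp
    have t_eq: "t = V * s / C" unfolding s_def using C V0 by simp
    have lC: "l * C = ln (1 + s)" unfolding l_def using C by simp
    have "- (l * t) + V * R l = - (V / C\<^sup>2) * phi s"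
      unfolding R_def lC t_eq phi_def using s C
      by (simp add: l_def field_simps power2_eq_square)
    then show ?thesis using bound[OF l] by (simp add: s_def)
  qed
qed

end

section \<open>Exceptional events and increments\<close>

lemma exp_neg_ratio_mult_cancel:
  "s \<noteq> 0 \<Longrightarrow> exp_neg_ratio (s * a) (s * b) = exp_neg_ratio a b"
  by (simp add: exp_neg_ratio_def)

context fin_prod
begin

lemma avg_avg:
  assumes F: "bm F" and "j \<le> k" "k \<le> N" "x \<in> space PM"
  shows "avg j (avg k F) x = avg j F x"
  using assms(2-4)
proof (induction j arbitrary: x rule: inc_induct)
  case base
  show ?case
    unfolding avg_def[of k "avg k F"] by (simp add: avg_mix PM.prob_space)
next
  case (step j)
  have "j < N" "Suc j \<in> {1..N}" using step by auto
  then show ?case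
    unfolding avg_step[OF bm_avg[OF F] step.prems(2) \<open>j < N\<close>] avg_step[OF F step.prems(2) \<open>j < N\<close>]
    using step upd_space by (intro Bochner_Integration.integral_cong refl) auto
qed

lemma integral_avg:
  assumes "bm F" "k \<le> N"
  shows "(\<integral>x. avg k F x \<partial>PM) = (\<integral>x. F x \<partial>PM)"
proof -
  obtain x0 where "x0 \<in> space PM" using PM.not_empty by blast
  then show ?thesis using avg_avg[OF assms(1) _ assms(2), of 0 x0] by (simp add: avg_0)
qed

definition fail :: "(nat \<Rightarrow> 'a) set \<Rightarrow> nat \<Rightarrow> (nat \<Rightarrow> 'a) \<Rightarrow> real" where
  "fail \<Gamma> k = avg k (indicator (space PM - \<Gamma>))"

text \<open>The index shift is deliberate: the increment at coordinate \<open>k + 1\<close> is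
  governed by the probability of leaving \<Gamma> as it stands before that coordinate is
  revealed.\<close>

definition exceptional :: "(nat \<Rightarrow> 'a) set \<Rightarrow> (nat \<Rightarrow> real) \<Rightarrow> (nat \<Rightarrow> 'a) set" where
  "exceptional \<Gamma> \<gamma> = {x\<in>space PM. x \<notin> \<Gamma> \<or> (\<exists>k<N. \<gamma> (Suc k) < fail \<Gamma> k x)}"

lemma bm_fail: "\<Gamma> \<in> sets PM \<Longrightarrow> bm (fail \<Gamma> k)"
  unfolding fail_def by (intro bm_avg bm_indicator) auto

lemma fail_nonneg: "0 \<le> fail \<Gamma> k x"
  unfolding fail_def avg_def by (intro Bochner_Integration.integral_nonneg) auto

lemma sets_exceptional [measurable]:
  assumes "\<Gamma> \<in> sets PM"
  shows "exceptional \<Gamma> \<gamma> \<in> sets PM"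
proof -
  have [measurable]: "fail \<Gamma> k \<in> borel_measurable PM" for k
    by (rule bm_measurable[OF bm_fail[OF assms]])
  have [measurable]: "\<Gamma> \<in> sets PM" by (fact assms)
  show ?thesis unfolding exceptional_def by measurable
qed

text \<open>The summand \<open>\<gamma> 1\<close> of the union bound pays for the complement of \<open>\<Gamma>\<close>: the condition
  on \<open>fail \<Gamma> 0\<close> is deterministic.\<close>

lemma measure_exceptional:
  assumes \<Gamma>: "\<Gamma> \<in> sets PM" and N: "1 \<le> N" and \<gamma>: "\<And>k. k \<in> {1..N} \<Longrightarrow> 0 < \<gamma> k \<and> \<gamma> k \<le> 1"
  shows "measure PM (exceptional \<Gamma> \<gamma>)
      \<le> (\<Sum>k\<in>{1..N}. inverse (\<gamma> k)) * measure PM (space PM - \<Gamma>)"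
proof -
  define \<pi> where "\<pi> = measure PM (space PM - \<Gamma>)"
  have \<gamma>': "0 < \<gamma> (Suc k)" "\<gamma> (Suc k) \<le> 1" if "k < N" for k
    using \<gamma>[of "Suc k"] that by auto
  have ind: "bm (indicator (space PM - \<Gamma>))" using \<Gamma> by (intro bm_indicator) auto
  have int: "(\<integral>x. fail \<Gamma> k x \<partial>PM) = \<pi>" if "k \<le> N" for k
    unfolding fail_def integral_avg[OF ind that] \<pi>_def using \<Gamma> by simp
  have sum_eq: "(\<Sum>k\<in>{1..N}. inverse (\<gamma> k)) = (\<Sum>k<N. inverse (\<gamma> (Suc k)))"
    by (rule sum.reindex_bij_witness[of _ Suc "\<lambda>k. k - 1"]) auto
  show ?thesis
  \<comment> \<open>If the total failure probability exceeds \<open>\<gamma> 1\<close>, the first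
    summand alone is at least 1. Otherwise the condition for \<open>k = 0\<close> holds nowhere and
    its place in the union is free.\<close>
  proof (cases "\<gamma> 1 < \<pi>")
    case True
    have "measure PM (exceptional \<Gamma> \<gamma>) \<le> 1" by (rule PM.prob_le_1)
    also have "1 \<le> inverse (\<gamma> 1) * \<pi>"
      using True \<gamma>[of 1] N by (simp add: field_simps)
    also have "\<dots> \<le> (\<Sum>k\<in>{1..N}. inverse (\<gamma> k)) * \<pi>"
      using N \<gamma> by (intro mult_right_mono member_le_sum) (auto simp: \<pi>_def less_imp_le)
    finally show ?thesis unfolding \<pi>_def .
  next
    case False
    define T where "T k = (if k = 0 then space PM - \<Gamma> else {x\<in>space PM. \<gamma> (Suc k) \<le> fail \<Gamma> k x})" for k
    have T_sets: "T k \<in> sets PM" for k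
    proof -
      have [measurable]: "fail \<Gamma> k \<in> borel_measurable PM"
        by (rule bm_measurable[OF bm_fail[OF \<Gamma>]])
      show ?thesis using \<Gamma> unfolding T_def by auto
    qed
    have T: "measure PM (T k) \<le> inverse (\<gamma> (Suc k)) * \<pi>" if k: "k < N" for k
    proof (cases "k = 0")
      case True
      have "1 * \<pi> \<le> inverse (\<gamma> (Suc k)) * \<pi>"
        using \<gamma>'[OF k] by (intro mult_right_mono) (auto simp: one_le_inverse_iff \<pi>_def)
      then show ?thesis using True by (simp add: T_def \<pi>_def)
    next
      case False
      have "measure PM {x\<in>space PM. \<gamma> (Suc k) \<le> fail \<Gamma> k x} \<le> (\<integral>x. fail \<Gamma> k x \<partial>PM) / \<gamma> (Suc k)"
        using \<gamma>'[OF k] bm_integrable[OF bm_fail[OF \<Gamma>]]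
        by (intro integral_Markov_inequality_measure[of _ _ "{}"]) (auto simp: fail_nonneg)
      then show ?thesis using False k by (simp add: T_def int divide_inverse mult.commute)
    qed
    have "exceptional \<Gamma> \<gamma> \<subseteq> (\<Union>k\<in>{..<N}. T k)"
    proof
      fix x assume x: "x \<in> exceptional \<Gamma> \<gamma>"
      then consider "x \<in> space PM - \<Gamma>" | k where "k < N" "x \<in> space PM" "\<gamma> (Suc k) < fail \<Gamma> k x"
        unfolding exceptional_def by auto
      then show "x \<in> (\<Union>k\<in>{..<N}. T k)"
      proof cases
        case 1
        then have "x \<in> T 0" by (simp add: T_def)
        then show ?thesis using N by (intro UN_I[of 0]) auto
      next
        case 2
        have "k \<noteq> 0"
        proof
          assume "k = 0"
          then have "fail \<Gamma> k x = \<pi>"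
            using 2(2) ind by (simp add: fail_def avg_0 \<pi>_def \<Gamma> Int_absorb2)
          then show False using 2(3) False \<open>k = 0\<close> by (simp add: One_nat_def)
        qed
        then have "x \<in> T k" using 2 by (simp add: T_def)
        then show ?thesis using 2(1) by (intro UN_I[of k]) auto
      qed
    qed
    then have "measure PM (exceptional \<Gamma> \<gamma>) \<le> measure PM (\<Union>k\<in>{..<N}. T k)"
      using T_sets by (intro PM.finite_measure_mono) auto
    also have "\<dots> \<le> (\<Sum>k<N. measure PM (T k))"
      using T_sets by (intro PM.finite_measure_subadditive_finite) auto
    also have "\<dots> \<le> (\<Sum>k<N. inverse (\<gamma> (Suc k)) * \<pi>)" by (intro sum_mono T) auto
    finally show ?thesis unfolding sum_eq \<pi>_def by (simp add: sum_distrib_right)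
  qed
qed

text \<open>Both prefixes are completed by the same \<open>z\<close>, so the points compared differ
  in one coordinate only. Separate coefficients for the two failures serve both kinds of Lipschitz
  condition, and zero coefficients the plain one.\<close>

lemma avg_diff_le:
  assumes f: "bm f" and A: "bm A" and x: "x \<in> space PM" and k: "k < N"
    and y: "y \<in> space (M (Suc k))" "y' \<in> space (M (Suc k))" "y \<noteq> y'"
    and lip: "\<And>w w'. w \<in> space PM \<Longrightarrow> w' \<in> space PM \<Longrightarrow> differ_only (Suc k) w w' \<Longrightarrow>
      \<bar>f w - f w'\<bar> \<le> c + D * A w + D' * A w'"
  shows "\<bar>avg (Suc k) f (x(Suc k := y)) - avg (Suc k) f (x(Suc k := y'))\<bar>
      \<le> c + D * avg (Suc k) A (x(Suc k := y)) + D' * avg (Suc k) A (x(Suc k := y'))"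
proof -
  have sk: "Suc k \<in> {1..N}" using k by simp
  let ?x = "x(Suc k := y)" and ?x' = "x(Suc k := y')"
  have xs: "?x \<in> space PM" "?x' \<in> space PM" using upd_space[OF x sk] y by auto
  note ints = bm_avg_integrable[OF f xs(1), of "Suc k"] bm_avg_integrable[OF f xs(2), of "Suc k"]
    bm_avg_integrable[OF A xs(1), of "Suc k"] bm_avg_integrable[OF A xs(2), of "Suc k"]
  have diff: "avg (Suc k) f ?x - avg (Suc k) f ?x'
      = (\<integral>z. f (mix (Suc k) ?x z) - f (mix (Suc k) ?x' z) \<partial>PM)"
    unfolding avg_def using ints by simp
  have "\<bar>avg (Suc k) f ?x - avg (Suc k) f ?x'\<bar>
      \<le> (\<integral>z. \<bar>f (mix (Suc k) ?x z) - f (mix (Suc k) ?x' z)\<bar> \<partial>PM)"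
    unfolding diff by (rule integral_abs_bound)
  also have "\<dots> \<le> (\<integral>z. c + D * A (mix (Suc k) ?x z) + D' * A (mix (Suc k) ?x' z) \<partial>PM)"
  proof (rule integral_mono)
    fix z assume z: "z \<in> space PM"
    show "\<bar>f (mix (Suc k) ?x z) - f (mix (Suc k) ?x' z)\<bar>
        \<le> c + D * A (mix (Suc k) ?x z) + D' * A (mix (Suc k) ?x' z)"
      using mix_space[OF xs(1) z] mix_space[OF xs(2) z] y(3)
      by (intro lip) (auto simp: differ_only_def mix_def)
  qed (use ints in auto)
  also have "\<dots> = c + D * avg (Suc k) A ?x + D' * avg (Suc k) A ?x'"
    unfolding avg_def using ints by (simp add: PM.prob_space)
  finally show ?thesis .
qed

lemma fail_coord:
  assumes "\<Gamma> \<in> sets PM" "x \<in> space PM" "k < N"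
  shows "(\<lambda>y. fail \<Gamma> (Suc k) (x(Suc k := y))) \<in> borel_measurable (M (Suc k))"
    and "integrable (M (Suc k)) (\<lambda>y. fail \<Gamma> (Suc k) (x(Suc k := y)))"
    and "\<exists>B. \<forall>y\<in>space (M (Suc k)). fail \<Gamma> (Suc k) (x(Suc k := y)) \<le> B"
    and "(\<integral>y. fail \<Gamma> (Suc k) (x(Suc k := y)) \<partial>M (Suc k)) = fail \<Gamma> k x"
proof -
  have sk: "Suc k \<in> {1..N}" using assms(3) by simp
  show "(\<lambda>y. fail \<Gamma> (Suc k) (x(Suc k := y))) \<in> borel_measurable (M (Suc k))"
    "integrable (M (Suc k)) (\<lambda>y. fail \<Gamma> (Suc k) (x(Suc k := y)))"
    using bm_coord[OF bm_fail[OF assms(1)] assms(2) sk] by auto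
  show "\<exists>B. \<forall>y\<in>space (M (Suc k)). fail \<Gamma> (Suc k) (x(Suc k := y)) \<le> B"
    using bm_coord(2)[OF bm_fail[OF assms(1)] assms(2) sk] by (meson abs_le_D1)
  show "(\<integral>y. fail \<Gamma> (Suc k) (x(Suc k := y)) \<partial>M (Suc k)) = fail \<Gamma> k x"
    unfolding fail_def using assms by (intro avg_step[symmetric] bm_indicator) auto
qed

text \<open>The truncation at 0 matters where a factor has only one point: there \<open>c\<close> may be negative.\<close>

definition bounded_steps ::
  "(nat \<Rightarrow> 'a) set \<Rightarrow> (nat \<Rightarrow> real) \<Rightarrow> (nat \<Rightarrow> real) \<Rightarrow> ((nat \<Rightarrow> 'a) \<Rightarrow> real) \<Rightarrow> bool" where
  "bounded_steps E c e f \<longleftrightarrow> (\<forall>k<N. \<forall>x\<in>E. \<forall>y\<in>space (M (Suc k)).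
     \<bar>avg (Suc k) f (x(Suc k := y)) - avg k f x\<bar> \<le> max 0 (c (Suc k) + e (Suc k)) \<and>
     (card (space (M (Suc k))) = 2 \<longrightarrow> (\<forall>y'\<in>space (M (Suc k)).
        \<bar>avg (Suc k) f (x(Suc k := y)) - avg (Suc k) f (x(Suc k := y'))\<bar>
          \<le> max 0 (c (Suc k) + e (Suc k)))) \<and>
     (\<forall>\<eta> m. atom_mass (M (Suc k)) \<eta> m \<and> 0 < m \<and> m \<le> 1 \<longrightarrow>
        \<bar>avg (Suc k) f (x(Suc k := y)) - avg (Suc k) f (x(Suc k := \<eta>))\<bar>
          \<le> max 0 (c (Suc k) + e (Suc k) * inverse m)))"

lemma bounded_steps_one_sided:
  assumes f: "bm f" and \<Gamma>: "\<Gamma> \<in> sets PM" and E: "E \<subseteq> \<Gamma>"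
    and fl: "\<And>k x. k < N \<Longrightarrow> x \<in> E \<Longrightarrow> fail \<Gamma> k x \<le> \<gamma> (Suc k)"
    and lip: "one_sided_lipschitz N (space PM) \<Gamma> c d f"
    and cd: "\<And>k. k \<in> {1..N} \<Longrightarrow> c k \<le> d k"
    and e: "\<And>k. k \<in> {1..N} \<Longrightarrow> e k = \<gamma> k * (d k - c k)"
  shows "bounded_steps E c e f"
  unfolding bounded_steps_def
proof (intro allI ballI impI)
  fix k x y assume k: "k < N" and x: "x \<in> E" and y: "y \<in> space (M (Suc k))"
  have sk: "Suc k \<in> {1..N}" using k by simp
  interpret Mk: prob_space "M (Suc k)" by (rule prob_space_factor[OF sk])
  have xs: "x \<in> space PM" using x E sets.sets_into_space[OF \<Gamma>] by auto
  define h where "h y = avg (Suc k) f (x(Suc k := y))" for y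
  define a where "a y = fail \<Gamma> (Suc k) (x(Suc k := y))" for y
  note a = fail_coord[OF \<Gamma> xs k, folded a_def]
  obtain B where B: "\<And>y. y \<in> space (M (Suc k)) \<Longrightarrow> a y \<le> B" using a(3) by auto
  have a0: "0 \<le> a y" for y by (simp add: a_def fail_nonneg)
  have h: "integrable (M (Suc k)) h" "Mk.expectation h = avg k f x"
    using bm_coord(3)[OF bm_avg[OF f] xs sk] avg_step[OF f xs k] unfolding h_def by auto
  have ind: "bm (indicator (space PM - \<Gamma>) :: _ \<Rightarrow> real)" using \<Gamma> by (intro bm_indicator) auto
  have lip': "0 \<le> c (Suc k) \<and> \<bar>h y - h y'\<bar> \<le> c (Suc k) + (d (Suc k) - c (Suc k)) * a y'"
    if y: "y \<in> space (M (Suc k))" "y' \<in> space (M (Suc k))" "y \<noteq> y'" for y y'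
  proof
    \<comment> \<open>A point of \<Gamma> with a neighbour in direction \<open>k + 1\<close> forces
      \<open>c\<close> to be nonnegative there.\<close>
    obtain y0 where y0: "y0 \<in> space (M (Suc k))" "x (Suc k) \<noteq> y0" using y by metis
    have "differ_only (Suc k) x (x(Suc k := y0))" using y0 by (simp add: differ_only_def)
    then have "\<bar>f x - f (x(Suc k := y0))\<bar> \<le> (if x \<in> \<Gamma> then c (Suc k) else d (Suc k))"
      using lip sk xs upd_space[OF xs sk y0(1)] unfolding one_sided_lipschitz_def by blast
    then have "\<bar>f x - f (x(Suc k := y0))\<bar> \<le> c (Suc k)" using x E by auto
    then show "0 \<le> c (Suc k)" by linarith
    have "\<bar>h y - h y'\<bar> \<le> c (Suc k) + 0 * a y + (d (Suc k) - c (Suc k)) * a y'"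
      unfolding h_def a_def fail_def
    proof (rule avg_diff_le[OF f ind xs k y])
      fix w w' assume w: "w \<in> space PM" "w' \<in> space PM" "differ_only (Suc k) w w'"
      \<comment> \<open>Differing in one coordinate is symmetric, so the condition may be read with
        \<open>w'\<close> first: the failure is charged to \<open>w'\<close> alone, whence the
        coefficient 0 at \<open>w\<close>.\<close>
      have "differ_only (Suc k) w' w" using w(3) by (auto simp: differ_only_def)
      then have "\<bar>f w' - f w\<bar> \<le> (if w' \<in> \<Gamma> then c (Suc k) else d (Suc k))"
        using lip sk w unfolding one_sided_lipschitz_def by blast
      then show "\<bar>f w - f w'\<bar> \<le> c (Suc k) + 0 * indicator (space PM - \<Gamma>) w
          + (d (Suc k) - c (Suc k)) * indicator (space PM - \<Gamma>) w'"
        using w by (simp add: abs_minus_commute indicator_def split: if_splits)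
    qed
    then show "\<bar>h y - h y'\<bar> \<le> c (Suc k) + (d (Suc k) - c (Suc k)) * a y'" by simp
  qed
  have g: "Mk.expectation a \<le> \<gamma> (Suc k)" using a(4) fl[OF k x] by simp
  have e': "e (Suc k) = \<gamma> (Suc k) * (d (Suc k) - c (Suc k))" by (rule e[OF sk])
  show "\<bar>avg (Suc k) f (x(Suc k := y)) - avg k f x\<bar> \<le> max 0 (c (Suc k) + e (Suc k)) \<and>
     (card (space (M (Suc k))) = 2 \<longrightarrow> (\<forall>y'\<in>space (M (Suc k)).
        \<bar>avg (Suc k) f (x(Suc k := y)) - avg (Suc k) f (x(Suc k := y'))\<bar>
          \<le> max 0 (c (Suc k) + e (Suc k)))) \<and>
     (\<forall>\<eta> m. atom_mass (M (Suc k)) \<eta> m \<and> 0 < m \<and> m \<le> 1 \<longrightarrow>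
        \<bar>avg (Suc k) f (x(Suc k := y)) - avg (Suc k) f (x(Suc k := \<eta>))\<bar>
          \<le> max 0 (c (Suc k) + e (Suc k) * inverse m))"
    unfolding h_def[symmetric] h(2)[symmetric] e'
  proof (intro conjI impI ballI allI)
    show "\<bar>h y - Mk.expectation h\<bar> \<le> max 0 (c (Suc k) + \<gamma> (Suc k) * (d (Suc k) - c (Suc k)))"
      by (rule Mk.one_sided_deviation[OF h(1) a(2) a0 g cd[OF sk] lip' y])
    show "\<bar>h y - h y'\<bar> \<le> max 0 (c (Suc k) + \<gamma> (Suc k) * (d (Suc k) - c (Suc k)))"
      if "card (space (M (Suc k))) = 2" "y' \<in> space (M (Suc k))" for y'
      by (rule Mk.one_sided_range_two_points[OF a(2) g cd[OF sk] lip' that(1) y that(2)])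
    show "\<bar>h y - h \<eta>\<bar> \<le> max 0 (c (Suc k) + \<gamma> (Suc k) * (d (Suc k) - c (Suc k)) * inverse m)"
      if "atom_mass (M (Suc k)) \<eta> m \<and> 0 < m \<and> m \<le> 1" for \<eta> m
      using that by (intro Mk.one_sided_range_atom[OF a(1) a0 B g cd[OF sk] lip' _ _ y]) auto
  qed
qed

text \<open>A bound on the range implies all three parts: the mean is no farther away than the
  points are, and dividing \<open>e\<close> by a mass of at most 1 only enlarges the bound.\<close>

lemma bounded_steps_range:
  assumes f: "bm f" and E: "E \<subseteq> space PM"
    and range: "\<And>k x y y'. k < N \<Longrightarrow> x \<in> E \<Longrightarrow> y \<in> space (M (Suc k)) \<Longrightarrow> y' \<in> space (M (Suc k)) \<Longrightarrow>
      \<bar>avg (Suc k) f (x(Suc k := y)) - avg (Suc k) f (x(Suc k := y'))\<bar> \<le> max 0 (c (Suc k) + e (Suc k))"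
    and e: "\<And>k. k \<in> {1..N} \<Longrightarrow> 0 \<le> e k"
  shows "bounded_steps E c e f"
  unfolding bounded_steps_def
proof (intro allI ballI conjI impI)
  fix k x y assume k: "k < N" and x: "x \<in> E" and y: "y \<in> space (M (Suc k))"
  have sk: "Suc k \<in> {1..N}" using k by simp
  interpret Mk: prob_space "M (Suc k)" by (rule prob_space_factor[OF sk])
  have xs: "x \<in> space PM" using x E by auto
  have "\<bar>avg (Suc k) f (x(Suc k := y)) - avg k f x\<bar> \<le> (\<integral>y. max 0 (c (Suc k) + e (Suc k)) \<partial>M (Suc k))"
    unfolding avg_step[OF f xs k] using bm_coord(3)[OF bm_avg[OF f] xs sk] range[OF k x y]
    by (intro Mk.abs_diff_expectation_le) auto
  then show "\<bar>avg (Suc k) f (x(Suc k := y)) - avg k f x\<bar> \<le> max 0 (c (Suc k) + e (Suc k))"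
    by (simp add: Mk.prob_space)
  show "\<bar>avg (Suc k) f (x(Suc k := y)) - avg (Suc k) f (x(Suc k := y'))\<bar>
      \<le> max 0 (c (Suc k) + e (Suc k))" if "y' \<in> space (M (Suc k))" for y'
    by (rule range[OF k x y that])
  fix \<eta> m assume *: "atom_mass (M (Suc k)) \<eta> m \<and> 0 < m \<and> m \<le> 1"
  then have "1 \<le> inverse m" by (simp add: one_le_inverse_iff)
  then have "e (Suc k) * 1 \<le> e (Suc k) * inverse m"
    using e[OF sk] by (intro mult_left_mono) auto
  moreover have "\<bar>avg (Suc k) f (x(Suc k := y)) - avg (Suc k) f (x(Suc k := \<eta>))\<bar>
      \<le> max 0 (c (Suc k) + e (Suc k))"
    using * atom_mass_space by (intro range[OF k x y]) auto
  ultimately show "\<bar>avg (Suc k) f (x(Suc k := y)) - avg (Suc k) f (x(Suc k := \<eta>))\<bar>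
      \<le> max 0 (c (Suc k) + e (Suc k) * inverse m)" by simp
qed

lemma bounded_steps_two_sided:
  assumes f: "bm f" and \<Gamma>: "\<Gamma> \<in> sets PM" and E: "E \<subseteq> \<Gamma>"
    and fl: "\<And>k x. k < N \<Longrightarrow> x \<in> E \<Longrightarrow> fail \<Gamma> k x \<le> \<gamma> (Suc k)"
    and lip: "two_sided_lipschitz N (space PM) \<Gamma> c d f"
    and cd: "\<And>k. k \<in> {1..N} \<Longrightarrow> c k \<le> d k"
    and atoms: "\<And>k \<eta>. k \<in> {1..N} \<Longrightarrow> \<eta> \<in> space (M k) \<Longrightarrow> atom_mass (M k) \<eta> (r k)"
    and r: "\<And>k. k \<in> {1..N} \<Longrightarrow> 0 < r k"
    and \<gamma>: "\<And>k. k \<in> {1..N} \<Longrightarrow> 0 \<le> \<gamma> k"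
    and e: "\<And>k. k \<in> {1..N} \<Longrightarrow> e k = 2 * \<gamma> k * (d k - c k) * inverse (r k)"
  shows "bounded_steps E c e f"
proof (rule bounded_steps_range[OF f])
  show "E \<subseteq> space PM" using E sets.sets_into_space[OF \<Gamma>] by auto
  show "0 \<le> e k" if "k \<in> {1..N}" for k
    unfolding e[OF that] using r[OF that] \<gamma>[OF that] cd[OF that] by simp
next
  fix k x y y' assume k: "k < N" and x: "x \<in> E"
    and y: "y \<in> space (M (Suc k))" "y' \<in> space (M (Suc k))"
  have sk: "Suc k \<in> {1..N}" using k by simp
  interpret Mk: prob_space "M (Suc k)" by (rule prob_space_factor[OF sk])
  have xs: "x \<in> space PM" using x E sets.sets_into_space[OF \<Gamma>] by auto
  define h where "h y = avg (Suc k) f (x(Suc k := y))" for y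
  define a where "a y = fail \<Gamma> (Suc k) (x(Suc k := y))" for y
  note a = fail_coord[OF \<Gamma> xs k, folded a_def]
  obtain B where B: "\<And>y. y \<in> space (M (Suc k)) \<Longrightarrow> a y \<le> B" using a(3) by auto
  have a0: "0 \<le> a y" for y by (simp add: a_def fail_nonneg)
  have ind: "bm (indicator (space PM - \<Gamma>) :: _ \<Rightarrow> real)" using \<Gamma> by (intro bm_indicator) auto
  have g: "Mk.expectation a \<le> \<gamma> (Suc k)" using a(4) fl[OF k x] by simp
  have lip': "\<bar>h y - h y'\<bar> \<le> c (Suc k) + (d (Suc k) - c (Suc k)) * a y + (d (Suc k) - c (Suc k)) * a y'"
    if y: "y \<in> space (M (Suc k))" "y' \<in> space (M (Suc k))" "y \<noteq> y'" for y y'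
    unfolding h_def a_def fail_def
  proof (rule avg_diff_le[OF f ind xs k y])
    fix w w' assume w: "w \<in> space PM" "w' \<in> space PM" "differ_only (Suc k) w w'"
    have "\<bar>f w - f w'\<bar> \<le> (if w \<in> \<Gamma> \<and> w' \<in> \<Gamma> then c (Suc k) else d (Suc k))"
      using lip sk w unfolding two_sided_lipschitz_def by blast
    then show "\<bar>f w - f w'\<bar> \<le> c (Suc k) + (d (Suc k) - c (Suc k)) * indicator (space PM - \<Gamma>) w
        + (d (Suc k) - c (Suc k)) * indicator (space PM - \<Gamma>) w'"
      using w cd[OF sk] by (simp add: indicator_def split: if_splits)
  qed
  show "\<bar>avg (Suc k) f (x(Suc k := y)) - avg (Suc k) f (x(Suc k := y'))\<bar>
      \<le> max 0 (c (Suc k) + e (Suc k))"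
    unfolding e[OF sk] h_def[symmetric]
    by (rule Mk.two_sided_range_atoms[OF a(1) a0 B g cd[OF sk] lip' atoms[OF sk] r[OF sk] y])
qed

section \<open>Tail bounds from bounded increments\<close>

text \<open>Two values at distance \<open>m\<close> from the mean may be \<open>2 * m\<close> apart,
  so Hoeffding's bound is applied with \<open>4 * W\<close>. For two-point factors the range itself
  is at most \<open>m\<close> and the 4 is saved.\<close>

lemma tail_bounded_steps:
  assumes f: "bm f" and E: "E \<in> sets PM" and Q: "valid_queries Q f" and t: "0 \<le> t"
    and steps: "bounded_steps E c e f"
    and W: "\<And>x. x \<in> space PM \<Longrightarrow> (\<Sum>k\<in>Q x. (c k + e k)\<^sup>2) \<le> W"
  shows "measure PM {x\<in>space PM. (\<integral>x. f x \<partial>PM) + t \<le> f x \<and> x \<in> E} \<le> exp_neg_ratio (t\<^sup>2) (2 * W)"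
      (is "?p \<le> _")
    and "\<forall>k\<in>{1..N}. card (space (M k)) = 2 \<Longrightarrow>
      measure PM {x\<in>space PM. (\<integral>x. f x \<partial>PM) + t \<le> f x \<and> x \<in> E} \<le> exp_neg_ratio (4 * t\<^sup>2) (2 * W)"
proof -
  have sq: "(max 0 (c k + e k))\<^sup>2 \<le> (c k + e k)\<^sup>2" for k
    by (cases "0 \<le> c k + e k") (auto simp: max_def)
  have W': "(\<Sum>k\<in>Q x. (max 0 (c k + e k))\<^sup>2) \<le> W" if "x \<in> space PM" for x
    by (rule order_trans[OF sum_mono[OF sq] W[OF that]])
  have "?p \<le> exp_neg_ratio (2 * t\<^sup>2) (4 * W)"
  proof (rule hoeffding_tail[OF f E Q t])
    show "\<bar>avg (Suc k) f (x(Suc k := y)) - avg (Suc k) f (x(Suc k := y'))\<bar>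
        \<le> 2 * max 0 (c (Suc k) + e (Suc k))"
      if "k < N" "x \<in> E" "y \<in> space (M (Suc k))" "y' \<in> space (M (Suc k))" for k x y y'
    proof -
      have "\<bar>avg (Suc k) f (x(Suc k := y)) - avg k f x\<bar> \<le> max 0 (c (Suc k) + e (Suc k))"
        "\<bar>avg (Suc k) f (x(Suc k := y')) - avg k f x\<bar> \<le> max 0 (c (Suc k) + e (Suc k))"
        using steps that unfolding bounded_steps_def by blast+
      moreover have "\<bar>a - b\<bar> \<le> 2 * m" if "\<bar>a - g\<bar> \<le> m" "\<bar>b - g\<bar> \<le> m" for a b g m :: real
        using that by linarith
      ultimately show ?thesis by blast
    qed
    show "(\<Sum>k\<in>Q x. (2 * max 0 (c k + e k))\<^sup>2) \<le> 4 * W" if "x \<in> space PM" for x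
      using W'[OF that] by (simp add: power_mult_distrib sum_distrib_left[symmetric])
  qed
  then show "?p \<le> exp_neg_ratio (t\<^sup>2) (2 * W)"
    using exp_neg_ratio_mult_cancel[of 2 "t\<^sup>2" "2 * W"] by simp
  assume card: "\<forall>k\<in>{1..N}. card (space (M k)) = 2"
  have "?p \<le> exp_neg_ratio (2 * t\<^sup>2) W"
  proof (rule hoeffding_tail[OF f E Q t _ W'])
    show "\<bar>avg (Suc k) f (x(Suc k := y)) - avg (Suc k) f (x(Suc k := y'))\<bar>
        \<le> max 0 (c (Suc k) + e (Suc k))"
      if "k < N" "x \<in> E" "y \<in> space (M (Suc k))" "y' \<in> space (M (Suc k))" for k x y y'
    proof -
      have "card (space (M (Suc k))) = 2" using card that(1) by simp
      then show ?thesis using steps that unfolding bounded_steps_def by blast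
    qed
  qed
  then show "?p \<le> exp_neg_ratio (4 * t\<^sup>2) (2 * W)"
    using exp_neg_ratio_mult_cancel[of 2 "2 * t\<^sup>2" W] by simp
qed

lemma tail_variance:
  assumes f: "bm f" and E: "E \<in> sets PM" and Q: "valid_queries Q f" and t: "0 \<le> t"
    and steps: "bounded_steps E c e f"
    and C: "\<And>x k. x \<in> space PM \<Longrightarrow> k \<in> Q x \<Longrightarrow> c k + e k \<le> C"
    and var: "\<And>k x. k < N \<Longrightarrow> x \<in> E \<Longrightarrow>
      (\<integral>y. (avg (Suc k) f (x(Suc k := y)) - avg k f x)\<^sup>2 \<partial>M (Suc k)) \<le> v (Suc k)"
    and V: "\<And>x. x \<in> space PM \<Longrightarrow> (\<Sum>k\<in>Q x. v k) \<le> V" "0 \<le> V"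
  shows "measure PM {x\<in>space PM. (\<integral>x. f x \<partial>PM) + t \<le> f x \<and> x \<in> E}
      \<le> exp_neg_ratio (t\<^sup>2) (2 * V + 2 * C * t / 3)" (is "?p \<le> _")
    and "0 < V \<Longrightarrow> 0 < C \<Longrightarrow> measure PM {x\<in>space PM. (\<integral>x. f x \<partial>PM) + t \<le> f x \<and> x \<in> E}
      \<le> exp (- (V / C\<^sup>2) * phi (C * t / V))"
proof -
  have Es: "x \<in> space PM" if "x \<in> E" for x using that sets.sets_into_space[OF E] by auto
  have upper: "avg (Suc k) f (x(Suc k := y)) - avg k f x \<le> C"
    if "0 < C" "k < N" "x \<in> E" "Suc k \<in> Q x" "y \<in> space (M (Suc k))" for k x y
  proof -
    have "\<bar>avg (Suc k) f (x(Suc k := y)) - avg k f x\<bar> \<le> max 0 (c (Suc k) + e (Suc k))"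
      using steps that unfolding bounded_steps_def by blast
    then show ?thesis using C[OF Es that(4)] that(1,3) by linarith
  qed
  show "0 < V \<Longrightarrow> 0 < C \<Longrightarrow> ?p \<le> exp (- (V / C\<^sup>2) * phi (C * t / V))"
    by (rule bennett_tail(2)[OF f E Q t _ upper var V])
  show "?p \<le> exp_neg_ratio (t\<^sup>2) (2 * V + 2 * C * t / 3)"
  proof (cases "0 < C")
    case True
    show ?thesis by (rule bennett_tail(1)[OF f E Q t True upper[OF True] var V])
  next
    case False
    \<comment> \<open>With \<open>C \<le> 0\<close> every increment at a queried coordinate
      vanishes, and Hoeffding's bound for range 0 gives probability 0 for positive
      \<open>t\<close>.\<close>
    have "?p \<le> exp_neg_ratio (2 * t\<^sup>2) 0"
    proof (rule hoeffding_tail[OF f E Q t])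
      show "\<bar>avg (Suc k) f (x(Suc k := y)) - avg (Suc k) f (x(Suc k := y'))\<bar> \<le> 0"
        if "k < N" "x \<in> E" "Suc k \<in> Q x" "y \<in> space (M (Suc k))" "y' \<in> space (M (Suc k))" for k x y y'
      proof -
        have "\<bar>avg (Suc k) f (x(Suc k := y)) - avg k f x\<bar> \<le> max 0 (c (Suc k) + e (Suc k))"
          "\<bar>avg (Suc k) f (x(Suc k := y')) - avg k f x\<bar> \<le> max 0 (c (Suc k) + e (Suc k))"
          using steps that unfolding bounded_steps_def by blast+
        then show ?thesis using C[OF Es[OF that(2)] that(3)] False by linarith
      qed
    qed simp
    then show ?thesis
      using exp_neg_ratio_nonneg[of "t\<^sup>2" "2 * V + 2 * C * t / 3"]
      by (cases "t = 0") (auto simp: exp_neg_ratio_def split: if_splits)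
  qed
qed

lemma sum_queries_nonneg:
  assumes "\<And>x. x \<in> space PM \<Longrightarrow> (\<Sum>k\<in>Q x. v k) \<le> V" "valid_queries Q f"
    and "\<And>k. k \<in> {1..N} \<Longrightarrow> 0 \<le> v k"
  shows "0 \<le> (V :: real)"
proof -
  obtain x0 where x0: "x0 \<in> space PM" using PM.not_empty by blast
  have "0 \<le> (\<Sum>k\<in>Q x0. v k)"
    using assms(2,3) x0 unfolding valid_queries_def by (intro sum_nonneg) blast
  then show ?thesis using assms(1)[OF x0] by linarith
qed

text \<open>\<open>u\<close> and \<open>v\<close> stand for 0 and 1, which the arbitrary value type
  does not provide. The variance on two points is an exact multiple of the squared range, so the
  range part of \<open>bounded_steps\<close> is the one to use.\<close>

lemma tail_binary:
  fixes u v :: 'a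
  assumes f: "bm f" and E: "E \<in> sets PM" and Q: "valid_queries Q f" and t: "0 \<le> t"
    and steps: "bounded_steps E c e f"
    and C: "\<And>x k. x \<in> space PM \<Longrightarrow> k \<in> Q x \<Longrightarrow> c k + e k \<le> C"
    and uv: "u \<noteq> v" and bin: "\<And>k. k \<in> {1..N} \<Longrightarrow> space (M k) = {u, v} \<and> sets (M k) = Pow {u, v}"
    and p: "\<And>k. k \<in> {1..N} \<Longrightarrow> p k = measure (M k) {v}"
    and V: "\<And>x. x \<in> space PM \<Longrightarrow> (\<Sum>k\<in>Q x. (1 - p k) * p k * (c k + e k)\<^sup>2) \<le> V"
  shows "measure PM {x\<in>space PM. (\<integral>x. f x \<partial>PM) + t \<le> f x \<and> x \<in> E}
      \<le> exp_neg_ratio (t\<^sup>2) (2 * V + 2 * C * t / 3)"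
    and "0 < V \<Longrightarrow> 0 < C \<Longrightarrow> measure PM {x\<in>space PM. (\<integral>x. f x \<partial>PM) + t \<le> f x \<and> x \<in> E}
      \<le> exp (- (V / C\<^sup>2) * phi (C * t / V))"
proof -
  have p01: "0 \<le> p k" "p k \<le> 1" if "k \<in> {1..N}" for k
    using p[OF that] prob_space.prob_le_1[OF prob_space_factor[OF that]] by auto
  have V0: "0 \<le> V"
    by (rule sum_queries_nonneg[OF V Q]) (use p01 in \<open>auto intro!: mult_nonneg_nonneg\<close>)
  have var: "(\<integral>y. (avg (Suc k) f (x(Suc k := y)) - avg k f x)\<^sup>2 \<partial>M (Suc k))
      \<le> (1 - p (Suc k)) * p (Suc k) * (c (Suc k) + e (Suc k))\<^sup>2"
    if k: "k < N" and x: "x \<in> E" for k x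
  proof -
    have sk: "Suc k \<in> {1..N}" using k by simp
    have xs: "x \<in> space PM" using x sets.sets_into_space[OF E] by auto
    interpret Mk: prob_space "M (Suc k)" by (rule prob_space_factor[OF sk])
    let ?h = "\<lambda>y. avg (Suc k) f (x(Suc k := y))"
    have sp: "space (M (Suc k)) = {u, v}" "sets (M (Suc k)) = Pow {u, v}" using bin[OF sk] by auto
    have "card (space (M (Suc k))) = 2" using sp uv by simp
    then have "\<bar>?h v - ?h u\<bar> \<le> max 0 (c (Suc k) + e (Suc k))"
      using steps k x sp unfolding bounded_steps_def by blast
    then have "\<bar>?h v - ?h u\<bar> \<le> \<bar>c (Suc k) + e (Suc k)\<bar>" by linarith
    then have sq: "(?h v - ?h u)\<^sup>2 \<le> (c (Suc k) + e (Suc k))\<^sup>2" by (simp add: abs_le_square_iff)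
    have "(\<integral>y. (?h y - avg k f x)\<^sup>2 \<partial>M (Suc k)) = (1 - p (Suc k)) * p (Suc k) * (?h v - ?h u)\<^sup>2"
      unfolding avg_step[OF f xs k] p[OF sk] by (rule Mk.binary_variance[OF sp(1) uv sp(2)])
    also have "\<dots> \<le> (1 - p (Suc k)) * p (Suc k) * (c (Suc k) + e (Suc k))\<^sup>2"
      using p01[OF sk] sq by (intro mult_left_mono) auto
    finally show ?thesis .
  qed
  show "measure PM {x\<in>space PM. (\<integral>x. f x \<partial>PM) + t \<le> f x \<and> x \<in> E}
      \<le> exp_neg_ratio (t\<^sup>2) (2 * V + 2 * C * t / 3)"
    by (rule tail_variance(1)[OF f E Q t steps C var V V0])
  show "0 < V \<Longrightarrow> 0 < C \<Longrightarrow> measure PM {x\<in>space PM. (\<integral>x. f x \<partial>PM) + t \<le> f x \<and> x \<in> E}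
      \<le> exp (- (V / C\<^sup>2) * phi (C * t / V))"
    by (rule tail_variance(2)[OF f E Q t steps C var V V0])
qed

text \<open>Only the variance pays for the division by \<open>1 - p k\<close>, through the distance
  to the atom; \<open>C\<close> comes from the deviation from the mean.\<close>

lemma tail_atom:
  assumes f: "bm f" and E: "E \<in> sets PM" and Q: "valid_queries Q f" and t: "0 \<le> t"
    and steps: "bounded_steps E c e f"
    and C: "\<And>x k. x \<in> space PM \<Longrightarrow> k \<in> Q x \<Longrightarrow> c k + e k \<le> C"
    and p: "\<And>k. k \<in> {1..N} \<Longrightarrow> 0 \<le> p k \<and> p k < 1 \<and> (\<exists>\<eta>. atom_mass (M k) \<eta> (1 - p k))"
    and V: "\<And>x. x \<in> space PM \<Longrightarrow> (\<Sum>k\<in>Q x. p k * (c k + e k * inverse (1 - p k))\<^sup>2) \<le> V"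
  shows "measure PM {x\<in>space PM. (\<integral>x. f x \<partial>PM) + t \<le> f x \<and> x \<in> E}
      \<le> exp_neg_ratio (t\<^sup>2) (2 * V + 2 * C * t / 3)"
proof (rule tail_variance(1)[OF f E Q t steps C _ V])
  show "0 \<le> V" by (rule sum_queries_nonneg[OF V Q]) (use p in auto)
  fix k x assume k: "k < N" and x: "x \<in> E"
  have sk: "Suc k \<in> {1..N}" using k by simp
  have xs: "x \<in> space PM" using x sets.sets_into_space[OF E] by auto
  interpret Mk: prob_space "M (Suc k)" by (rule prob_space_factor[OF sk])
  define h where "h y = avg (Suc k) f (x(Suc k := y))" for y
  obtain \<eta> where \<eta>: "atom_mass (M (Suc k)) \<eta> (1 - p (Suc k))" using p[OF sk] by auto
  have "\<bar>h y - h \<eta>\<bar> \<le> max 0 (c (Suc k) + e (Suc k) * inverse (1 - p (Suc k)))"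
    if "y \<in> space (M (Suc k))" for y
    using steps k x that \<eta> p[OF sk] unfolding bounded_steps_def h_def by auto
  then have bd: "\<bar>h y - h \<eta>\<bar> \<le> \<bar>c (Suc k) + e (Suc k) * inverse (1 - p (Suc k))\<bar>"
    if "y \<in> space (M (Suc k))" for y using that by fastforce
  have "(\<integral>y. (h y - Mk.expectation h)\<^sup>2 \<partial>M (Suc k))
      \<le> (1 - (1 - p (Suc k))) * \<bar>c (Suc k) + e (Suc k) * inverse (1 - p (Suc k))\<bar>\<^sup>2"
    using bm_coord(1)[OF bm_avg[OF f] xs sk]
    by (intro Mk.variance_le_atom[where h = h, OF _ \<eta> bd]) (simp_all add: h_def[abs_def])
  then show "(\<integral>y. (avg (Suc k) f (x(Suc k := y)) - avg k f x)\<^sup>2 \<partial>M (Suc k))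
      \<le> p (Suc k) * (c (Suc k) + e (Suc k) * inverse (1 - p (Suc k)))\<^sup>2"
    unfolding avg_step[OF f xs k] h_def by simp
qed

end

section \<open>Query strategies, Harris' inequality and conditioned products\<close>

lemma queries_mono:
  assumes "increasing_queries N S q" "x \<in> S" "1 \<le> i" "i \<le> j" "j \<le> N"
  shows "q i x \<le> q j x"
  using assms(4,5)
proof (induction j rule: dec_induct)
  case (step n)
  then have "q n x \<le> q (Suc n) x"
    using assms(1-3) unfolding increasing_queries_def by auto
  then show ?case using step by simp
qed simp

text \<open>Until \<open>k\<close> is asked for at \<open>x\<close>, monotonicity keeps all queries
  below \<open>k\<close>, where \<open>x\<close> and \<open>y\<close> agree; hence both runs ask the
  same questions up to that moment.\<close>

lemma queries_prefix:
  assumes q: "query_strategy N S f q" and incr: "increasing_queries N S q"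
    and x: "x \<in> S" and y: "y \<in> S" and agree: "\<And>j. j < k \<Longrightarrow> x j = y j"
    and k: "k \<in> (\<lambda>i. q i x) ` {1..N}"
  shows "k \<in> (\<lambda>i. q i y) ` {1..N}"
proof -
  define i0 where "i0 = (LEAST i. i \<in> {1..N} \<and> q i x = k)"
  have "\<exists>i. i \<in> {1..N} \<and> q i x = k" using k by auto
  from LeastI_ex[OF this] have i0: "i0 \<in> {1..N}" "q i0 x = k" unfolding i0_def by auto
  have small: "q j x < k" if j: "1 \<le> j" "j < i0" for j
  proof -
    have "q j x \<noteq> k" using not_less_Least[of j "\<lambda>i. i \<in> {1..N} \<and> q i x = k"] j i0
      unfolding i0_def by auto
    then show ?thesis using queries_mono[OF incr x j(1), of i0] j i0 by auto
  qed
  have "q i x = q i y" if "1 \<le> i" "i \<le> i0" for i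
    using that
  proof (induction i rule: less_induct)
    case (less i)
    have "x (q j x) = y (q j y)" if j: "j \<in> {1..<i}" for j
    proof -
      have "q j x = q j y" using less j by auto
      then show ?thesis using agree[OF small[of j]] j less.prems by auto
    qed
    moreover have "i \<in> {1..N}" using less.prems i0 by auto
    ultimately show ?case using q x y unfolding query_strategy_def by blast
  qed
  from this[of i0] i0 show ?thesis by auto
qed

text \<open>As long as \<open>f\<close> is undetermined each query exposes a new coordinate, so
  after \<open>N\<close> of them either \<open>f\<close> is determined or every coordinate is
  known.\<close>

lemma queries_determine:
  assumes q: "query_strategy N S f q" and N: "1 \<le> N" and S: "S = Pi\<^sub>E {1..N} L" and x: "x \<in> S"
  shows "determined_by S f ((\<lambda>i. q i x) ` {1..N}) x"
proof -
  define J where "J i = (\<lambda>j. q j x) ` {1..i}" for i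
  have "\<forall>i\<in>{1..N}. q i x \<in> {1..N}" using q x unfolding query_strategy_def by blast
  then have sub: "J i \<subseteq> {1..N}" if "i \<le> N" for i using that unfolding J_def by auto
  have J_Suc: "J (Suc i) = insert (q (Suc i) x) (J i)" for i
    unfolding J_def by (simp add: atLeastAtMostSuc_conv)
  have "determined_by S f (J i) x \<or> card (J i) = i" if "1 \<le> i" "i \<le> N" for i
    using that
  proof (induction i rule: dec_induct)
    case base
    show ?case by (simp add: J_def)
  next
    case (step i)
    have i: "i \<in> {1..<N}" using step by auto
    show ?case
    proof (cases "determined_by S f (J i) x")
      case True
      have "J i \<subseteq> J (Suc i)" unfolding J_Suc by auto
      then show ?thesis using True unfolding determined_by_def by blast
    next
      case False
      then have "q (Suc i) x \<notin> J i"
        using q x i unfolding query_strategy_def J_def Let_def by metis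
      moreover have "finite (J i)" by (simp add: J_def)
      ultimately show ?thesis using step False by (simp add: J_Suc)
    qed
  qed
  from this[of N] N consider "determined_by S f (J N) x" | "card (J N) = N" by auto
  then show ?thesis
  proof cases
    case 2
    then have JN: "J N = {1..N}" using sub[of N] by (intro card_subset_eq) auto
    have "y = x" if "y \<in> S" "\<forall>j\<in>{1..N}. y j = x j" for y
      using that x unfolding S by (intro PiE_ext) auto
    then show ?thesis unfolding J_def[symmetric] JN determined_by_def by blast
  qed (simp add: J_def)
qed

section \<open>Harris' inequality on the cube\<close>

lemma cube_le_mix: "cube_le N x y \<Longrightarrow> cube_le N (mix k x z) (mix k y z)"
  by (auto simp: cube_le_def mix_def)

text \<open>Stated for all partial averages so that the coordinates can be treated from the last one
  down: averages of increasing functions increase with the prefix, and each step is the correlation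
  inequality on two points.\<close>

lemma avg_mult_ge:
  fixes M :: "nat \<Rightarrow> 'a::zero_neq_one measure"
  assumes "fin_prod N M" and bin: "binary_spaces N M"
    and F: "fin_prod.bm N M F" "cube_increasing N F"
    and G: "fin_prod.bm N M G" "cube_increasing N G"
    and "k \<le> N" "x \<in> space (PiM {1..N} M)"
  shows "fin_prod.avg N M k F x * fin_prod.avg N M k G x \<le> fin_prod.avg N M k (\<lambda>x. F x * G x) x"
  using assms(7,8)
proof -
  interpret fin_prod N M by fact
  have sp: "space (M k) = {0, 1}" "sets (M k) = Pow {0, 1}" if "k \<in> {1..N}" for k
    using bin that unfolding binary_spaces_def by auto
  have space: "space PM = {1..N} \<rightarrow>\<^sub>E {0, 1}"
    unfolding space_PM using sp by (intro PiE_cong) auto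
  have mono: "avg k H x \<le> avg k H y"
    if H: "bm H" "cube_increasing N H" and xy: "x \<in> space PM" "y \<in> space PM" "cube_le N x y" for H k x y
    unfolding avg_def
  proof (rule integral_mono)
    fix z assume z: "z \<in> space PM"
    show "H (mix k x z) \<le> H (mix k y z)"
      by (rule H(2)[unfolded cube_increasing_def, folded space, rule_format])
        (rule mix_space[OF xy(1) z] mix_space[OF xy(2) z] cube_le_mix[OF xy(3)])+
  qed (intro bm_avg_integrable H xy)+
  show ?thesis
    using assms(7,8)
  proof (induction k arbitrary: x rule: inc_induct)
    case base
    then show ?case using F G by (simp add: avg_top bm_mult)
  next
    case (step k)
    have k: "k < N" and sk: "Suc k \<in> {1..N}" using step by auto
    note x = step.prems
    interpret Mk: prob_space "M (Suc k)" by (rule prob_space_factor[OF sk])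
    define p where "p = Mk.prob {1}"
    define h where "h y = avg (Suc k) F (x(Suc k := y))" for y
    define g where "g y = avg (Suc k) G (x(Suc k := y))" for y
    have E: "Mk.expectation u = (1 - p) * u 0 + p * u 1" for u :: "'a \<Rightarrow> real"
      unfolding p_def by (rule Mk.binary_expectation[OF sp(1)[OF sk] _ sp(2)[OF sk]]) simp
    have p: "0 \<le> p" "p \<le> 1" unfolding p_def by (auto intro: Mk.prob_le_1)
    have xs: "x(Suc k := 0) \<in> space PM" "x(Suc k := 1) \<in> space PM"
      using upd_space[OF x sk] sp[OF sk] by auto
    have "cube_le N (x(Suc k := 0)) (x(Suc k := 1))" by (auto simp: cube_le_def)
    then have hg: "h 0 \<le> h 1" "g 0 \<le> g 1"
      unfolding h_def g_def using mono[OF F xs] mono[OF G xs] by auto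
    have "avg k F x * avg k G x = ((1 - p) * h 0 + p * h 1) * ((1 - p) * g 0 + p * g 1)"
      unfolding avg_step[OF F(1) x k] avg_step[OF G(1) x k] E h_def g_def ..
    \<comment> \<open>The subtracted term is the covariance of \<open>h\<close> and \<open>g\<close>
      under the two-point law.\<close>
    also have "\<dots> = (1 - p) * (h 0 * g 0) + p * (h 1 * g 1) - p * (1 - p) * ((h 1 - h 0) * (g 1 - g 0))"
      by (simp add: algebra_simps)
    also have "\<dots> \<le> (1 - p) * (h 0 * g 0) + p * (h 1 * g 1)"
      using p hg by simp
    also have "\<dots> \<le> (1 - p) * avg (Suc k) (\<lambda>x. F x * G x) (x(Suc k := 0))
        + p * avg (Suc k) (\<lambda>x. F x * G x) (x(Suc k := 1))"
      unfolding h_def g_def using p by (intro add_mono mult_left_mono step.IH xs) auto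
    also have "\<dots> = avg k (\<lambda>x. F x * G x) x"
      unfolding avg_step[OF bm_mult[OF F(1) G(1)] x k] E ..
    finally show ?case .
  qed
qed

lemma harris_inequality:
  fixes M :: "nat \<Rightarrow> 'a::zero_neq_one measure"
  assumes "fin_prod N M" "binary_spaces N M"
    and "fin_prod.bm N M F" "cube_increasing N F" "fin_prod.bm N M G" "cube_increasing N G"
  shows "(\<integral>x. F x \<partial>PiM {1..N} M) * (\<integral>x. G x \<partial>PiM {1..N} M) \<le> (\<integral>x. F x * G x \<partial>PiM {1..N} M)"
proof -
  interpret fin_prod N M by fact
  obtain x0 where x0: "x0 \<in> space PM" using PM.not_empty by blast
  from avg_mult_ge[OF assms le0 x0] show ?thesis by (simp add: avg_0[OF x0])
qed

section \<open>Conditioned factors and their products\<close>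

text \<open>The space itself shrinks to \<open>A\<close>. The conditioned product then has exactly
  the box of the \<open>G k\<close> as its points, so that a condition assumed on the box holds at
  all of them.\<close>

definition cond_measure :: "'a measure \<Rightarrow> 'a set \<Rightarrow> 'a measure" where
  "cond_measure M A = density (restrict_space M A) (\<lambda>_. ennreal (1 / measure M A))"

context prob_space
begin

context
  fixes A assumes A: "A \<in> events" "0 < prob A"
begin

lemma space_cond_measure [simp]: "space (cond_measure M A) = A"
  using A sets.sets_into_space unfolding cond_measure_def by (auto simp: space_restrict_space)

lemma sets_cond_measure [measurable_cong]: "sets (cond_measure M A) = sets (restrict_space M A)"
  unfolding cond_measure_def by simp

lemma measurable_cond_measure: "h \<in> M \<rightarrow>\<^sub>M M' \<Longrightarrow> h \<in> cond_measure M A \<rightarrow>\<^sub>M M'"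
  using measurable_restrict_space1[of h M M' A] measurable_cong_sets[OF sets_cond_measure refl] by blast

lemma integral_cond_measure:
  fixes h :: "'a \<Rightarrow> real"
  assumes "h \<in> borel_measurable M"
  shows "(\<integral>y. h y \<partial>cond_measure M A) = (\<integral>y. indicator A y * h y \<partial>M) / prob A"
proof -
  have "h \<in> borel_measurable (restrict_space M A)" using assms by (rule measurable_restrict_space1)
  then have "(\<integral>y. h y \<partial>cond_measure M A) = (\<integral>y. (1 / prob A) *\<^sub>R h y \<partial>restrict_space M A)"
    unfolding cond_measure_def using A by (intro integral_density) auto
  also have "\<dots> = (\<integral>y. indicator A y *\<^sub>R ((1 / prob A) *\<^sub>R h y) \<partial>M)"
    using A by (intro integral_restrict_space) auto
  also have "\<dots> = (\<integral>y. (indicator A y * h y) / prob A \<partial>M)" by (simp add: field_simps)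
  finally show ?thesis by simp
qed

lemma prob_space_cond_measure: "prob_space (cond_measure M A)"
proof
  have "emeasure (cond_measure M A) (space (cond_measure M A))
      = (\<integral>\<^sup>+y. ennreal (1 / prob A) \<partial>restrict_space M A)"
    unfolding cond_measure_def by (subst emeasure_density) (auto intro!: nn_integral_cong)
  also have "\<dots> = ennreal (1 / prob A) * emeasure M A"
    using A sets.sets_into_space by (subst nn_integral_const) (simp add: space_restrict_space emeasure_restrict_space Int_absorb2)
  also have "\<dots> = 1" using A by (simp add: emeasure_eq_measure ennreal_mult[symmetric])
  finally show "emeasure (cond_measure M A) (space (cond_measure M A)) = 1" .
qed

text \<open>Values off \<open>A\<close> are at least every value on \<open>A\<close>, hence at least
  the conditional mean \<open>m\<close>; replacing them by \<open>m\<close> gives a function below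
  \<open>h\<close> whose integral is \<open>m\<close>.\<close>

lemma integral_cond_measure_le:
  fixes h :: "'a \<Rightarrow> real"
  assumes h: "h \<in> borel_measurable M" "\<And>y. y \<in> space M \<Longrightarrow> \<bar>h y\<bar> \<le> K"
    and mono: "\<And>y y'. y \<in> space M - A \<Longrightarrow> y' \<in> A \<Longrightarrow> h y' \<le> h y"
  shows "(\<integral>y. h y \<partial>cond_measure M A) \<le> expectation h"
proof -
  interpret C: prob_space "cond_measure M A" by (rule prob_space_cond_measure)
  define m where "m = (\<integral>y. h y \<partial>cond_measure M A)"
  have AM: "A \<subseteq> space M" using A sets.sets_into_space by auto
  have int: "integrable M h" using h by (intro integrable_const_bound[where B = K]) auto
  have intA: "integrable M (\<lambda>y. indicator A y * h y)" "integrable M (\<lambda>y. indicator A y * m)"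
    using A int integrable_mult_indicator[of A M h]
    by (auto intro!: integrable_mult_left integrable_real_indicator simp: emeasure_eq_measure)
  have intC: "integrable (cond_measure M A) h"
    using h(2) AM measurable_cond_measure[OF h(1)] by (intro C.integrable_const_bound[where B = K]) (auto intro!: AE_I2)
  have outside: "m \<le> h y" if "y \<in> space M - A" for y
  proof -
    have "m \<le> (\<integral>_. h y \<partial>cond_measure M A)"
      unfolding m_def using mono[OF that] intC by (intro integral_mono) auto
    then show ?thesis using C.prob_space by simp
  qed
  have inside: "(\<integral>y. indicator A y * h y \<partial>M) = prob A * m"
    using integral_cond_measure[OF h(1)] A by (simp add: m_def)
  have "m = (\<integral>y. indicator A y * h y \<partial>M) + (m - (\<integral>y. indicator A y * m \<partial>M))"
    using A unfolding inside by simp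
  also have "\<dots> = (\<integral>y. indicator A y * h y + (m - indicator A y * m) \<partial>M)"
    using intA by (simp only: Bochner_Integration.integral_add Bochner_Integration.integral_diff
      Bochner_Integration.integrable_diff integrable_const lebesgue_integral_const) (simp add: prob_space)
  also have "\<dots> \<le> expectation h"
  proof (rule integral_mono)
    fix y assume "y \<in> space M"
    then show "indicator A y * h y + (m - indicator A y * m) \<le> h y"
      using outside[of y] by (cases "y \<in> A") auto
  qed (use intA int in auto)
  finally show ?thesis unfolding m_def .
qed

end

end

locale fin_prod_cond = fin_prod N M for N and M :: "nat \<Rightarrow> 'a measure" +
  fixes G :: "nat \<Rightarrow> 'a set"
  assumes G_sets: "k \<in> {1..N} \<Longrightarrow> G k \<in> sets (M k)"
    and G_pos: "k \<in> {1..N} \<Longrightarrow> 0 < measure (M k) (G k)"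
begin

sublocale R: fin_prod N "\<lambda>k. cond_measure (M k) (G k)"
  by (rule fin_prod.intro) (intro prob_space.prob_space_cond_measure prob_space_factor G_sets G_pos)

lemma space_R: "space R.PM = (\<Pi>\<^sub>E k\<in>{1..N}. G k)"
  unfolding R.space_PM
  by (intro PiE_cong prob_space.space_cond_measure prob_space_factor G_sets G_pos)

lemma G_sub: "k \<in> {1..N} \<Longrightarrow> G k \<subseteq> space (M k)"
  using sets.sets_into_space[OF G_sets] .

lemma space_R_sub: "space R.PM \<subseteq> space PM"
  unfolding space_R space_PM by (intro PiE_mono G_sub)

lemma space_R_sets: "space R.PM \<in> sets PM"
  unfolding space_R using G_sets by (intro sets_PiM_I_finite) auto

lemma measurable_inclusion: "(\<lambda>x. x) \<in> R.PM \<rightarrow>\<^sub>M PM"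
proof (rule measurable_PiM_single')
  fix i assume i: "i \<in> {1..N}"
  have "(\<lambda>y. y) \<in> cond_measure (M i) (G i) \<rightarrow>\<^sub>M M i"
    using i by (intro prob_space.measurable_cond_measure prob_space_factor G_sets G_pos) auto
  then show "(\<lambda>x. x i) \<in> R.PM \<rightarrow>\<^sub>M M i"
    by (rule measurable_compose[OF measurable_component_singleton[OF i,
          where M = "\<lambda>k. cond_measure (M k) (G k)"]])
next
  show "(\<lambda>x i. x i) \<in> space R.PM \<rightarrow> (\<Pi>\<^sub>E i\<in>{1..N}. space (M i))"
    using space_R_sub by (auto simp: space_PM[symmetric])
qed

lemma bm_R:
  assumes "bm F"
  shows "R.bm F"
proof -
  have "F \<in> borel_measurable R.PM"
    using measurable_compose[OF measurable_inclusion bm_measurable[OF assms]] by simp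
  then show ?thesis
    using bm_bound[OF assms] space_R_sub unfolding R.bm_def by blast
qed

lemma sets_R: 
  assumes "E \<in> sets PM"
  shows "E \<inter> space R.PM \<in> sets R.PM"
  using measurable_sets[OF measurable_inclusion assms] by simp

lemma upd_R:
  assumes "x \<in> space R.PM" "k \<in> {1..N}" "y \<in> G k"
  shows "x(k := y) \<in> space R.PM"
  using assms unfolding space_R by (rule fun_upd_mem_PiE)

text \<open>For a function that lives on the box, values of a coordinate outside \<open>G j\<close>
  contribute nothing, so each coordinate still to be averaged can be conditioned at the price of its
  mass.\<close>

lemma avg_cond:
  assumes F: "bm F" and supp: "\<And>x. x \<in> space PM \<Longrightarrow> x \<notin> space R.PM \<Longrightarrow> F x = 0"
    and "k \<le> N" "x \<in> space R.PM"
  shows "avg k F x = (\<Prod>j\<in>{k<..N}. measure (M j) (G j)) * R.avg k F x"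
  using assms(3,4)
proof (induction k arbitrary: x rule: inc_induct)
  case base
  then show ?case using space_R_sub by (auto simp: avg_top F R.avg_top bm_R)
next
  case (step k)
  note x = step.prems
  have k: "k < N" and sk: "Suc k \<in> {1..N}" using step by auto
  have xs: "x \<in> space PM" using x space_R_sub by auto
  interpret Mk: prob_space "M (Suc k)" by (rule prob_space_factor[OF sk])
  note GA = G_sets[OF sk] G_pos[OF sk]
  define P where "P = (\<Prod>j\<in>{Suc k<..N}. measure (M j) (G j))"
  have PSuc: "(\<Prod>j\<in>{k<..N}. measure (M j) (G j)) = Mk.prob (G (Suc k)) * P"
  proof -
    have "{k<..N} = insert (Suc k) {Suc k<..N}" using k by auto
    then show ?thesis unfolding P_def by simp
  qed
  have "avg k F x = (\<integral>y. avg (Suc k) F (x(Suc k := y)) \<partial>M (Suc k))"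
    by (rule avg_step[OF F xs k])
  also have "\<dots> = (\<integral>y. indicator (G (Suc k)) y * avg (Suc k) F (x(Suc k := y)) \<partial>M (Suc k))"
  proof (rule Bochner_Integration.integral_cong[OF refl])
    fix y assume y: "y \<in> space (M (Suc k))"
    show "avg (Suc k) F (x(Suc k := y)) = indicator (G (Suc k)) y * avg (Suc k) F (x(Suc k := y))"
    proof (cases "y \<in> G (Suc k)")
      case False
      have "F (mix (Suc k) (x(Suc k := y)) z) = 0" if z: "z \<in> space PM" for z
      proof (rule supp)
        show "mix (Suc k) (x(Suc k := y)) z \<in> space PM"
          by (intro mix_space upd_space xs sk y z)
        have "mix (Suc k) (x(Suc k := y)) z (Suc k) = y" by (simp add: mix_def)
        then show "mix (Suc k) (x(Suc k := y)) z \<notin> space R.PM"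
          using False sk unfolding space_R by (metis PiE_mem)
      qed
      then have "avg (Suc k) F (x(Suc k := y)) = (\<integral>z. 0 \<partial>PM)"
        unfolding avg_def by (intro Bochner_Integration.integral_cong) auto
      then show ?thesis by simp
    qed simp
  qed
  also have "\<dots> = Mk.prob (G (Suc k)) * (\<integral>y. avg (Suc k) F (x(Suc k := y)) \<partial>cond_measure (M (Suc k)) (G (Suc k)))"
    using GA(2) by (simp add: Mk.integral_cond_measure[OF GA bm_coord(1)[OF bm_avg[OF F] xs sk]])
  also have "(\<integral>y. avg (Suc k) F (x(Suc k := y)) \<partial>cond_measure (M (Suc k)) (G (Suc k)))
      = (\<integral>y. P * R.avg (Suc k) F (x(Suc k := y)) \<partial>cond_measure (M (Suc k)) (G (Suc k)))"
    unfolding P_def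
    using Mk.space_cond_measure[OF GA] upd_R[OF x sk]
    by (intro Bochner_Integration.integral_cong[OF refl] step.IH) (auto simp: fun_upd_def)
  also have "\<dots> = P * R.avg k F x"
    by (simp add: R.avg_step[OF bm_R[OF F] x k])
  finally show ?case by (simp add: PSuc)
qed

lemma integral_cond:
  assumes F: "bm F" and supp: "\<And>x. x \<in> space PM \<Longrightarrow> x \<notin> space R.PM \<Longrightarrow> F x = 0"
  shows "(\<integral>x. F x \<partial>PM) = measure PM (space R.PM) * (\<integral>x. F x \<partial>R.PM)"
proof -
  obtain x0 where x0: "x0 \<in> space R.PM" using R.PM.not_empty by blast
  then have x0': "x0 \<in> space PM" using space_R_sub by auto
  have *: "(\<integral>x. H x \<partial>PM) = (\<Prod>j\<in>{0<..N}. measure (M j) (G j)) * (\<integral>x. H x \<partial>R.PM)"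
    if "bm H" "\<And>x. x \<in> space PM \<Longrightarrow> x \<notin> space R.PM \<Longrightarrow> H x = 0" for H
    using avg_cond[OF that le0 x0] by (simp add: avg_0[OF x0'] R.avg_0[OF x0])
  \<comment> \<open>The indicator of the box identifies the product of the masses with the measure
    of the box.\<close>
  have "(\<integral>x. indicator (space R.PM) x \<partial>R.PM) = (\<integral>x. 1 \<partial>R.PM)"
    by (intro Bochner_Integration.integral_cong) auto
  with *[of "indicator (space R.PM)"] have "measure PM (space R.PM) = (\<Prod>j\<in>{0<..N}. measure (M j) (G j))"
    using space_R_sub space_R_sets by (simp add: bm_indicator Int_absorb2 R.PM.prob_space)
  then show ?thesis using *[OF F supp] by simp
qed

lemma measure_cond:
  assumes "E \<in> sets PM" "E \<subseteq> space R.PM"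
  shows "measure PM E = measure PM (space R.PM) * measure R.PM E"
proof -
  have "E \<in> sets R.PM" using sets_R[OF assms(1)] assms(2) by (simp add: Int_absorb2)
  moreover have "(\<integral>x. indicator E x \<partial>PM) = measure PM (space R.PM) * (\<integral>x. indicator E x \<partial>R.PM :: real)"
    using assms by (intro integral_cond bm_indicator) (auto simp: indicator_def)
  ultimately show ?thesis
    using assms space_R_sub by (simp add: Int_absorb2)
qed

text \<open>\<Gamma> lies in the box, so confining the remaining coordinates to it can only raise
  the probability of \<Gamma>. Hence the exceptional event formed under the original law also
  controls the conditioned one.\<close>

lemma fail_cond:
  assumes \<Gamma>: "\<Gamma> \<in> sets PM" "\<Gamma> \<subseteq> space R.PM" and k: "k \<le> N" and x: "x \<in> space R.PM"
  shows "R.fail \<Gamma> k x \<le> fail \<Gamma> k x"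
proof -
  have xs: "x \<in> space PM" using x space_R_sub by auto
  have \<Gamma>R: "\<Gamma> \<in> sets R.PM" using sets_R[OF \<Gamma>(1)] \<Gamma>(2) by (simp add: Int_absorb2)
  have ind: "bm (indicator \<Gamma> :: _ \<Rightarrow> real)" by (rule bm_indicator[OF \<Gamma>(1)])
  have "fail \<Gamma> k x = (\<integral>z. 1 - indicator \<Gamma> (mix k x z) \<partial>PM)"
    unfolding fail_def avg_def
    using mix_space[OF xs] by (intro Bochner_Integration.integral_cong) (auto simp: indicator_def)
  also have "\<dots> = 1 - avg k (indicator \<Gamma>) x"
    unfolding avg_def using bm_avg_integrable[OF ind xs] by (simp add: PM.prob_space)
  finally have 1: "fail \<Gamma> k x = 1 - avg k (indicator \<Gamma>) x" .
  have "R.fail \<Gamma> k x = (\<integral>z. 1 - indicator \<Gamma> (mix k x z) \<partial>R.PM)"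
    unfolding R.fail_def R.avg_def
    using R.mix_space[OF x] by (intro Bochner_Integration.integral_cong) (auto simp: indicator_def)
  also have "\<dots> = 1 - R.avg k (indicator \<Gamma>) x"
    unfolding R.avg_def using R.bm_avg_integrable[OF R.bm_indicator[OF \<Gamma>R] x] by (simp add: R.PM.prob_space)
  finally have 2: "R.fail \<Gamma> k x = 1 - R.avg k (indicator \<Gamma>) x" .
  have "avg k (indicator \<Gamma>) x = (\<Prod>j\<in>{k<..N}. measure (M j) (G j)) * R.avg k (indicator \<Gamma>) x"
    using \<Gamma>(2) by (intro avg_cond[OF ind _ k x]) (auto simp: indicator_def)
  also have "\<dots> \<le> 1 * R.avg k (indicator \<Gamma>) x"
  proof (intro mult_right_mono prod_le_1)
    show "0 \<le> measure (M j) (G j) \<and> measure (M j) (G j) \<le> 1" if "j \<in> {k<..N}" for j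
      using that prob_space.prob_le_1[OF prob_space_factor, of j] by auto
    show "0 \<le> R.avg k (indicator \<Gamma>) x"
      unfolding R.avg_def by (intro Bochner_Integration.integral_nonneg) auto
  qed
  finally show ?thesis unfolding 1 2 by simp
qed

text \<open>The coordinates are conditioned one at a time. Moving one from outside
  \<open>G k\<close> into it can only lower \<open>f\<close>, and averages inherit this.\<close>

lemma avg_cond_le:
  assumes f: "bm f"
    and mono: "\<And>k x y. k \<in> {1..N} \<Longrightarrow> x \<in> space PM \<Longrightarrow> y \<in> space PM \<Longrightarrow> differ_only k x y \<Longrightarrow>
      x k \<notin> G k \<Longrightarrow> y k \<in> G k \<Longrightarrow> f y \<le> f x"
    and "k \<le> N" "x \<in> space R.PM"
  shows "R.avg k f x \<le> avg k f x"
  using assms(3,4)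
proof (induction k arbitrary: x rule: inc_induct)
  case base
  then show ?case using space_R_sub by (auto simp: avg_top f R.avg_top bm_R)
next
  case (step k)
  note x = step.prems
  have k: "k < N" and sk: "Suc k \<in> {1..N}" using step by auto
  have xs: "x \<in> space PM" using x space_R_sub by auto
  interpret Mk: prob_space "M (Suc k)" by (rule prob_space_factor[OF sk])
  note GA = G_sets[OF sk] G_pos[OF sk]
  interpret Ck: prob_space "cond_measure (M (Suc k)) (G (Suc k))"
    by (rule Mk.prob_space_cond_measure[OF GA])
  note h = bm_coord[OF bm_avg[OF f] xs sk]
  obtain K where K: "\<And>y. y \<in> space (M (Suc k)) \<Longrightarrow> \<bar>avg (Suc k) f (x(Suc k := y))\<bar> \<le> K"
    using h(2) by blast
  have intC: "integrable (cond_measure (M (Suc k)) (G (Suc k))) (\<lambda>y. avg (Suc k) f (x(Suc k := y)))"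
    using Mk.measurable_cond_measure[OF GA h(1)] K G_sub[OF sk] Mk.space_cond_measure[OF GA]
    by (intro Ck.integrable_const_bound[where B = K]) (auto intro!: AE_I2)
  have "R.avg k f x = (\<integral>y. R.avg (Suc k) f (x(Suc k := y)) \<partial>cond_measure (M (Suc k)) (G (Suc k)))"
    by (rule R.avg_step[OF bm_R[OF f] x k])
  also have "\<dots> \<le> (\<integral>y. avg (Suc k) f (x(Suc k := y)) \<partial>cond_measure (M (Suc k)) (G (Suc k)))"
    using Mk.space_cond_measure[OF GA] upd_R[OF x sk] intC
      R.bm_coord(3)[OF R.bm_avg[OF bm_R[OF f]] x sk]
    by (intro integral_mono step.IH) (auto simp: fun_upd_def)
  also have "\<dots> \<le> (\<integral>y. avg (Suc k) f (x(Suc k := y)) \<partial>M (Suc k))"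
  proof (rule Mk.integral_cond_measure_le[OF GA h(1) K])
    fix y y' assume y: "y \<in> space (M (Suc k)) - G (Suc k)" "y' \<in> G (Suc k)"
    then have y's: "y' \<in> space (M (Suc k))" using G_sub[OF sk] by auto
    have xy: "x(Suc k := y) \<in> space PM" "x(Suc k := y') \<in> space PM"
      using upd_space[OF xs sk] y y's by auto
    show "avg (Suc k) f (x(Suc k := y')) \<le> avg (Suc k) f (x(Suc k := y))"
      unfolding avg_def
    proof (rule integral_mono)
      fix z assume z: "z \<in> space PM"
      show "f (mix (Suc k) (x(Suc k := y')) z) \<le> f (mix (Suc k) (x(Suc k := y)) z)"
        using y mix_space[OF xy(1) z] mix_space[OF xy(2) z]
        by (intro mono[OF sk]) (auto simp: differ_only_def mix_def)
    qed (intro bm_avg_integrable f xy)+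
  qed auto
  also have "\<dots> = avg k f x" by (rule avg_step[OF f xs k, symmetric])
  finally show ?case .
qed

lemma integral_cond_le:
  assumes "bm f"
    and "\<And>k x y. k \<in> {1..N} \<Longrightarrow> x \<in> space PM \<Longrightarrow> y \<in> space PM \<Longrightarrow> differ_only k x y \<Longrightarrow>
      x k \<notin> G k \<Longrightarrow> y k \<in> G k \<Longrightarrow> f y \<le> f x"
  shows "(\<integral>x. f x \<partial>R.PM) \<le> (\<integral>x. f x \<partial>PM)"
proof -
  obtain x0 where x0: "x0 \<in> space R.PM" using R.PM.not_empty by blast
  then have x0': "x0 \<in> space PM" using space_R_sub by auto
  show ?thesis using avg_cond_le[OF assms le0 x0] by (simp add: avg_0[OF x0'] R.avg_0[OF x0])
qed

text \<open>On the box \<open>f\<close> averages to the conditional mean \<open>m\<close>; elsewhere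
  it is still at least \<open>m - s\<close>.\<close>

lemma integral_cond_le_add:
  assumes f: "bm f" and s: "\<And>x y. x \<in> space PM \<Longrightarrow> y \<in> space PM \<Longrightarrow> \<bar>f x - f y\<bar> \<le> s"
  shows "(\<integral>x. f x \<partial>R.PM) \<le> (\<integral>x. f x \<partial>PM) + s * measure PM (space PM - space R.PM)"
proof -
  define m where "m = (\<integral>x. f x \<partial>R.PM)"
  let ?G = "space R.PM"
  have ind: "bm (indicator ?G :: _ \<Rightarrow> real)" by (rule bm_indicator[OF space_R_sets])
  have lower: "m - s \<le> f x" if x: "x \<in> space PM" for x
  proof -
    have "m \<le> (\<integral>_. f x + s \<partial>R.PM)"
      unfolding m_def using R.bm_integrable[OF bm_R[OF f]]
    proof (rule integral_mono)
      fix y assume "y \<in> space R.PM"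
      then have "\<bar>f x - f y\<bar> \<le> s" using s x space_R_sub by auto
      then show "f y \<le> f x + s" by linarith
    qed simp
    then show ?thesis by (simp add: R.PM.prob_space)
  qed
  have fG: "bm (\<lambda>x. f x * indicator ?G x)" by (intro bm_mult f ind)
  have "(\<integral>x. f x * indicator ?G x \<partial>R.PM) = m"
    unfolding m_def by (intro Bochner_Integration.integral_cong) auto
  then have inside: "(\<integral>x. f x * indicator ?G x \<partial>PM) = measure PM ?G * m"
    using integral_cond[OF fG] by (simp add: indicator_def)
  have intN: "integrable PM (indicator (space PM - ?G) :: _ \<Rightarrow> real)"
    using space_R_sets by (intro bm_integrable bm_indicator) auto
  have comp: "measure PM (space PM - ?G) = 1 - measure PM ?G"
    by (rule PM.prob_compl[OF space_R_sets])
  have "measure PM ?G * m + (m - s) * measure PM (space PM - ?G)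
      = (\<integral>x. f x * indicator ?G x + (m - s) * indicator (space PM - ?G) x \<partial>PM)"
    using bm_integrable[OF fG] intN space_R_sets inside by (subst Bochner_Integration.integral_add) auto
  also have "\<dots> \<le> (\<integral>x. f x \<partial>PM)"
  proof (rule integral_mono)
    fix x assume "x \<in> space PM"
    then show "f x * indicator ?G x + (m - s) * indicator (space PM - ?G) x \<le> f x"
      using lower[of x] by (cases "x \<in> ?G") auto
  qed (use bm_integrable[OF fG] bm_integrable[OF f] intN in auto)
  finally show ?thesis unfolding m_def[symmetric] comp by (simp add: algebra_simps)
qed

end

section \<open>Query sets of a strategy; tails of Lipschitz functions\<close>

lemma finite_query_sets:
  assumes "query_strategy N S f q"
  shows "finite (query_sets N S q)"
proof (rule finite_subset)
  have "\<forall>x\<in>S. \<forall>i\<in>{1..N}. q i x \<in> {1..N}" using assms unfolding query_strategy_def by blast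
  then show "query_sets N S q \<subseteq> Pow {1..N}" unfolding query_sets_def by auto
qed simp

lemma query_sets_Max_ge:
  fixes h :: "nat set \<Rightarrow> real"
  assumes "query_strategy N S f q" "x \<in> S"
  shows "h ((\<lambda>i. q i x) ` {1..N}) \<le> (MAX Q\<in>query_sets N S q. h Q)"
  using finite_query_sets[OF assms(1)] assms(2) by (intro Max_ge) (auto simp: query_sets_def)

lemma query_sets_Max_Max_ge:
  fixes c :: "nat \<Rightarrow> real"
  assumes "query_strategy N S f q" "x \<in> S" "k \<in> (\<lambda>i. q i x) ` {1..N}"
  shows "c k \<le> (MAX Q\<in>query_sets N S q. MAX k\<in>Q. c k)"
proof -
  have "c k \<le> (MAX k\<in>(\<lambda>i. q i x) ` {1..N}. c k)" using assms(3) by (intro Max_ge) auto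
  also have "\<dots> \<le> (MAX Q\<in>query_sets N S q. MAX k\<in>Q. c k)"
    by (rule query_sets_Max_ge[OF assms(1,2)])
  finally show ?thesis .
qed

context fin_prod
begin

text \<open>\<open>S\<close> may be larger than the space, because a strategy for the full product
  is also run on the conditioned one.\<close>

lemma valid_queries_strategy:
  assumes q: "query_strategy N S f q" and incr: "increasing_queries N S q" and N: "1 \<le> N"
    and S: "S = Pi\<^sub>E {1..N} D" and sub: "space PM \<subseteq> S"
  shows "valid_queries (\<lambda>x. (\<lambda>i. q i x) ` {1..N}) f"
  unfolding valid_queries_def
proof (intro conjI ballI impI)
  fix x assume "x \<in> space PM"
  then have x: "x \<in> S" using sub by auto
  have "\<forall>x\<in>S. \<forall>i\<in>{1..N}. q i x \<in> {1..N}" using q unfolding query_strategy_def by blast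
  then show "(\<lambda>i. q i x) ` {1..N} \<subseteq> {1..N}" using x by auto
next
  fix x y k assume xy: "x \<in> space PM" "y \<in> space PM" and agree: "\<forall>j<k. x j = y j"
  then have xy': "x \<in> S" "y \<in> S" using sub by auto
  show "(k \<in> (\<lambda>i. q i x) ` {1..N}) = (k \<in> (\<lambda>i. q i y) ` {1..N})"
    using queries_prefix[OF q incr xy'] queries_prefix[OF q incr xy'(2,1)] agree by metis
next
  fix x y assume xy: "x \<in> space PM" "y \<in> space PM"
    and agree: "\<forall>j\<in>(\<lambda>i. q i x) ` {1..N}. x j = y j"
  then have xy': "x \<in> S" "y \<in> S" using sub by auto
  show "f y = f x"
    using queries_determine[OF q N S xy'(1)] xy'(2) agree unfolding determined_by_def by auto
qed

lemma bm_osc: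
  assumes "f \<in> borel_measurable PM" "\<And>x y. x \<in> space PM \<Longrightarrow> y \<in> space PM \<Longrightarrow> \<bar>f x - f y\<bar> \<le> s"
  shows "bm f"
proof -
  obtain x0 where x0: "x0 \<in> space PM" using PM.not_empty by blast
  have "\<bar>f x\<bar> \<le> \<bar>f x0\<bar> + s" if "x \<in> space PM" for x
    using assms(2)[OF that x0] by linarith
  then show ?thesis using assms(1) unfolding bm_def by blast
qed

text \<open>Boundedness comes from walking from \<open>y\<close> to \<open>x\<close> along the
  points \<open>mix k x y\<close>, one coordinate at a time. The maximum with 0 allows for a
  negative \<open>b k\<close> at a factor with a single point.\<close>

lemma bm_lipschitz:
  assumes f: "f \<in> borel_measurable PM"
    and lip: "\<And>k x y. k \<in> {1..N} \<Longrightarrow> x \<in> space PM \<Longrightarrow> y \<in> space PM \<Longrightarrow> differ_only k x y \<Longrightarrow>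
      \<bar>f x - f y\<bar> \<le> b k"
  shows "bm f"
proof (rule bm_osc[OF f])
  fix x y assume x: "x \<in> space PM" and y: "y \<in> space PM"
  have "\<bar>f (mix k x y) - f y\<bar> \<le> (\<Sum>j<k. max 0 (b (Suc j)))" if "k \<le> N" for k
    using that
  proof (induction k)
    case 0
    then show ?case using mix_0[OF x y] by simp
  next
    case (Suc k)
    have "\<bar>f (mix (Suc k) x y) - f (mix k x y)\<bar> \<le> max 0 (b (Suc k))"
    proof (cases "x (Suc k) = y (Suc k)")
      case True
      then have "mix (Suc k) x y = mix k x y" by (auto simp: mix_def fun_eq_iff le_Suc_eq)
      then show ?thesis by simp
    next
      case False
      then have "differ_only (Suc k) (mix (Suc k) x y) (mix k x y)"
        by (auto simp: mix_def differ_only_def le_Suc_eq)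
      then have "\<bar>f (mix (Suc k) x y) - f (mix k x y)\<bar> \<le> b (Suc k)"
        using Suc.prems mix_space[OF x y] by (intro lip) auto
      then show ?thesis by simp
    qed
    then show ?case using Suc by simp
  qed
  moreover have "mix N x y = x"
    using x y by (auto simp: space_PM mix_def PiE_def extensional_def fun_eq_iff)
  ultimately show "\<bar>f x - f y\<bar> \<le> (\<Sum>j<N. max 0 (b (Suc j)))" by (metis order_refl)
qed

text \<open>The summand 0 is the error term of \<open>bounded_steps\<close> in the absence of
  failures.\<close>

lemma range_lipschitz:
  assumes f: "bm f"
    and lip: "\<And>k x y. k \<in> {1..N} \<Longrightarrow> x \<in> space PM \<Longrightarrow> y \<in> space PM \<Longrightarrow> differ_only k x y \<Longrightarrow>
      \<bar>f x - f y\<bar> \<le> c k"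
    and k: "k < N" and x: "x \<in> space PM" and y: "y \<in> space (M (Suc k))" "y' \<in> space (M (Suc k))"
  shows "\<bar>avg (Suc k) f (x(Suc k := y)) - avg (Suc k) f (x(Suc k := y'))\<bar> \<le> max 0 (c (Suc k) + 0)"
proof (cases "y = y'")
  case False
  have sk: "Suc k \<in> {1..N}" using k by simp
  show ?thesis
    using avg_diff_le[OF f bm_const[of 0] x k y False, of "c (Suc k)" 0 0] lip[OF sk] by auto
qed simp

lemma tail_lipschitz:
  assumes f: "bm f" and E: "E \<in> sets PM" and Q: "valid_queries Q f" and t: "0 \<le> t"
    and lip: "\<And>k x y. k \<in> {1..N} \<Longrightarrow> x \<in> space PM \<Longrightarrow> y \<in> space PM \<Longrightarrow> differ_only k x y \<Longrightarrow>
      \<bar>f x - f y\<bar> \<le> c k"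
    and W: "\<And>x. x \<in> space PM \<Longrightarrow> (\<Sum>k\<in>Q x. (c k)\<^sup>2) \<le> W"
  shows "measure PM {x\<in>space PM. (\<integral>x. f x \<partial>PM) + t \<le> f x \<and> x \<in> E} \<le> exp_neg_ratio (2 * t\<^sup>2) W"
proof (rule hoeffding_tail[OF f E Q t])
  show "\<bar>avg (Suc k) f (x(Suc k := y)) - avg (Suc k) f (x(Suc k := y'))\<bar> \<le> max 0 (c (Suc k))"
    if "k < N" "x \<in> E" "y \<in> space (M (Suc k))" "y' \<in> space (M (Suc k))" for k x y y'
  proof -
    have "x \<in> space PM" using that(2) sets.sets_into_space[OF E] by auto
    from range_lipschitz[where c = c, OF f lip that(1) this that(3,4)] show ?thesis by simp
  qed
  have "(max 0 (c k))\<^sup>2 \<le> (c k)\<^sup>2" for k by (cases "0 \<le> c k") (auto simp: max_def)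
  then show "(\<Sum>k\<in>Q x. (max 0 (c k))\<^sup>2) \<le> W" if "x \<in> space PM" for x
    by (rule order_trans[OF sum_mono W[OF that]])
qed

lemma bounded_steps_lipschitz:
  assumes f: "bm f"
    and lip: "\<And>k x y. k \<in> {1..N} \<Longrightarrow> x \<in> space PM \<Longrightarrow> y \<in> space PM \<Longrightarrow> differ_only k x y \<Longrightarrow>
      \<bar>f x - f y\<bar> \<le> c k"
  shows "bounded_steps (space PM) c (\<lambda>_. 0) f"
  by (rule bounded_steps_range[OF f order_refl range_lipschitz[OF f lip]]) auto

text \<open>Without an error term nothing is divided by \<open>1 - p k\<close>, so values of
  \<open>p k\<close> from 1 upwards, which \<open>tail_atom\<close> excludes, are covered as
  well.\<close>

lemma tail_atom_lipschitz:
  assumes f: "bm f" and Q: "valid_queries Q f" and t: "0 \<le> t"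
    and lip: "\<And>k x y. k \<in> {1..N} \<Longrightarrow> x \<in> space PM \<Longrightarrow> y \<in> space PM \<Longrightarrow> differ_only k x y \<Longrightarrow>
      \<bar>f x - f y\<bar> \<le> c k"
    and C: "\<And>x k. x \<in> space PM \<Longrightarrow> k \<in> Q x \<Longrightarrow> c k \<le> C"
    and p: "\<And>k. k \<in> {1..N} \<Longrightarrow> 0 \<le> p k \<and> (\<exists>\<eta>. atom_mass (M k) \<eta> (1 - p k))"
    and V: "\<And>x. x \<in> space PM \<Longrightarrow> (\<Sum>k\<in>Q x. p k * (c k)\<^sup>2) \<le> V"
  shows "measure PM {x\<in>space PM. (\<integral>x. f x \<partial>PM) + t \<le> f x \<and> x \<in> space PM}
      \<le> exp_neg_ratio (t\<^sup>2) (2 * V + 2 * C * t / 3)"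
proof (rule tail_variance(1)[OF f sets.top Q t bounded_steps_lipschitz[OF f lip] _ _ V])
  show "0 \<le> V" by (rule sum_queries_nonneg[OF V Q]) (use p in auto)
  show "c k + 0 \<le> C" if "x \<in> space PM" "k \<in> Q x" for x k using C[OF that] by simp
  fix k x assume k: "k < N" and x: "x \<in> space PM"
  have sk: "Suc k \<in> {1..N}" using k by simp
  interpret Mk: prob_space "M (Suc k)" by (rule prob_space_factor[OF sk])
  define h where "h y = avg (Suc k) f (x(Suc k := y))" for y
  obtain \<eta> where \<eta>: "atom_mass (M (Suc k)) \<eta> (1 - p (Suc k))" using p[OF sk] by auto
  have bd: "\<bar>h y - h \<eta>\<bar> \<le> \<bar>c (Suc k)\<bar>" if "y \<in> space (M (Suc k))" for y
    using range_lipschitz[where c = c, OF f lip k x that atom_mass_space[OF \<eta>]]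
    unfolding h_def by linarith
  have "(\<integral>y. (h y - Mk.expectation h)\<^sup>2 \<partial>M (Suc k)) \<le> (1 - (1 - p (Suc k))) * \<bar>c (Suc k)\<bar>\<^sup>2"
    using bm_coord(1)[OF bm_avg[OF f] x sk]
    by (intro Mk.variance_le_atom[where h = h, OF _ \<eta> bd]) (simp_all add: h_def[abs_def])
  then show "(\<integral>y. (avg (Suc k) f (x(Suc k := y)) - avg k f x)\<^sup>2 \<partial>M (Suc k))
      \<le> p (Suc k) * (c (Suc k))\<^sup>2"
    unfolding avg_step[OF f x k] h_def by simp
qed

text \<open>Completing \<open>x\<close> and \<open>y\<close> by the same tail compares their
  conditional failure probabilities. Phrasing the hypothesis for completed points serves increasing
  and decreasing \<Gamma> alike.\<close>

lemma not_exceptional_mono: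
  assumes \<Gamma>: "\<Gamma> \<in> sets PM" and x: "x \<in> space PM" and y: "y \<in> space PM"
    and mono: "\<And>k z. z \<in> space PM \<Longrightarrow> mix k x z \<in> \<Gamma> \<Longrightarrow> mix k y z \<in> \<Gamma>" "x \<in> \<Gamma> \<Longrightarrow> y \<in> \<Gamma>"
    and "x \<notin> exceptional \<Gamma> \<gamma>"
  shows "y \<notin> exceptional \<Gamma> \<gamma>"
proof -
  have ind: "bm (indicator (space PM - \<Gamma>) :: _ \<Rightarrow> real)" using \<Gamma> by (intro bm_indicator) auto
  have "fail \<Gamma> k y \<le> fail \<Gamma> k x" for k
    unfolding fail_def avg_def
  proof (rule integral_mono)
    fix z assume z: "z \<in> space PM"
    show "indicator (space PM - \<Gamma>) (mix k y z) \<le> (indicator (space PM - \<Gamma>) (mix k x z) :: real)"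
      using mono(1)[OF z, of k] mix_space[OF x z] mix_space[OF y z] by (auto simp: indicator_def)
  qed (intro bm_avg_integrable ind x y)+
  then show ?thesis using assms(6) x mono(2) unfolding exceptional_def
    by (auto intro: order_trans simp: not_less)
qed

end

lemma exceptional_harris:
  fixes M :: "nat \<Rightarrow> 'a::zero_neq_one measure" and \<gamma> :: "nat \<Rightarrow> real" and s :: real
  assumes "fin_prod N M" and bin: "binary_spaces N M"
    and f: "f \<in> borel_measurable (PiM {1..N} M)" and \<Gamma>: "\<Gamma> \<in> sets (PiM {1..N} M)"
    and mono: "cube_increasing N f \<and> cube_increasing N (indicator \<Gamma>) \<or>
      cube_decreasing N f \<and> cube_decreasing N (indicator \<Gamma>)"
  defines "E \<equiv> space (PiM {1..N} M) - fin_prod.exceptional N M \<Gamma> \<gamma>"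
  shows "measure (PiM {1..N} M) {x\<in>space (PiM {1..N} M). s \<le> f x} * measure (PiM {1..N} M) E
    \<le> measure (PiM {1..N} M) {x\<in>space (PiM {1..N} M). s \<le> f x \<and> x \<in> E}"
proof -
  interpret fin_prod N M by fact
  have "space (M k) = {0, 1}" if "k \<in> {1..N}" for k
    using bin that unfolding binary_spaces_def by auto
  then have space: "{1..N} \<rightarrow>\<^sub>E {0, 1} = space PM"
    unfolding space_PM by (intro PiE_cong) auto
  define A where "A = {x\<in>space PM. s \<le> f x}"
  have A: "A \<in> sets PM" using f unfolding A_def by measurable
  have E: "E \<in> sets PM" unfolding E_def using sets_exceptional[OF \<Gamma>] by auto
  let ?F = "indicator A :: _ \<Rightarrow> real" and ?G = "indicator E :: _ \<Rightarrow> real"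
  have eq: "(\<integral>x. ?F x * ?G x \<partial>PM) = measure PM {x\<in>space PM. s \<le> f x \<and> x \<in> E}"
  proof -
    have "(\<integral>x. ?F x * ?G x \<partial>PM) = (\<integral>x. indicator (A \<inter> E) x \<partial>PM)"
      by (simp add: indicator_inter_arith)
    also have "\<dots> = measure PM (A \<inter> E)" using A E sets.sets_into_space by (simp add: Int_absorb2 le_infI1)
    also have "A \<inter> E = {x\<in>space PM. s \<le> f x \<and> x \<in> E}" by (auto simp: A_def)
    finally show ?thesis .
  qed
  have int: "(\<integral>x. ?F x \<partial>PM) = measure PM A" "(\<integral>x. ?G x \<partial>PM) = measure PM E"
    using A E by (simp_all add: Int_absorb2 sets.sets_into_space)
  from mono have "(\<integral>x. ?F x \<partial>PM) * (\<integral>x. ?G x \<partial>PM) \<le> (\<integral>x. ?F x * ?G x \<partial>PM)"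
  proof
    assume inc: "cube_increasing N f \<and> cube_increasing N (indicator \<Gamma>)"
    have up: "y \<in> \<Gamma>" if "x \<in> space PM" "y \<in> space PM" "cube_le N x y" "x \<in> \<Gamma>" for x y
    proof -
      have "indicator \<Gamma> x \<le> (indicator \<Gamma> y :: real)"
        using inc that unfolding cube_increasing_def space by blast
      then show ?thesis using that(4) by (cases "y \<in> \<Gamma>") simp_all
    qed
    have "cube_increasing N ?F"
      unfolding cube_increasing_def space
    proof (intro ballI impI)
      fix x y assume "x \<in> space PM" "y \<in> space PM" "cube_le N x y"
      then have "f x \<le> f y" "y \<in> space PM" using inc unfolding cube_increasing_def space by blast+
      then show "?F x \<le> ?F y" by (auto simp: indicator_def A_def)
    qed
    moreover have "cube_increasing N ?G"
      unfolding cube_increasing_def space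
    proof (intro ballI impI)
      fix x y assume xy: "x \<in> space PM" "y \<in> space PM" "cube_le N x y"
      have "x \<in> E \<Longrightarrow> y \<in> E"
        using not_exceptional_mono[OF \<Gamma> xy(1,2), of \<gamma>] up[OF xy]
          up[OF mix_space[OF xy(1)] mix_space[OF xy(2)] cube_le_mix[OF xy(3)]] xy(2)
        unfolding E_def by blast
      then show "?G x \<le> ?G y" by (auto simp: indicator_def)
    qed
    ultimately show ?thesis
      by (intro harris_inequality[OF assms(1) bin] bm_indicator A E)
  next
    assume dec: "cube_decreasing N f \<and> cube_decreasing N (indicator \<Gamma>)"
    have down: "x \<in> \<Gamma>" if "x \<in> space PM" "y \<in> space PM" "cube_le N x y" "y \<in> \<Gamma>" for x y
    proof -
      have "indicator \<Gamma> y \<le> (indicator \<Gamma> x :: real)"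
        using dec that unfolding cube_decreasing_def space by blast
      then show ?thesis using that(4) by (cases "x \<in> \<Gamma>") simp_all
    qed
    \<comment> \<open>In the decreasing case both indicators are negated; the signs cancel in the
      products.\<close>
    have "cube_increasing N (\<lambda>x. 0 - ?F x)"
      unfolding cube_increasing_def space
    proof (intro ballI impI)
      fix x y assume "x \<in> space PM" "y \<in> space PM" "cube_le N x y"
      then have "f y \<le> f x" "x \<in> space PM" using dec unfolding cube_decreasing_def space by blast+
      then show "0 - ?F x \<le> 0 - ?F y" by (auto simp: indicator_def A_def)
    qed
    moreover have "cube_increasing N (\<lambda>x. 0 - ?G x)"
      unfolding cube_increasing_def space
    proof (intro ballI impI)
      fix x y assume xy: "x \<in> space PM" "y \<in> space PM" "cube_le N x y"
      have "y \<in> E \<Longrightarrow> x \<in> E"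
        using not_exceptional_mono[OF \<Gamma> xy(2,1), of \<gamma>] down[OF xy]
          down[OF mix_space[OF xy(1)] mix_space[OF xy(2)] cube_le_mix[OF xy(3)]] xy(1)
        unfolding E_def by blast
      then show "0 - ?G x \<le> 0 - ?G y" by (auto simp: indicator_def)
    qed
    ultimately have "(\<integral>x. 0 - ?F x \<partial>PM) * (\<integral>x. 0 - ?G x \<partial>PM) \<le> (\<integral>x. (0 - ?F x) * (0 - ?G x) \<partial>PM)"
      by (intro harris_inequality[OF assms(1) bin] bm_minus bm_const bm_indicator A E)
    then show ?thesis by simp
  qed
  then show ?thesis unfolding eq int unfolding A_def .
qed

context fin_prod_cond
begin

text \<open>\<open>E\<close> lies in the box, where the original measure is the conditioned one
  times a factor of at most 1; \<Delta> absorbs the shift of the mean.\<close>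

lemma tail_cond:
  fixes f :: "(nat \<Rightarrow> 'a) \<Rightarrow> real"
  assumes f: "f \<in> borel_measurable PM" and E: "E \<in> sets PM" "E \<subseteq> space R.PM"
    and m: "(\<integral>x. f x \<partial>R.PM) \<le> \<mu> + \<Delta>"
    and b: "measure R.PM {x\<in>space R.PM. (\<integral>x. f x \<partial>R.PM) + t \<le> f x \<and> x \<in> E} \<le> b"
  shows "measure PM {x\<in>space PM. \<mu> + t + \<Delta> \<le> f x \<and> x \<in> E} \<le> b"
proof -
  let ?m = "\<integral>x. f x \<partial>R.PM"
  let ?A = "{x\<in>space PM. ?m + t \<le> f x \<and> x \<in> E}"
  note [measurable] = f E(1)
  have A: "?A \<in> sets PM" by measurable
  have "?m + t \<le> v" if "\<mu> + t + \<Delta> \<le> v" for v using m that by linarith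
  then have "measure PM {x\<in>space PM. \<mu> + t + \<Delta> \<le> f x \<and> x \<in> E} \<le> measure PM ?A"
    using A by (intro PM.finite_measure_mono) auto
  also have "\<dots> = measure PM (space R.PM) * measure R.PM ?A"
    using E(2) by (intro measure_cond A) auto
  also have "\<dots> \<le> 1 * measure R.PM ?A" by (intro mult_right_mono PM.prob_le_1) auto
  also have "?A = {x\<in>space R.PM. ?m + t \<le> f x \<and> x \<in> E}" using E(2) space_R_sub by auto
  finally show ?thesis using b by simp
qed

end

section \<open>Independent families\<close>

locale indep_family = prob_space P for P :: "'w measure" +
  fixes N :: nat and L :: "nat \<Rightarrow> 'a measure" and X :: "nat \<Rightarrow> 'w \<Rightarrow> 'a"
  assumes N_pos: "1 \<le> N" and indep: "indep_vars L X {1..N}"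
begin

abbreviation law :: "nat \<Rightarrow> 'a measure" where
  "law k \<equiv> distr P (L k) (X k)"

lemma rv: "k \<in> {1..N} \<Longrightarrow> X k \<in> P \<rightarrow>\<^sub>M L k"
  using indep unfolding indep_vars_def by auto

sublocale fin_prod N law
  by (rule fin_prod.intro) (intro prob_space_distr rv)

lemma sets_PM: "sets PM = sets (PiM {1..N} L)"
  by (intro sets_PiM_cong) auto

lemma space_PM_eq: "space PM = outcomes N L"
  unfolding space_PM by simp

lemma measurable_tuple: "tuple N X \<in> P \<rightarrow>\<^sub>M PiM {1..N} L"
  unfolding tuple_def[abs_def] by (intro measurable_restrict rv)

text \<open>Beyond the measurability of the \<open>X k\<close>, this is where independence enters:
  from here on everything takes place on the product of the laws.\<close>

lemma distr_tuple: "distr P (PiM {1..N} L) (tuple N X) = PM"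
  using indep_vars_iff_distr_eq_PiM'[of "{1..N}" X L] indep rv N_pos
  unfolding tuple_def[abs_def] by auto

lemma tuple_space: "\<omega> \<in> space P \<Longrightarrow> tuple N X \<omega> \<in> space PM"
  using measurable_space[OF measurable_tuple] unfolding space_PM_eq by (auto simp: space_PiM)

lemma prob_tuple:
  assumes "{x\<in>space PM. \<phi> x} \<in> sets PM"
  shows "\<P>(\<omega> in P. \<phi> (tuple N X \<omega>)) = measure PM {x\<in>space PM. \<phi> x}"
proof -
  have "measure PM {x\<in>space PM. \<phi> x} = measure (distr P (PiM {1..N} L) (tuple N X)) {x\<in>space PM. \<phi> x}"
    by (simp only: distr_tuple)
  also have "\<dots> = prob (tuple N X -` {x\<in>space PM. \<phi> x} \<inter> space P)"
    using assms unfolding sets_PM by (intro measure_distr measurable_tuple)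
  also have "tuple N X -` {x\<in>space PM. \<phi> x} \<inter> space P = {\<omega>\<in>space P. \<phi> (tuple N X \<omega>)}"
    using tuple_space by auto
  finally show ?thesis by simp
qed

lemma expectation_tuple:
  fixes f :: "(nat \<Rightarrow> 'a) \<Rightarrow> real"
  assumes "f \<in> borel_measurable (PiM {1..N} L)"
  shows "expectation (\<lambda>\<omega>. f (tuple N X \<omega>)) = (\<integral>x. f x \<partial>PM)"
  unfolding distr_tuple[symmetric] by (rule integral_distr[OF measurable_tuple assms, symmetric])

lemma borel_PM:
  fixes f :: "(nat \<Rightarrow> 'a) \<Rightarrow> real"
  shows "f \<in> borel_measurable (PiM {1..N} L) \<Longrightarrow> f \<in> borel_measurable PM"
  using measurable_cong_sets[OF sets_PM refl] by blast

lemma atom_mass_law: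
  assumes k: "k \<in> {1..N}" and \<eta>: "\<eta> \<in> space (L k)" and m: "m \<le> \<P>(\<omega> in P. X k \<omega> = \<eta>)"
  shows "atom_mass (law k) \<eta> m"
  unfolding atom_mass_def
proof (intro conjI ballI allI impI)
  show "\<eta> \<in> space (law k)" using \<eta> by simp
  fix u :: "'a \<Rightarrow> real" and B
  assume u: "u \<in> borel_measurable (law k)" and B: "\<forall>y\<in>space (law k). 0 \<le> u y \<and> u y \<le> B"
  let ?A = "{\<omega>\<in>space P. X k \<omega> = \<eta>}"
  have uL: "u \<in> borel_measurable (L k)" using u by simp
  have Xs: "X k \<omega> \<in> space (L k)" if "\<omega> \<in> space P" for \<omega> using measurable_space[OF rv[OF k] that] .
  have eq: "(\<integral>y. u y \<partial>law k) = (\<integral>\<omega>. u (X k \<omega>) \<partial>P)"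
    by (rule integral_distr[OF rv[OF k] uL])
  have "prob ?A * u \<eta> \<le> (\<integral>\<omega>. u (X k \<omega>) \<partial>P)"
  \<comment> \<open>The set where \<open>X k\<close> equals \<eta> need not be an event; if it is
    not, its probability is 0 by convention and the inequality says that an integral of a
    nonnegative function is nonnegative.\<close>
  proof (cases "?A \<in> events")
    case True
    have "prob ?A * u \<eta> = (\<integral>\<omega>. indicator ?A \<omega> * u \<eta> \<partial>P)" using True by simp
    also have "\<dots> \<le> (\<integral>\<omega>. u (X k \<omega>) \<partial>P)"
    proof (rule integral_mono)
      show "integrable P (\<lambda>\<omega>. indicator ?A \<omega> * u \<eta>)"
        using True by (auto intro!: integrable_mult_left integrable_real_indicator simp: emeasure_eq_measure)
      show "integrable P (\<lambda>\<omega>. u (X k \<omega>))"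
        using measurable_compose[OF rv[OF k] uL] B Xs
        by (intro integrable_const_bound[where B = B]) auto
      fix \<omega> assume "\<omega> \<in> space P"
      then show "indicator ?A \<omega> * u \<eta> \<le> u (X k \<omega>)"
        using B Xs by (cases "X k \<omega> = \<eta>") auto
    qed
    finally show ?thesis .
  next
    case False
    then have "prob ?A = 0" by (rule measure_notin_sets)
    then show ?thesis using B Xs by (auto intro!: Bochner_Integration.integral_nonneg)
  qed
  moreover have "m * u \<eta> \<le> prob ?A * u \<eta>"
    using m B \<eta> by (intro mult_right_mono) auto
  ultimately show "m * u \<eta> \<le> (\<integral>y. u y \<partial>law k)" unfolding eq by simp
qed

lemma binary_law:
  assumes "space (L k) = {u, v}" "sets (L k) = Pow {u, v}" "k \<in> {1..N}"
  shows "measure (law k) {v} = \<P>(\<omega> in P. X k \<omega> = v)"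
proof -
  have "measure (law k) {v} = prob (X k -` {v} \<inter> space P)"
    using assms by (intro measure_distr rv) auto
  also have "X k -` {v} \<inter> space P = {\<omega>\<in>space P. X k \<omega> = v}" by auto
  finally show ?thesis .
qed

lemma exceptional_event_exceptional:
  assumes \<Gamma>: "\<Gamma> \<in> sets (PiM {1..N} L)" and \<gamma>: "\<And>k. k \<in> {1..N} \<Longrightarrow> 0 < \<gamma> k \<and> \<gamma> k \<le> 1"
  shows "exceptional_event P N L X \<Gamma> \<gamma> (exceptional \<Gamma> \<gamma>)"
proof -
  have \<Gamma>': "\<Gamma> \<in> sets PM" using \<Gamma> sets_PM by simp
  have e: "exceptional \<Gamma> \<gamma> \<in> sets PM" by (rule sets_exceptional[OF \<Gamma>'])
  have e_eq: "{x\<in>space PM. x \<in> exceptional \<Gamma> \<gamma>} = exceptional \<Gamma> \<gamma>" by (auto simp: exceptional_def)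
  have \<Gamma>_eq: "{x\<in>space PM. x \<notin> \<Gamma>} = space PM - \<Gamma>" by auto
  have "\<P>(\<omega> in P. tuple N X \<omega> \<in> exceptional \<Gamma> \<gamma>) = measure PM (exceptional \<Gamma> \<gamma>)"
    using prob_tuple[of "\<lambda>x. x \<in> exceptional \<Gamma> \<gamma>"] e unfolding e_eq by simp
  moreover have "\<P>(\<omega> in P. tuple N X \<omega> \<notin> \<Gamma>) = measure PM (space PM - \<Gamma>)"
    using prob_tuple[of "\<lambda>x. x \<notin> \<Gamma>"] \<Gamma>' unfolding \<Gamma>_eq by auto
  ultimately show ?thesis
    using measure_exceptional[OF \<Gamma>' N_pos \<gamma>] e unfolding exceptional_event_def sets_PM[symmetric] space_PM_eq[symmetric]
    by (auto simp: exceptional_def)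
qed

text \<open>The sum of the inverses is at least 1 already because of
  \<open>\<gamma> 1 \<le> 1\<close>.\<close>

lemma exceptional_event_compl:
  assumes \<Gamma>: "\<Gamma> \<in> sets (PiM {1..N} L)" and \<gamma>: "\<And>k. k \<in> {1..N} \<Longrightarrow> 0 < \<gamma> k \<and> \<gamma> k \<le> 1"
  shows "exceptional_event P N L X \<Gamma> \<gamma> (outcomes N L - \<Gamma>)"
proof -
  have "{\<omega>\<in>space P. tuple N X \<omega> \<in> outcomes N L - \<Gamma>} = {\<omega>\<in>space P. tuple N X \<omega> \<notin> \<Gamma>}"
    using tuple_space unfolding space_PM_eq by auto
  then have eq: "\<P>(\<omega> in P. tuple N X \<omega> \<in> outcomes N L - \<Gamma>) = \<P>(\<omega> in P. tuple N X \<omega> \<notin> \<Gamma>)"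
    by simp
  have "1 \<le> inverse (\<gamma> 1)" using \<gamma>[of 1] N_pos by (simp add: one_le_inverse_iff)
  also have "\<dots> \<le> (\<Sum>k\<in>{1..N}. inverse (\<gamma> k))"
    using N_pos \<gamma> by (intro member_le_sum) (auto simp: less_imp_le)
  finally have "1 * \<P>(\<omega> in P. tuple N X \<omega> \<notin> \<Gamma>)
      \<le> (\<Sum>k\<in>{1..N}. inverse (\<gamma> k)) * \<P>(\<omega> in P. tuple N X \<omega> \<notin> \<Gamma>)"
    by (intro mult_right_mono) auto
  moreover have "outcomes N L - \<Gamma> \<in> sets (PiM {1..N} L)"
    using sets.compl_sets[OF \<Gamma>] by (simp add: space_PiM)
  ultimately show ?thesis unfolding exceptional_event_def eq by auto
qed

lemma prob_tail:
  fixes f :: "(nat \<Rightarrow> 'a) \<Rightarrow> real"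
  assumes f: "f \<in> borel_measurable (PiM {1..N} L)" and B: "B \<in> sets (PiM {1..N} L)"
  shows "\<P>(\<omega> in P. s \<le> f (tuple N X \<omega>) \<and> tuple N X \<omega> \<notin> B)
    = measure PM {x\<in>space PM. s \<le> f x \<and> x \<in> space PM - B}"
proof -
  note [measurable] = borel_PM[OF f]
  have [measurable]: "B \<in> sets PM" using B sets_PM by simp
  have "{x\<in>space PM. s \<le> f x \<and> x \<notin> B} \<in> sets PM" by measurable
  from prob_tuple[OF this]
  have "\<P>(\<omega> in P. s \<le> f (tuple N X \<omega>) \<and> tuple N X \<omega> \<notin> B) = measure PM {x\<in>space PM. s \<le> f x \<and> x \<notin> B}" .
  also have "{x\<in>space PM. s \<le> f x \<and> x \<notin> B} = {x\<in>space PM. s \<le> f x \<and> x \<in> space PM - B}" by auto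
  finally show ?thesis .
qed

lemma prob_tail':
  fixes f :: "(nat \<Rightarrow> 'a) \<Rightarrow> real"
  assumes f: "f \<in> borel_measurable (PiM {1..N} L)"
  shows "\<P>(\<omega> in P. s \<le> f (tuple N X \<omega>)) = measure PM {x\<in>space PM. s \<le> f x \<and> x \<in> space PM}"
  using prob_tail[OF f sets.empty_sets] by simp

text \<open>Ensures that conditioning on \<open>G k\<close> makes sense unless \<Gamma> is a null
  set.\<close>

lemma law_pos:
  assumes k: "k \<in> {1..N}" and G: "G k \<in> sets (L k)"
    and \<Gamma>: "\<Gamma> \<in> sets PM" "\<Gamma> \<subseteq> (\<Pi>\<^sub>E k\<in>{1..N}. G k)" "measure PM \<Gamma> \<noteq> 0"
  shows "0 < measure (law k) (G k)"
proof -
  have eq: "{x\<in>space PM. x \<in> \<Gamma>} = \<Gamma>" using sets.sets_into_space[OF \<Gamma>(1)] by auto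
  have "0 < measure PM \<Gamma>" using \<Gamma>(3) by (simp add: zero_less_measure_iff)
  also have "\<dots> = \<P>(\<omega> in P. tuple N X \<omega> \<in> \<Gamma>)" using prob_tuple[of "\<lambda>x. x \<in> \<Gamma>"] \<Gamma>(1) unfolding eq by simp
  also have "\<dots> \<le> prob (X k -` G k \<inter> space P)"
  proof (rule finite_measure_mono)
    show "{\<omega>\<in>space P. tuple N X \<omega> \<in> \<Gamma>} \<subseteq> X k -` G k \<inter> space P"
    proof
      fix \<omega> assume "\<omega> \<in> {\<omega>\<in>space P. tuple N X \<omega> \<in> \<Gamma>}"
      then have "tuple N X \<omega> \<in> (\<Pi>\<^sub>E k\<in>{1..N}. G k)" "\<omega> \<in> space P" using \<Gamma>(2) by blast+
      from PiE_mem[OF this(1) k] this(2) show "\<omega> \<in> X k -` G k \<inter> space P" using k by (simp add: tuple_def)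
    qed
    show "X k -` G k \<inter> space P \<in> events" by (rule measurable_sets[OF rv[OF k] G])
  qed
  also have "\<dots> = measure (law k) (G k)" by (rule measure_distr[OF rv[OF k] G, symmetric])
  finally show ?thesis .
qed

end

section \<open>The bounds for an independent family\<close>

context indep_family
begin

context
  fixes f :: "(nat \<Rightarrow> 'a) \<Rightarrow> real" and q :: "nat \<Rightarrow> (nat \<Rightarrow> 'a) \<Rightarrow> nat"
  assumes f: "f \<in> borel_measurable (PiM {1..N} L)"
    and q: "query_strategy N (outcomes N L) f q"
    and incr: "increasing_queries N (outcomes N L) q"
begin

lemma valid_strategy: "valid_queries (\<lambda>x. (\<lambda>i. q i x) ` {1..N}) f"
  by (rule valid_queries_strategy[OF q incr N_pos refl]) (simp add: space_PM_eq)

lemma sum_queries_le_Max: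
  fixes h :: "nat \<Rightarrow> real"
  assumes "x \<in> space PM"
  shows "(\<Sum>k\<in>(\<lambda>i. q i x) ` {1..N}. h k) \<le> (MAX Q\<in>query_sets N (outcomes N L) q. \<Sum>k\<in>Q. h k)"
  using assms query_sets_Max_ge[OF q, of x "\<lambda>Q. \<Sum>k\<in>Q. h k"] by (simp add: space_PM_eq)

lemma queried_le_Max:
  fixes h :: "nat \<Rightarrow> real"
  assumes "x \<in> space PM" "k \<in> (\<lambda>i. q i x) ` {1..N}"
  shows "h k \<le> (MAX Q\<in>query_sets N (outcomes N L) q. MAX k\<in>Q. h k)"
  using assms query_sets_Max_Max_ge[OF q, of x k h] by (simp add: space_PM_eq)

context
  fixes c :: "nat \<Rightarrow> real" and t :: real
  assumes lip: "\<And>k x y. k \<in> {1..N} \<Longrightarrow> x \<in> outcomes N L \<Longrightarrow> y \<in> outcomes N L \<Longrightarrow>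
      differ_only k x y \<Longrightarrow> \<bar>f x - f y\<bar> \<le> c k"
    and t: "0 \<le> t"
begin

lemma bm_f: "bm f"
  by (rule bm_lipschitz[OF borel_PM[OF f], of c]) (rule lip, auto simp: space_PM_eq)

lemma typical_hoeffding:
  "\<P>(\<omega> in P. f (tuple N X \<omega>) \<ge> expectation (\<lambda>\<omega>. f (tuple N X \<omega>)) + t)
    \<le> exp_neg_ratio (2 * t\<^sup>2) (MAX Q\<in>query_sets N (outcomes N L) q. \<Sum>k\<in>Q. (c k)\<^sup>2)"
  unfolding prob_tail'[OF f] expectation_tuple[OF f]
  by (rule tail_lipschitz[OF bm_f sets.top valid_strategy t lip sum_queries_le_Max])
    (auto simp: space_PM_eq)

lemma typical_binary:
  assumes uv: "u \<noteq> v" and bin: "\<And>k. k \<in> {1..N} \<Longrightarrow> space (L k) = {u, v} \<and> sets (L k) = Pow {u, v}"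
    and p: "\<And>k. k \<in> {1..N} \<Longrightarrow> p k = \<P>(\<omega> in P. X k \<omega> = v)"
  defines "C \<equiv> MAX Q\<in>query_sets N (outcomes N L) q. MAX k\<in>Q. c k"
    and "V \<equiv> MAX Q\<in>query_sets N (outcomes N L) q. \<Sum>k\<in>Q. (1 - p k) * p k * (c k)\<^sup>2"
  shows "\<P>(\<omega> in P. f (tuple N X \<omega>) \<ge> expectation (\<lambda>\<omega>. f (tuple N X \<omega>)) + t)
      \<le> exp_neg_ratio (t\<^sup>2) (2 * V + 2 * C * t / 3)"
    and "V > 0 \<and> C > 0 \<longrightarrow> \<P>(\<omega> in P. f (tuple N X \<omega>) \<ge> expectation (\<lambda>\<omega>. f (tuple N X \<omega>)) + t)
      \<le> exp (- (V / C\<^sup>2) * phi (C * t / V))"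
proof -
  have steps: "bounded_steps (space PM) c (\<lambda>_. 0) f"
    by (rule bounded_steps_lipschitz[OF bm_f]) (rule lip, auto simp: space_PM_eq)
  have bin': "space (law k) = {u, v} \<and> sets (law k) = Pow {u, v}" if "k \<in> {1..N}" for k
    using bin[OF that] by simp
  have p': "p k = measure (law k) {v}" if "k \<in> {1..N}" for k
    using binary_law[OF _ _ that] bin[OF that] p[OF that] by auto
  have C: "c k + 0 \<le> C" if "x \<in> space PM" "k \<in> (\<lambda>i. q i x) ` {1..N}" for x k
    unfolding C_def using queried_le_Max[OF that] by simp
  have V: "(\<Sum>k\<in>(\<lambda>i. q i x) ` {1..N}. (1 - p k) * p k * (c k + 0)\<^sup>2) \<le> V" if "x \<in> space PM" for x
    unfolding V_def using sum_queries_le_Max[OF that] by simp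
  note tail = tail_binary[OF bm_f sets.top valid_strategy t steps C uv bin' p' V]
  show "\<P>(\<omega> in P. f (tuple N X \<omega>) \<ge> expectation (\<lambda>\<omega>. f (tuple N X \<omega>)) + t)
      \<le> exp_neg_ratio (t\<^sup>2) (2 * V + 2 * C * t / 3)"
    unfolding prob_tail'[OF f] expectation_tuple[OF f] by (rule tail(1))
  show "V > 0 \<and> C > 0 \<longrightarrow> \<P>(\<omega> in P. f (tuple N X \<omega>) \<ge> expectation (\<lambda>\<omega>. f (tuple N X \<omega>)) + t)
      \<le> exp (- (V / C\<^sup>2) * phi (C * t / V))"
    unfolding prob_tail'[OF f] expectation_tuple[OF f] by (intro impI, elim conjE, rule tail(2))
qed

lemma typical_atom:
  assumes p: "\<And>k. k \<in> {1..N} \<Longrightarrow> \<exists>\<eta>\<in>space (L k). \<P>(\<omega> in P. X k \<omega> = \<eta>) \<ge> 1 - p k"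
  shows "\<P>(\<omega> in P. f (tuple N X \<omega>) \<ge> expectation (\<lambda>\<omega>. f (tuple N X \<omega>)) + t)
    \<le> exp_neg_ratio (t\<^sup>2) (2 * (MAX Q\<in>query_sets N (outcomes N L) q. \<Sum>k\<in>Q. p k * (c k)\<^sup>2)
      + 2 * (MAX Q\<in>query_sets N (outcomes N L) q. MAX k\<in>Q. c k) * t / 3)"
  unfolding prob_tail'[OF f] expectation_tuple[OF f]
proof (rule tail_atom_lipschitz[OF bm_f valid_strategy t lip queried_le_Max _ sum_queries_le_Max])
  fix k assume k: "k \<in> {1..N}"
  then obtain \<eta> where \<eta>: "\<eta> \<in> space (L k)" "1 - p k \<le> \<P>(\<omega> in P. X k \<omega> = \<eta>)" using p by auto
  then have "0 \<le> p k" using prob_le_1[of "{\<omega>\<in>space P. X k \<omega> = \<eta>}"] by linarith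
  then show "0 \<le> p k \<and> (\<exists>\<eta>. atom_mass (law k) \<eta> (1 - p k))"
    using atom_mass_law[OF k \<eta>] by blast
qed (auto simp: space_PM_eq)

end

context
  fixes \<Gamma> :: "(nat \<Rightarrow> 'a) set" and \<gamma> :: "nat \<Rightarrow> real"
  assumes \<Gamma>: "\<Gamma> \<in> sets (PiM {1..N} L)" and \<gamma>: "\<And>k. k \<in> {1..N} \<Longrightarrow> 0 < \<gamma> k \<and> \<gamma> k \<le> 1"
begin

lemma \<Gamma>_PM: "\<Gamma> \<in> sets PM"
  using \<Gamma> sets_PM by simp

lemma exceptional_sets_L: "exceptional \<Gamma> \<gamma> \<in> sets (PiM {1..N} L)"
  using sets_exceptional[OF \<Gamma>_PM] sets_PM by simp

lemma good_sets: "space PM - exceptional \<Gamma> \<gamma> \<in> sets PM"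
  using sets_exceptional[OF \<Gamma>_PM] by auto

lemma good_subset: "space PM - exceptional \<Gamma> \<gamma> \<subseteq> \<Gamma>"
  by (auto simp: exceptional_def)

lemma good_fail:
  "k < N \<Longrightarrow> x \<in> space PM - exceptional \<Gamma> \<gamma> \<Longrightarrow> fail \<Gamma> k x \<le> \<gamma> (Suc k)"
  unfolding exceptional_def by (auto simp: not_less) (meson not_less)

context
  fixes c d e :: "nat \<Rightarrow> real"
  assumes cd: "\<And>k. k \<in> {1..N} \<Longrightarrow> c k \<le> d k"
    and lip: "one_sided_lipschitz N (outcomes N L) \<Gamma> c d f \<and> (\<forall>k\<in>{1..N}. e k = \<gamma> k * (d k - c k)) \<or>
      two_sided_lipschitz N (outcomes N L) \<Gamma> c d f \<and>
      (\<exists>r :: nat \<Rightarrow> real.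
        (\<forall>k\<in>{1..N}. r k > 0 \<and> (\<forall>\<eta>\<in>space (L k). \<P>(\<omega> in P. X k \<omega> = \<eta>) \<ge> r k)) \<and>
        (\<forall>k\<in>{1..N}. e k = 2 * \<gamma> k * (d k - c k) * inverse (r k)))"
begin

lemma bm_f_typical: "bm f"
proof (rule bm_lipschitz[OF borel_PM[OF f], of d])
  fix k x y assume k: "k \<in> {1..N}" and "x \<in> space PM" "y \<in> space PM" "differ_only k x y"
  then have "\<bar>f x - f y\<bar> \<le> (if x \<in> \<Gamma> then c k else d k)
      \<or> \<bar>f x - f y\<bar> \<le> (if x \<in> \<Gamma> \<and> y \<in> \<Gamma> then c k else d k)"
    using lip unfolding space_PM_eq one_sided_lipschitz_def two_sided_lipschitz_def by blast
  then show "\<bar>f x - f y\<bar> \<le> d k" using cd[OF k] by (auto split: if_splits)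
qed

lemma bounded_steps_good: "bounded_steps (space PM - exceptional \<Gamma> \<gamma>) c e f"
  using lip
proof (elim disjE conjE exE)
  assume "one_sided_lipschitz N (outcomes N L) \<Gamma> c d f" "\<forall>k\<in>{1..N}. e k = \<gamma> k * (d k - c k)"
  then show ?thesis
    by (intro bounded_steps_one_sided[OF bm_f_typical \<Gamma>_PM good_subset good_fail _ cd])
      (auto simp: space_PM_eq)
next
  fix r :: "nat \<Rightarrow> real"
  assume "two_sided_lipschitz N (outcomes N L) \<Gamma> c d f"
    and r: "\<forall>k\<in>{1..N}. r k > 0 \<and> (\<forall>\<eta>\<in>space (L k). \<P>(\<omega> in P. X k \<omega> = \<eta>) \<ge> r k)"
    and "\<forall>k\<in>{1..N}. e k = 2 * \<gamma> k * (d k - c k) * inverse (r k)"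
  moreover have "atom_mass (law k) \<eta> (r k)" if "k \<in> {1..N}" "\<eta> \<in> space (law k)" for k \<eta>
    using that r by (intro atom_mass_law) auto
  ultimately show ?thesis
    using \<gamma> by (intro bounded_steps_two_sided[OF bm_f_typical \<Gamma>_PM good_subset good_fail _ cd])
      (auto simp: space_PM_eq less_imp_le)
qed

context
  fixes t :: real
  assumes t: "0 \<le> t"
begin

lemma typical_good:
  "\<P>(\<omega> in P. f (tuple N X \<omega>) \<ge> expectation (\<lambda>\<omega>. f (tuple N X \<omega>)) + t
      \<and> tuple N X \<omega> \<notin> exceptional \<Gamma> \<gamma>)
    \<le> exp_neg_ratio (t\<^sup>2) (2 * (MAX Q\<in>query_sets N (outcomes N L) q. \<Sum>k\<in>Q. (c k + e k)\<^sup>2))"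
  unfolding prob_tail[OF f exceptional_sets_L] expectation_tuple[OF f]
  by (rule tail_bounded_steps(1)[OF bm_f_typical good_sets valid_strategy t bounded_steps_good
        sum_queries_le_Max])

lemma typical_good_two_points:
  assumes "\<forall>k\<in>{1..N}. card (space (L k)) = 2"
  shows "\<P>(\<omega> in P. f (tuple N X \<omega>) \<ge> expectation (\<lambda>\<omega>. f (tuple N X \<omega>)) + t
      \<and> tuple N X \<omega> \<notin> exceptional \<Gamma> \<gamma>)
    \<le> exp_neg_ratio (4 * t\<^sup>2) (2 * (MAX Q\<in>query_sets N (outcomes N L) q. \<Sum>k\<in>Q. (c k + e k)\<^sup>2))"
  unfolding prob_tail[OF f exceptional_sets_L] expectation_tuple[OF f]
  by (rule tail_bounded_steps(2)[OF bm_f_typical good_sets valid_strategy t bounded_steps_good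
        sum_queries_le_Max]) (use assms in auto)

lemma typical_good_binary:
  assumes uv: "u \<noteq> v" and bin: "\<And>k. k \<in> {1..N} \<Longrightarrow> space (L k) = {u, v} \<and> sets (L k) = Pow {u, v}"
    and p: "\<And>k. k \<in> {1..N} \<Longrightarrow> p k = \<P>(\<omega> in P. X k \<omega> = v)"
  defines "C \<equiv> MAX Q\<in>query_sets N (outcomes N L) q. MAX k\<in>Q. c k + e k"
    and "V \<equiv> MAX Q\<in>query_sets N (outcomes N L) q. \<Sum>k\<in>Q. (1 - p k) * p k * (c k + e k)\<^sup>2"
  shows "\<P>(\<omega> in P. f (tuple N X \<omega>) \<ge> expectation (\<lambda>\<omega>. f (tuple N X \<omega>)) + t
      \<and> tuple N X \<omega> \<notin> exceptional \<Gamma> \<gamma>)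
      \<le> exp_neg_ratio (t\<^sup>2) (2 * V + 2 * C * t / 3)"
    and "V > 0 \<and> C > 0 \<longrightarrow>
      \<P>(\<omega> in P. f (tuple N X \<omega>) \<ge> expectation (\<lambda>\<omega>. f (tuple N X \<omega>)) + t
      \<and> tuple N X \<omega> \<notin> exceptional \<Gamma> \<gamma>)
      \<le> exp (- (V / C\<^sup>2) * phi (C * t / V))"
proof -
  have bin': "space (law k) = {u, v} \<and> sets (law k) = Pow {u, v}" if "k \<in> {1..N}" for k
    using bin[OF that] by simp
  have p': "p k = measure (law k) {v}" if "k \<in> {1..N}" for k
    using binary_law[OF _ _ that] bin[OF that] p[OF that] by auto
  have C: "c k + e k \<le> C" if "x \<in> space PM" "k \<in> (\<lambda>i. q i x) ` {1..N}" for x k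
    unfolding C_def by (rule queried_le_Max[OF that])
  have V: "(\<Sum>k\<in>(\<lambda>i. q i x) ` {1..N}. (1 - p k) * p k * (c k + e k)\<^sup>2) \<le> V" if "x \<in> space PM" for x
    unfolding V_def by (rule sum_queries_le_Max[OF that])
  note tail = tail_binary[OF bm_f_typical good_sets valid_strategy t bounded_steps_good C uv bin' p' V]
  show "\<P>(\<omega> in P. f (tuple N X \<omega>) \<ge> expectation (\<lambda>\<omega>. f (tuple N X \<omega>)) + t
      \<and> tuple N X \<omega> \<notin> exceptional \<Gamma> \<gamma>)
      \<le> exp_neg_ratio (t\<^sup>2) (2 * V + 2 * C * t / 3)"
    unfolding prob_tail[OF f exceptional_sets_L] expectation_tuple[OF f] by (rule tail(1))
  show "V > 0 \<and> C > 0 \<longrightarrow>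
      \<P>(\<omega> in P. f (tuple N X \<omega>) \<ge> expectation (\<lambda>\<omega>. f (tuple N X \<omega>)) + t
      \<and> tuple N X \<omega> \<notin> exceptional \<Gamma> \<gamma>)
      \<le> exp (- (V / C\<^sup>2) * phi (C * t / V))"
    unfolding prob_tail[OF f exceptional_sets_L] expectation_tuple[OF f] by (intro impI, elim conjE, rule tail(2))
qed

lemma typical_good_atom:
  assumes p: "\<And>k. k \<in> {1..N} \<Longrightarrow> 0 \<le> p k \<and> p k < 1 \<and>
    (\<exists>\<eta>\<in>space (L k). \<P>(\<omega> in P. X k \<omega> = \<eta>) \<ge> 1 - p k)"
  shows "\<P>(\<omega> in P. f (tuple N X \<omega>) \<ge> expectation (\<lambda>\<omega>. f (tuple N X \<omega>)) + t
      \<and> tuple N X \<omega> \<notin> exceptional \<Gamma> \<gamma>)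
    \<le> exp_neg_ratio (t\<^sup>2) (2 * (MAX Q\<in>query_sets N (outcomes N L) q.
        \<Sum>k\<in>Q. p k * (c k + e k * inverse (1 - p k))\<^sup>2)
      + 2 * (MAX Q\<in>query_sets N (outcomes N L) q. MAX k\<in>Q. c k + e k) * t / 3)"
  unfolding prob_tail[OF f exceptional_sets_L] expectation_tuple[OF f]
proof (rule tail_atom[OF bm_f_typical good_sets valid_strategy t bounded_steps_good
      queried_le_Max _ sum_queries_le_Max])
  fix k assume k: "k \<in> {1..N}"
  then obtain \<eta> where \<eta>: "\<eta> \<in> space (L k)" "1 - p k \<le> \<P>(\<omega> in P. X k \<omega> = \<eta>)" using p by blast
  then show "0 \<le> p k \<and> p k < 1 \<and> (\<exists>\<eta>. atom_mass (law k) \<eta> (1 - p k))"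
    using p[OF k] atom_mass_law[OF k \<eta>] by blast
qed

end

end

context
  fixes G :: "nat \<Rightarrow> 'a set" and c d e :: "nat \<Rightarrow> real" and s \<Delta> t :: real
  assumes G: "\<And>k. k \<in> {1..N} \<Longrightarrow> G k \<in> sets (L k)" and \<Gamma>G: "\<Gamma> \<subseteq> (\<Pi>\<^sub>E k\<in>{1..N}. G k)"
    and cd: "\<And>k. k \<in> {1..N} \<Longrightarrow> c k \<le> d k"
    and lip: "one_sided_lipschitz N (\<Pi>\<^sub>E k\<in>{1..N}. G k) \<Gamma> c d f"
    and s: "\<And>x y. x \<in> outcomes N L \<Longrightarrow> y \<in> outcomes N L \<Longrightarrow> \<bar>f x - f y\<bar> \<le> s"
    and \<Delta>: "\<Delta> = s * \<P>(\<omega> in P. tuple N X \<omega> \<notin> \<Gamma>) \<or>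
      \<Delta> = 0 \<and>
      (\<forall>k\<in>{1..N}. \<forall>x\<in>outcomes N L. \<forall>y\<in>outcomes N L.
        differ_only k x y \<and> x k \<in> space (L k) - G k \<and> y k \<in> G k \<longrightarrow> f x \<ge> f y)"
    and e: "\<And>k. k \<in> {1..N} \<Longrightarrow> e k = \<gamma> k * (d k - c k)"
    and t: "0 \<le> t"
begin

lemma bm_f_cond: "bm f"
  by (rule bm_osc[OF borel_PM[OF f], of s]) (rule s, auto simp: space_PM_eq)

lemma fin_prod_cond_law:
  assumes "measure PM \<Gamma> \<noteq> 0"
  shows "fin_prod_cond N law G"
proof
  fix k assume k: "k \<in> {1..N}"
  show "G k \<in> sets (law k)" using G[OF k] by simp
  show "0 < measure (law k) (G k)" by (rule law_pos[OF k G[OF k] \<Gamma>_PM \<Gamma>G assms])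
qed

context
  assumes null: "measure PM \<Gamma> \<noteq> 0"
begin

interpretation fin_prod_cond N law G by (rule fin_prod_cond_law[OF null])

lemma valid_strategy_cond: "R.valid_queries (\<lambda>x. (\<lambda>i. q i x) ` {1..N}) f"
  by (rule R.valid_queries_strategy[OF q incr N_pos refl]) (use space_R_sub space_PM_eq in auto)

lemma sum_queries_le_Max_cond:
  fixes h :: "nat \<Rightarrow> real"
  assumes "x \<in> space R.PM"
  shows "(\<Sum>k\<in>(\<lambda>i. q i x) ` {1..N}. h k) \<le> (MAX Q\<in>query_sets N (outcomes N L) q. \<Sum>k\<in>Q. h k)"
  using sum_queries_le_Max assms space_R_sub by blast

text \<open>In the first case the shift is at most \<open>s\<close> times the probability of leaving
  the box, which is at most that of leaving \<Gamma>; in the second, conditioning lowers the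
  mean.\<close>

lemma mean_cond: "(\<integral>x. f x \<partial>R.PM) \<le> (\<integral>x. f x \<partial>PM) + \<Delta>"
  using \<Delta>
proof
  assume \<Delta>: "\<Delta> = s * \<P>(\<omega> in P. tuple N X \<omega> \<notin> \<Gamma>)"
  have eq: "{x\<in>space PM. x \<notin> \<Gamma>} = space PM - \<Gamma>" by auto
  have "\<P>(\<omega> in P. tuple N X \<omega> \<notin> \<Gamma>) = measure PM (space PM - \<Gamma>)"
    using prob_tuple[of "\<lambda>x. x \<notin> \<Gamma>"] \<Gamma>_PM unfolding eq by auto
  moreover have "s * measure PM (space PM - space R.PM) \<le> s * measure PM (space PM - \<Gamma>)"
  proof (intro mult_left_mono PM.finite_measure_mono)
    show "space PM - space R.PM \<subseteq> space PM - \<Gamma>" using \<Gamma>G unfolding space_R by auto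
    obtain x0 where "x0 \<in> space PM" using PM.not_empty by blast
    then show "0 \<le> s" using s[of x0 x0] unfolding space_PM_eq by simp
  qed (use \<Gamma>_PM in auto)
  moreover have "(\<integral>x. f x \<partial>R.PM) \<le> (\<integral>x. f x \<partial>PM) + s * measure PM (space PM - space R.PM)"
    by (rule integral_cond_le_add[OF bm_f_cond s]) (auto simp: space_PM_eq)
  ultimately show ?thesis using \<Delta> by simp
next
  assume *: "\<Delta> = 0 \<and> (\<forall>k\<in>{1..N}. \<forall>x\<in>outcomes N L. \<forall>y\<in>outcomes N L.
    differ_only k x y \<and> x k \<in> space (L k) - G k \<and> y k \<in> G k \<longrightarrow> f x \<ge> f y)"
  have "(\<integral>x. f x \<partial>R.PM) \<le> (\<integral>x. f x \<partial>PM)"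
  proof (rule integral_cond_le[OF bm_f_cond])
    fix k x y assume k: "k \<in> {1..N}" and xy: "x \<in> space PM" "y \<in> space PM" "differ_only k x y"
      and xk: "x k \<notin> G k" and yk: "y k \<in> G k"
    have "x k \<in> space (L k)" using xy(1) k unfolding space_PM_eq by (rule PiE_mem)
    then show "f y \<le> f x" using * k xy xk yk unfolding space_PM_eq by blast
  qed
  then show ?thesis using * by simp
qed

lemma tail_good_cond:
  "measure PM {x\<in>space PM. (\<integral>x. f x \<partial>PM) + t + \<Delta> \<le> f x \<and> x \<in> space PM - exceptional \<Gamma> \<gamma>}
    \<le> exp_neg_ratio (t\<^sup>2) (2 * (MAX Q\<in>query_sets N (outcomes N L) q. \<Sum>k\<in>Q. (c k + e k)\<^sup>2))"
proof (rule tail_cond[OF borel_PM[OF f] good_sets _ mean_cond])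
  let ?E = "space PM - exceptional \<Gamma> \<gamma>"
  have \<Gamma>R: "\<Gamma> \<subseteq> space R.PM" using \<Gamma>G unfolding space_R .
  show E: "?E \<subseteq> space R.PM" using good_subset \<Gamma>R by auto
  have \<Gamma>s: "\<Gamma> \<in> sets R.PM" using sets_R[OF \<Gamma>_PM] \<Gamma>R by (simp add: Int_absorb2)
  have Es: "?E \<in> sets R.PM" using sets_R[OF good_sets] E by (simp add: Int_absorb2)
  have steps: "R.bounded_steps ?E c e f"
  proof (rule R.bounded_steps_one_sided[OF bm_R[OF bm_f_cond] \<Gamma>s good_subset])
    \<comment> \<open>The threshold is known for the original failure probability, and the
      conditioned one is no larger.\<close>
    show "R.fail \<Gamma> k x \<le> \<gamma> (Suc k)" if "k < N" "x \<in> ?E" for k x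
      using fail_cond[OF \<Gamma>_PM \<Gamma>R, of k x] good_fail[OF that] that E by fastforce
    show "one_sided_lipschitz N (space R.PM) \<Gamma> c d f" using lip unfolding space_R .
  qed (use cd e in auto)
  show "measure R.PM {x\<in>space R.PM. (\<integral>x. f x \<partial>R.PM) + t \<le> f x \<and> x \<in> ?E}
    \<le> exp_neg_ratio (t\<^sup>2) (2 * (MAX Q\<in>query_sets N (outcomes N L) q. \<Sum>k\<in>Q. (c k + e k)\<^sup>2))"
    by (rule R.tail_bounded_steps(1)[OF bm_R[OF bm_f_cond] Es valid_strategy_cond t steps
          sum_queries_le_Max_cond])
qed

text \<open>If \<Gamma> is the whole box, no point of the conditioned product lies outside it, so
  \<open>f\<close> is Lipschitz there with the constants \<open>c\<close> and the range is bounded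
  directly.\<close>

lemma tail_box_cond:
  assumes \<Gamma>_eq: "\<Gamma> = (\<Pi>\<^sub>E k\<in>{1..N}. G k)"
  shows "measure PM {x\<in>space PM. (\<integral>x. f x \<partial>PM) + t + \<Delta> \<le> f x \<and> x \<in> \<Gamma>}
    \<le> exp_neg_ratio (4 * t\<^sup>2) (2 * (MAX Q\<in>query_sets N (outcomes N L) q. \<Sum>k\<in>Q. (c k)\<^sup>2))"
proof (rule tail_cond[OF borel_PM[OF f] \<Gamma>_PM _ mean_cond])
  have \<Gamma>R: "\<Gamma> = space R.PM" unfolding \<Gamma>_eq space_R ..
  then show "\<Gamma> \<subseteq> space R.PM" by simp
  have "measure R.PM {x\<in>space R.PM. (\<integral>x. f x \<partial>R.PM) + t \<le> f x \<and> x \<in> \<Gamma>}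
    \<le> exp_neg_ratio (2 * t\<^sup>2) (MAX Q\<in>query_sets N (outcomes N L) q. \<Sum>k\<in>Q. (c k)\<^sup>2)"
  proof (rule R.tail_lipschitz[OF bm_R[OF bm_f_cond] _ valid_strategy_cond t _ sum_queries_le_Max_cond])
    show "\<Gamma> \<in> sets R.PM" unfolding \<Gamma>R by simp
    fix k x y assume "k \<in> {1..N}" "x \<in> space R.PM" "y \<in> space R.PM" "differ_only k x y"
    then have "\<bar>f x - f y\<bar> \<le> (if x \<in> \<Gamma> then c k else d k)" "x \<in> \<Gamma>"
      using lip \<Gamma>R unfolding one_sided_lipschitz_def \<Gamma>_eq[symmetric] by auto
    then show "\<bar>f x - f y\<bar> \<le> c k" by simp
  qed
  then show "measure R.PM {x\<in>space R.PM. (\<integral>x. f x \<partial>R.PM) + t \<le> f x \<and> x \<in> \<Gamma>}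
    \<le> exp_neg_ratio (4 * t\<^sup>2) (2 * (MAX Q\<in>query_sets N (outcomes N L) q. \<Sum>k\<in>Q. (c k)\<^sup>2))"
    using exp_neg_ratio_mult_cancel[of 2 "2 * t\<^sup>2"] by simp
qed

end

text \<open>If \<Gamma> is null, some factor may be impossible to condition; the tail then has
  probability 0 because it lies inside \<Gamma>.\<close>

lemma null_tail:
  assumes "measure PM \<Gamma> = 0" "E \<in> sets PM" "E \<subseteq> \<Gamma>"
  shows "measure PM {x\<in>space PM. \<phi> x \<and> x \<in> E} \<le> exp_neg_ratio a b"
proof -
  have "measure PM {x\<in>space PM. \<phi> x \<and> x \<in> E} \<le> measure PM \<Gamma>"
    using assms \<Gamma>_PM by (intro PM.finite_measure_mono) auto
  then show ?thesis using assms(1) exp_neg_ratio_nonneg[of a b] by linarith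
qed

lemma typical_cond:
  "\<P>(\<omega> in P. f (tuple N X \<omega>) \<ge> expectation (\<lambda>\<omega>. f (tuple N X \<omega>)) + t + \<Delta>
      \<and> tuple N X \<omega> \<notin> exceptional \<Gamma> \<gamma>)
    \<le> exp_neg_ratio (t\<^sup>2) (2 * (MAX Q\<in>query_sets N (outcomes N L) q. \<Sum>k\<in>Q. (c k + e k)\<^sup>2))"
  unfolding prob_tail[OF f exceptional_sets_L] expectation_tuple[OF f]
  by (cases "measure PM \<Gamma> = 0") (rule null_tail[OF _ good_sets good_subset] tail_good_cond; assumption)+

lemma typical_cond_box:
  assumes "\<Gamma> = (\<Pi>\<^sub>E k\<in>{1..N}. G k)"
  shows "\<P>(\<omega> in P. f (tuple N X \<omega>) \<ge> expectation (\<lambda>\<omega>. f (tuple N X \<omega>)) + t + \<Delta>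
      \<and> tuple N X \<omega> \<notin> outcomes N L - \<Gamma>)
    \<le> exp_neg_ratio (4 * t\<^sup>2) (2 * (MAX Q\<in>query_sets N (outcomes N L) q. \<Sum>k\<in>Q. (c k)\<^sup>2))"
proof -
  have B: "outcomes N L - \<Gamma> \<in> sets (PiM {1..N} L)"
    using sets.compl_sets[OF \<Gamma>] by (simp add: space_PiM)
  have eq: "space PM - (outcomes N L - \<Gamma>) = \<Gamma>"
    unfolding space_PM_eq using sets.sets_into_space[OF \<Gamma>_PM] unfolding space_PM_eq by auto
  show ?thesis
    unfolding prob_tail[OF f B] expectation_tuple[OF f] eq
    by (cases "measure PM \<Gamma> = 0") (rule null_tail[OF _ \<Gamma>_PM order_refl] tail_box_cond[OF _ assms]; assumption)+
qed

end

end

end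

end

section \<open>The monotone case and the final assembly\<close>

lemma typical_harris:
  fixes L :: "nat \<Rightarrow> 'a::zero_neq_one measure" and X :: "nat \<Rightarrow> 'w \<Rightarrow> 'a" and f :: "(nat \<Rightarrow> 'a) \<Rightarrow> real"
    and \<gamma> :: "nat \<Rightarrow> real" and s :: real
  assumes "indep_family P N L X" and bin: "binary_spaces N L"
    and f: "f \<in> borel_measurable (PiM {1..N} L)" and \<Gamma>: "\<Gamma> \<in> sets (PiM {1..N} L)"
    and mono: "cube_increasing N f \<and> cube_increasing N (indicator \<Gamma>) \<or>
      cube_decreasing N f \<and> cube_decreasing N (indicator \<Gamma>)"
  defines "B \<equiv> fin_prod.exceptional N (\<lambda>k. distr P (L k) (X k)) \<Gamma> \<gamma>"
  assumes B1: "\<P>(\<omega> in P. tuple N X \<omega> \<in> B) < 1"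
  shows "\<P>(\<omega> in P. f (tuple N X \<omega>) \<ge> s)
    \<le> \<P>(\<omega> in P. f (tuple N X \<omega>) \<ge> s \<and> tuple N X \<omega> \<notin> B) / (1 - \<P>(\<omega> in P. tuple N X \<omega> \<in> B))"
proof -
  interpret indep_family P N L X by fact
  have fp: "fin_prod N law" ..
  have bin': "binary_spaces N law" using bin unfolding binary_spaces_def by simp
  have \<Gamma>': "\<Gamma> \<in> sets PM" using \<Gamma> sets_PM by simp
  have B: "B \<in> sets PM" unfolding B_def by (rule sets_exceptional[OF \<Gamma>'])
  have B_eq: "{x\<in>space PM. x \<in> B} = B" using sets.sets_into_space[OF B] by auto
  have PB: "\<P>(\<omega> in P. tuple N X \<omega> \<in> B) = measure PM B"
    using prob_tuple[of "\<lambda>x. x \<in> B"] B unfolding B_eq by simp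
  have "measure PM {x\<in>space PM. s \<le> f x} * measure PM (space PM - B)
      \<le> measure PM {x\<in>space PM. s \<le> f x \<and> x \<in> space PM - B}"
    unfolding B_def by (rule exceptional_harris[OF fp bin' borel_PM[OF f] \<Gamma>' mono])
  moreover have "measure PM (space PM - B) = 1 - measure PM B" by (rule PM.prob_compl[OF B])
  moreover have "{x\<in>space PM. s \<le> f x \<and> x \<in> space PM} = {x\<in>space PM. s \<le> f x}" by auto
  moreover have "B \<in> sets (PiM {1..N} L)" using B sets_PM by simp
  ultimately show ?thesis
    using B1 unfolding PB by (simp only: prob_tail[OF f] prob_tail'[OF f]) (simp add: pos_le_divide_eq)
qed

theorem theorem14:
  fixes P :: "'w measure" and N :: nat
    and L :: "nat \<Rightarrow> 'a::zero_neq_one measure" and X :: "nat \<Rightarrow> 'w \<Rightarrow> 'a"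
  assumes "prob_space P" and "1 \<le> N" and "prob_space.indep_vars P L X {1..N}"
  shows
    \<comment> \<open>(1)\<close>
    "(\<forall>(f :: (nat \<Rightarrow> 'a) \<Rightarrow> real) q (c :: nat \<Rightarrow> real).
        f \<in> borel_measurable (Pi\<^sub>M {1..N} L) \<and>
        query_strategy N (outcomes N L) f q \<and> increasing_queries N (outcomes N L) q \<and>
        (\<forall>k\<in>{1..N}. \<forall>x\<in>outcomes N L. \<forall>y\<in>outcomes N L.
           differ_only k x y \<longrightarrow> \<bar>f x - f y\<bar> \<le> c k) \<longrightarrow>
        (let \<Q> = query_sets N (outcomes N L) q;
             \<mu> = prob_space.expectation P (\<lambda>\<omega>. f (tuple N X \<omega>));
             C = (MAX Q\<in>\<Q>. MAX k\<in>Q. c k)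
         in \<forall>t\<ge>0.
           \<comment> \<open>(1a)\<close>
           \<P>(\<omega> in P. f (tuple N X \<omega>) \<ge> \<mu> + t)
             \<le> exp_neg_ratio (2 * t\<^sup>2) (MAX Q\<in>\<Q>. \<Sum>k\<in>Q. (c k)\<^sup>2) \<and>
           \<comment> \<open>(1b)\<close>
           (\<forall>p. binary_spaces N L \<and> (\<forall>k\<in>{1..N}. p k = \<P>(\<omega> in P. X k \<omega> = 1)) \<longrightarrow>
             (let V = (MAX Q\<in>\<Q>. \<Sum>k\<in>Q. (1 - p k) * p k * (c k)\<^sup>2)
              in \<P>(\<omega> in P. f (tuple N X \<omega>) \<ge> \<mu> + t)
                   \<le> exp_neg_ratio (t\<^sup>2) (2 * V + 2 * C * t / 3) \<and>
                 (V > 0 \<and> C > 0 \<longrightarrow>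
                   \<P>(\<omega> in P. f (tuple N X \<omega>) \<ge> \<mu> + t) \<le> exp (- (V / C\<^sup>2) * phi (C * t / V))))) \<and>
           \<comment> \<open>(1c)\<close>
           (\<forall>p. (\<forall>k\<in>{1..N}. \<exists>\<eta>\<in>space (L k). \<P>(\<omega> in P. X k \<omega> = \<eta>) \<ge> 1 - p k) \<longrightarrow>
             (let V' = (MAX Q\<in>\<Q>. \<Sum>k\<in>Q. p k * (c k)\<^sup>2)
              in \<P>(\<omega> in P. f (tuple N X \<omega>) \<ge> \<mu> + t)
                   \<le> exp_neg_ratio (t\<^sup>2) (2 * V' + 2 * C * t / 3)))))
     \<and>
     \<comment> \<open>(2)\<close>
     (\<forall>\<Gamma> (\<gamma> :: nat \<Rightarrow> real).
        \<Gamma> \<in> sets (Pi\<^sub>M {1..N} L) \<and> (\<forall>k\<in>{1..N}. 0 < \<gamma> k \<and> \<gamma> k \<le> 1) \<longrightarrow>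
        (\<exists>B. exceptional_event P N L X \<Gamma> \<gamma> B \<and>
          (\<forall>(f :: (nat \<Rightarrow> 'a) \<Rightarrow> real) q (c :: nat \<Rightarrow> real) (d :: nat \<Rightarrow> real) (e :: nat \<Rightarrow> real).
            f \<in> borel_measurable (Pi\<^sub>M {1..N} L) \<and>
            query_strategy N (outcomes N L) f q \<and> increasing_queries N (outcomes N L) q \<and>
            (\<forall>k\<in>{1..N}. c k \<le> d k) \<and>
            (\<comment> \<open>(i)\<close>
             one_sided_lipschitz N (outcomes N L) \<Gamma> c d f \<and>
             (\<forall>k\<in>{1..N}. e k = \<gamma> k * (d k - c k))
             \<or>
             \<comment> \<open>(ii)\<close>
             two_sided_lipschitz N (outcomes N L) \<Gamma> c d f \<and>
             (\<exists>r :: nat \<Rightarrow> real.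
               (\<forall>k\<in>{1..N}. r k > 0 \<and> (\<forall>\<eta>\<in>space (L k). \<P>(\<omega> in P. X k \<omega> = \<eta>) \<ge> r k)) \<and>
               (\<forall>k\<in>{1..N}. e k = 2 * \<gamma> k * (d k - c k) * inverse (r k)))) \<longrightarrow>
            (let \<Q> = query_sets N (outcomes N L) q;
                 \<mu> = prob_space.expectation P (\<lambda>\<omega>. f (tuple N X \<omega>));
                 C = (MAX Q\<in>\<Q>. MAX k\<in>Q. c k + e k);
                 W = (MAX Q\<in>\<Q>. \<Sum>k\<in>Q. (c k + e k)\<^sup>2)
             in \<forall>t\<ge>0.
               \<comment> \<open>(2a)\<close>
               \<P>(\<omega> in P. f (tuple N X \<omega>) \<ge> \<mu> + t \<and> tuple N X \<omega> \<notin> B) \<le> exp_neg_ratio (t\<^sup>2) (2 * W) \<and>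
               ((\<forall>k\<in>{1..N}. card (space (L k)) = 2) \<longrightarrow>
                 \<P>(\<omega> in P. f (tuple N X \<omega>) \<ge> \<mu> + t \<and> tuple N X \<omega> \<notin> B)
                   \<le> exp_neg_ratio (4 * t\<^sup>2) (2 * W)) \<and>
               \<comment> \<open>(2b)\<close>
               (\<forall>p. binary_spaces N L \<and> (\<forall>k\<in>{1..N}. p k = \<P>(\<omega> in P. X k \<omega> = 1)) \<longrightarrow>
                 (let V = (MAX Q\<in>\<Q>. \<Sum>k\<in>Q. (1 - p k) * p k * (c k + e k)\<^sup>2)
                  in \<P>(\<omega> in P. f (tuple N X \<omega>) \<ge> \<mu> + t \<and> tuple N X \<omega> \<notin> B)
                       \<le> exp_neg_ratio (t\<^sup>2) (2 * V + 2 * C * t / 3) \<and>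
                     (V > 0 \<and> C > 0 \<longrightarrow>
                       \<P>(\<omega> in P. f (tuple N X \<omega>) \<ge> \<mu> + t \<and> tuple N X \<omega> \<notin> B)
                         \<le> exp (- (V / C\<^sup>2) * phi (C * t / V)))) \<and>
                 (one_sided_lipschitz N (outcomes N L) \<Gamma> c d f \<and>
                  (cube_increasing N f \<and> cube_increasing N (indicator \<Gamma>) \<or>
                   cube_decreasing N f \<and> cube_decreasing N (indicator \<Gamma>)) \<and>
                  \<P>(\<omega> in P. tuple N X \<omega> \<in> B) < 1 \<longrightarrow>
                    \<P>(\<omega> in P. f (tuple N X \<omega>) \<ge> \<mu> + t)
                      \<le> \<P>(\<omega> in P. f (tuple N X \<omega>) \<ge> \<mu> + t \<and> tuple N X \<omega> \<notin> B)
                        / (1 - \<P>(\<omega> in P. tuple N X \<omega> \<in> B)))) \<and>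
               \<comment> \<open>(2c)\<close>
               (\<forall>p. (\<forall>k\<in>{1..N}. 0 \<le> p k \<and> p k < 1 \<and>
                       (\<exists>\<eta>\<in>space (L k). \<P>(\<omega> in P. X k \<omega> = \<eta>) \<ge> 1 - p k)) \<longrightarrow>
                 (let V' = (MAX Q\<in>\<Q>. \<Sum>k\<in>Q. p k * (c k + e k * inverse (1 - p k))\<^sup>2)
                  in \<P>(\<omega> in P. f (tuple N X \<omega>) \<ge> \<mu> + t \<and> tuple N X \<omega> \<notin> B)
                       \<le> exp_neg_ratio (t\<^sup>2) (2 * V' + 2 * C * t / 3)))))))
     \<and>
     \<comment> \<open>(3)\<close>
     (\<forall>\<Gamma> (\<gamma> :: nat \<Rightarrow> real).
        \<Gamma> \<in> sets (Pi\<^sub>M {1..N} L) \<and> (\<forall>k\<in>{1..N}. 0 < \<gamma> k \<and> \<gamma> k \<le> 1) \<longrightarrow>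
        (\<exists>B. exceptional_event P N L X \<Gamma> \<gamma> B \<and>
          (\<forall>G (f :: (nat \<Rightarrow> 'a) \<Rightarrow> real) q (c :: nat \<Rightarrow> real) (d :: nat \<Rightarrow> real) (e :: nat \<Rightarrow> real)
              (s :: real) (\<Delta> :: real).
            (\<forall>k\<in>{1..N}. G k \<in> sets (L k)) \<and> \<Gamma> \<subseteq> (\<Pi>\<^sub>E k\<in>{1..N}. G k) \<and>
            f \<in> borel_measurable (Pi\<^sub>M {1..N} L) \<and>
            query_strategy N (outcomes N L) f q \<and> increasing_queries N (outcomes N L) q \<and>
            (\<forall>k\<in>{1..N}. c k \<le> d k) \<and>
            one_sided_lipschitz N (\<Pi>\<^sub>E k\<in>{1..N}. G k) \<Gamma> c d f \<and>
            (\<forall>x\<in>outcomes N L. \<forall>y\<in>outcomes N L. \<bar>f x - f y\<bar> \<le> s) \<and>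
            (\<Delta> = s * \<P>(\<omega> in P. tuple N X \<omega> \<notin> \<Gamma>) \<or>
             \<Delta> = 0 \<and>
             (\<forall>k\<in>{1..N}. \<forall>x\<in>outcomes N L. \<forall>y\<in>outcomes N L.
                differ_only k x y \<and> x k \<in> space (L k) - G k \<and> y k \<in> G k \<longrightarrow> f x \<ge> f y)) \<and>
            (\<forall>k\<in>{1..N}. e k = \<gamma> k * (d k - c k)) \<longrightarrow>
            (let \<Q> = query_sets N (outcomes N L) q;
                 \<mu> = prob_space.expectation P (\<lambda>\<omega>. f (tuple N X \<omega>))
             in (\<forall>t\<ge>0.
                   \<P>(\<omega> in P. f (tuple N X \<omega>) \<ge> \<mu> + t + \<Delta> \<and> tuple N X \<omega> \<notin> B)
                     \<le> exp_neg_ratio (t\<^sup>2) (2 * (MAX Q\<in>\<Q>. \<Sum>k\<in>Q. (c k + e k)\<^sup>2))) \<and>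
                (\<Gamma> = (\<Pi>\<^sub>E k\<in>{1..N}. G k) \<longrightarrow>
                   exceptional_event P N L X \<Gamma> \<gamma> (outcomes N L - \<Gamma>) \<and>
                   (\<forall>t\<ge>0.
                      \<P>(\<omega> in P. f (tuple N X \<omega>) \<ge> \<mu> + t + \<Delta> \<and> tuple N X \<omega> \<notin> outcomes N L - \<Gamma>)
                        \<le> exp_neg_ratio (4 * t\<^sup>2) (2 * (MAX Q\<in>\<Q>. \<Sum>k\<in>Q. (c k)\<^sup>2))))))))"
proof -
  have "indep_family P N L X"
    by (rule indep_family.intro[OF assms(1) indep_family_axioms.intro[OF assms(2,3)]])
  then interpret I: indep_family P N L X .
  have ifam: "indep_family P N L X" by (rule I.indep_family_axioms)
  have binD: "space (L k) = {0, 1} \<and> sets (L k) = Pow {0, 1}" if "binary_spaces N L" "k \<in> {1..N}" for k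
    using that unfolding binary_spaces_def by (rule bspec)
  have 01: "(0::'a) \<noteq> 1" by simp
  show ?thesis
    unfolding Let_def
  proof (intro conjI, goal_cases)
    case 1
    show ?case
    proof (intro allI impI, elim conjE, goal_cases)
      case (1 f q c t)
      note fq = 1(2,3,4)
      have lip: "\<bar>f x - f y\<bar> \<le> c k"
        if "k \<in> {1..N}" "x \<in> outcomes N L" "y \<in> outcomes N L" "differ_only k x y" for k x y
        using 1(5) that by blast
      note hyps = fq lip 1(1)
      show ?case
      proof (intro conjI, goal_cases)
        case 1
        show ?case by (rule I.typical_hoeffding[OF hyps])
      next
        case 2
        show ?case
        proof (intro allI impI, elim conjE, goal_cases)
          case (1 p)
          have p: "p k = \<P>(\<omega> in P. X k \<omega> = 1)" if "k \<in> {1..N}" for k using 1(2) that by blast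
          show ?case by (rule conjI[OF I.typical_binary[OF hyps 01 binD[OF 1(1)] p]])
        qed
      next
        case 3
        show ?case
        proof (intro allI impI, goal_cases)
          case (1 p)
          have p: "\<exists>\<eta>\<in>space (L k). \<P>(\<omega> in P. X k \<omega> = \<eta>) \<ge> 1 - p k" if "k \<in> {1..N}" for k
            using 1 that by blast
          show ?case by (rule I.typical_atom[OF hyps p])
        qed
      qed
    qed
  next
    case 2
    show ?case
    proof (intro allI impI, elim conjE, goal_cases)
      case (1 \<Gamma> \<gamma>)
      note \<Gamma> = 1(1)
      have \<gamma>: "0 < \<gamma> k \<and> \<gamma> k \<le> 1" if "k \<in> {1..N}" for k using 1(2) that by blast
      show ?case
      proof (rule exI[of _ "I.exceptional \<Gamma> \<gamma>"], rule conjI, goal_cases)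
        case 1
        show ?case by (rule I.exceptional_event_exceptional[OF \<Gamma> \<gamma>])
      next
        case 2
        show ?case
        proof (intro allI impI, elim conjE, goal_cases)
          case (1 f q c d e t)
          note fq = 1(2,3,4)
          have cd: "c k \<le> d k" if "k \<in> {1..N}" for k using 1(5) that by blast
          note hyps = fq \<Gamma> \<gamma> cd 1(6) 1(1)
          show ?case
          proof (intro conjI, goal_cases)
            case 1
            show ?case by (rule I.typical_good[OF hyps])
          next
            case 2
            show ?case using I.typical_good_two_points[OF hyps] by (rule impI)
          next
            case 3
            show ?case
            proof (intro allI impI, elim conjE, goal_cases)
              case (1 p)
              have p: "p k = \<P>(\<omega> in P. X k \<omega> = 1)" if "k \<in> {1..N}" for k using 1(2) that by blast
              show ?case
              proof (intro conjI, goal_cases)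
                case 1
                show ?case by (rule I.typical_good_binary(1)[OF hyps 01 binD[OF \<open>binary_spaces N L\<close>] p])
              next
                case 2
                show ?case by (rule I.typical_good_binary(2)[OF hyps 01 binD[OF \<open>binary_spaces N L\<close>] p])
              next
                case 3
                show ?case
                proof (intro impI, elim conjE, goal_cases)
                  case 1
                  show ?case
                    by (rule typical_harris[OF ifam \<open>binary_spaces N L\<close> fq(1) \<Gamma> 1(2,3)])
                qed
              qed
            qed
          next
            case 4
            show ?case
            proof (intro allI impI, goal_cases)
              case (1 p)
              have p: "0 \<le> p k \<and> p k < 1 \<and> (\<exists>\<eta>\<in>space (L k). \<P>(\<omega> in P. X k \<omega> = \<eta>) \<ge> 1 - p k)"
                if "k \<in> {1..N}" for k using 1 that by blast
              show ?case by (rule I.typical_good_atom[OF hyps p])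
            qed
          qed
        qed
      qed
    qed
  next
    case 3
    show ?case
    proof (intro allI impI, elim conjE, goal_cases)
      case (1 \<Gamma> \<gamma>)
      note \<Gamma> = 1(1)
      have \<gamma>: "0 < \<gamma> k \<and> \<gamma> k \<le> 1" if "k \<in> {1..N}" for k using 1(2) that by blast
      show ?case
      \<comment> \<open>The same event as before, formed with the unconditioned laws, because the
        sets \<open>G k\<close> are chosen only after it.\<close>
      proof (rule exI[of _ "I.exceptional \<Gamma> \<gamma>"], rule conjI, goal_cases)
        case 1
        show ?case by (rule I.exceptional_event_exceptional[OF \<Gamma> \<gamma>])
      next
        case 2
        show ?case
        proof (intro allI impI, elim conjE, goal_cases)
          case (1 G f q c d e s \<Delta>)
          note fq = 1(3,4,5)
          have G: "G k \<in> sets (L k)" if "k \<in> {1..N}" for k using 1(1) that by blast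
          have cd: "c k \<le> d k" if "k \<in> {1..N}" for k using 1(6) that by blast
          have s: "\<bar>f x - f y\<bar> \<le> s" if "x \<in> outcomes N L" "y \<in> outcomes N L" for x y
            using 1(8) that by blast
          have e: "e k = \<gamma> k * (d k - c k)" if "k \<in> {1..N}" for k using 1(10) that by blast
          note hyps = fq \<Gamma> \<gamma> G 1(2) cd 1(7) s 1(9) e
          show ?case
          proof (intro conjI allI impI, goal_cases)
            case (1 t)
            show ?case by (rule I.typical_cond[OF hyps 1])
          next
            case 2
            show ?case by (rule I.exceptional_event_compl[OF \<Gamma> \<gamma>])
          next
            case (3 t)
            show ?case by (rule I.typical_cond_box[OF hyps 3(2,1)])
          qed
        qed
      qed
    qed
  qed
qed

end
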